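(* Let $\sigma\ge1$, $\delta\in(\frac\sigma2,\sigma)$ and $m\in[1,2)$. For every space dimension $n\ge1$, every $a\ge0$ and $j\in\{0,1\}$, the Sobolev solutions $w$ to $$w_{tt}+(-\Delta)^\sigma w+(-\Delta)^\delta w_t=0,\quad w(0,x)=w_0(x),\quad w_t(0,x)=w_1(x)\qquad (t\ge0,\ x\in\mathbb{R}^n)$$ satisfy the $(L^m\cap L^2)-L^2$ estimates $$\big\|\partial_t^j|D|^aw(t,\cdot)\big\|_{L^2}\lesssim(1+t)^{-\frac{n}{2\delta}(\frac1m-\frac12)-\frac{a+j\sigma}{2\delta}}\|w_0\|_{L^m\cap H^{a+2j(\sigma-\delta)}}+(1+t)^{1-\frac{n}{2\delta}(\frac1m-\frac12)-\frac{a+j\sigma}{2\delta}}\|w_1\|_{L^m\cap H^{[a+2(j-1)\delta]^+}},$$ and the $L^2-L^2$ estimates $$\big\|\partial_t^j|D|^aw(t,\cdot)\big\|_{L^2}\lesssim(1+t)^{-\frac{a+j\sigma}{2\delta}}\|w_0\|_{H^{a+2j(\sigma-\delta)}}+(1+t)^{1-\frac{a+j\sigma}{2\delta}}\|w_1\|_{H^{[a+2(j-1)\delta]^+}}.$$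
   Context: $[s]^+:=\max\{s,0\}$; $H^a$ is the $L^2$-based Bessel potential space on $\mathbb{R}^n$; $|D|^a$ and $(-\Delta)^a$ are the Fourier multipliers with symbols $|\xi|^a$ and $|\xi|^{2a}$; $\|\cdot\|_{L^m\cap H^s}=\|\cdot\|_{L^m}+\|\cdot\|_{H^s}$; $f\lesssim g$ means $f\le Cg$ with $C>0$ independent of $t\ge0$ and of the data. The solution is the one given on the Fourier side by $\hat w=\frac{\lambda_1e^{\lambda_2t}-\lambda_2e^{\lambda_1t}}{\lambda_1-\lambda_2}\hat w_0+\frac{e^{\lambda_1t}-e^{\lambda_2t}}{\lambda_1-\lambda_2}\hat w_1$, $\lambda_{1,2}=\frac12\big(-|\xi|^{2\delta}\pm\sqrt{|\xi|^{4\delta}-4|\xi|^{2\sigma}}\big)$ (limiting values where $\lambda_1=\lambda_2$); the data are any functions for which the norms on the right-hand side are finite. *)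

theory Defs
  imports "HOL-Analysis.Analysis"
begin

section \<open>Lebesgue spaces\<close>

text \<open>Elements of \<open>L\<^sup>p\<close> are represented by Borel functions; every Lebesgue measurable function
  agrees almost everywhere with one. The norm is meaningful only together with membership.\<close>

definition in_Lp :: "real \<Rightarrow> (real^'n \<Rightarrow> complex) \<Rightarrow> bool" where
  "in_Lp p f \<longleftrightarrow> f \<in> borel_measurable lborel \<and> integrable lborel (\<lambda>x. norm (f x) powr p)"

definition Lp_norm :: "real \<Rightarrow> (real^'n \<Rightarrow> complex) \<Rightarrow> real" where
  "Lp_norm p f = (LINT x|lborel. norm (f x) powr p) powr (1 / p)"

text \<open>Convergence to \<open>0\<close> in \<open>L\<^sup>2\<close>, phrased with the nonnegative integral, which is \<open>\<infinity>\<close> (and not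
  \<open>0\<close>, as the Bochner integral would be) for a measurable function that is not square integrable.\<close>

definition tendsto_zero_L2 :: "('b \<Rightarrow> real^'n \<Rightarrow> complex) \<Rightarrow> 'b filter \<Rightarrow> bool" where
  "tendsto_zero_L2 h F \<longleftrightarrow>
     ((\<lambda>s. \<integral>\<^sup>+x. ennreal ((norm (h s x))\<^sup>2) \<partial>lborel) \<longlongrightarrow> 0) F"


section \<open>The Fourier transform\<close>

definition fourier_L1 :: "(real^'n \<Rightarrow> complex) \<Rightarrow> real^'n \<Rightarrow> complex" where
  "fourier_L1 f \<xi> =
     of_real ((2 * pi) powr (- real CARD('n) / 2)) * (LINT x|lborel. cis (- (x \<bullet> \<xi>)) * f x)"

text \<open>The Fourier--Plancherel transform: the \<open>L\<^sup>2\<close> limit of the transforms of the truncations of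
  \<open>f\<close>, which are integrable. It is determined up to null sets.\<close>

definition is_fourier :: "(real^'n \<Rightarrow> complex) \<Rightarrow> (real^'n \<Rightarrow> complex) \<Rightarrow> bool" where
  "is_fourier f g \<longleftrightarrow> in_Lp 2 f \<and> in_Lp 2 g \<and>
     tendsto_zero_L2
       (\<lambda>R \<xi>. fourier_L1 (\<lambda>x. indicator (cball 0 R) x * f x) \<xi> - g \<xi>) (at_top :: real filter)"

definition fourier :: "(real^'n \<Rightarrow> complex) \<Rightarrow> real^'n \<Rightarrow> complex" where
  "fourier f = (SOME g. is_fourier f g)"

definition inv_fourier :: "(real^'n \<Rightarrow> complex) \<Rightarrow> real^'n \<Rightarrow> complex" where
  "inv_fourier g = (SOME f. is_fourier f g)"


section \<open>Sobolev spaces and fractional derivatives\<close>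

text \<open>The Bessel potential space \<open>H\<^sup>s\<close> for \<open>s \<ge> 0\<close>, where it is a subspace of \<open>L\<^sup>2\<close>.\<close>

definition in_Hs :: "real \<Rightarrow> (real^'n \<Rightarrow> complex) \<Rightarrow> bool" where
  "in_Hs s f \<longleftrightarrow>
     in_Lp 2 f \<and> in_Lp 2 (\<lambda>\<xi>. of_real ((1 + (norm \<xi>)\<^sup>2) powr (s / 2)) * fourier f \<xi>)"

definition Hs_norm :: "real \<Rightarrow> (real^'n \<Rightarrow> complex) \<Rightarrow> real" where
  "Hs_norm s f = Lp_norm 2 (\<lambda>\<xi>. of_real ((1 + (norm \<xi>)\<^sup>2) powr (s / 2)) * fourier f \<xi>)"

definition Lm_Hs_norm :: "real \<Rightarrow> real \<Rightarrow> (real^'n \<Rightarrow> complex) \<Rightarrow> real" where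
  "Lm_Hs_norm m s f = Lp_norm m f + Hs_norm s f"

text \<open>\<open>|D|\<^sup>a\<close>. For \<open>a = 0\<close> the convention \<open>0 powr 0 = 0\<close> changes the symbol only at the origin.\<close>

definition abs_D :: "real \<Rightarrow> (real^'n \<Rightarrow> complex) \<Rightarrow> real^'n \<Rightarrow> complex" where
  "abs_D a f = inv_fourier (\<lambda>\<xi>. of_real (norm \<xi> powr a) * fourier f \<xi>)"


section \<open>Time derivatives of curves in \<open>L\<^sup>2\<close>\<close>

text \<open>Strong \<open>L\<^sup>2\<close> derivative on \<open>[0, \<infinity>)\<close>, one-sided at \<open>t = 0\<close>.\<close>

definition has_L2_deriv ::
    "(real \<Rightarrow> real^'n \<Rightarrow> complex) \<Rightarrow> (real^'n \<Rightarrow> complex) \<Rightarrow> real \<Rightarrow> bool" where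
  "has_L2_deriv u v t \<longleftrightarrow> in_Lp 2 v \<and>
     tendsto_zero_L2 (\<lambda>s x. (u s x - u t x) / of_real (s - t) - v x) (at t within {0..})"

definition L2_deriv :: "(real \<Rightarrow> real^'n \<Rightarrow> complex) \<Rightarrow> real \<Rightarrow> real^'n \<Rightarrow> complex" where
  "L2_deriv u t = (SOME v. has_L2_deriv u v t)"

definition time_deriv ::
    "nat \<Rightarrow> (real \<Rightarrow> real^'n \<Rightarrow> complex) \<Rightarrow> real \<Rightarrow> real^'n \<Rightarrow> complex" where
  "time_deriv j = L2_deriv ^^ j"


section \<open>The solution of the damped evolution equation\<close>

text \<open>The solution of \<open>w\<^sub>t\<^sub>t + (-\<Delta>)\<^sup>\<sigma> w + (-\<Delta>)\<^sup>\<delta> w\<^sub>t = 0\<close>, \<open>w(0) = w\<^sub>0\<close>, \<open>w\<^sub>t(0) = w\<^sub>1\<close>, given by its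
  Fourier transform; \<open>char_root1\<close> and \<open>char_root2\<close> are the roots of
  \<open>\<lambda>\<^sup>2 + |\<xi>|\<^bsup>2\<delta>\<^esup> \<lambda> + |\<xi>|\<^bsup>2\<sigma>\<^esup> = 0\<close>.\<close>

definition char_root1 :: "real \<Rightarrow> real \<Rightarrow> real^'n \<Rightarrow> complex" where
  "char_root1 \<sigma> \<delta> \<xi> =
     (- of_real (norm \<xi> powr (2 * \<delta>))
      + csqrt (of_real (norm \<xi> powr (4 * \<delta>) - 4 * norm \<xi> powr (2 * \<sigma>)))) / 2"

definition char_root2 :: "real \<Rightarrow> real \<Rightarrow> real^'n \<Rightarrow> complex" where
  "char_root2 \<sigma> \<delta> \<xi> =
     (- of_real (norm \<xi> powr (2 * \<delta>))
      - csqrt (of_real (norm \<xi> powr (4 * \<delta>) - 4 * norm \<xi> powr (2 * \<sigma>)))) / 2"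

text \<open>In the case of a double root the kernels take their limiting values.\<close>

definition kernel0 :: "real \<Rightarrow> real \<Rightarrow> real \<Rightarrow> real^'n \<Rightarrow> complex" where
  "kernel0 \<sigma> \<delta> t \<xi> =
     (let l1 = char_root1 \<sigma> \<delta> \<xi>; l2 = char_root2 \<sigma> \<delta> \<xi> in
      if l1 = l2 then (1 - l1 * of_real t) * exp (l1 * of_real t)
      else (l1 * exp (l2 * of_real t) - l2 * exp (l1 * of_real t)) / (l1 - l2))"

definition kernel1 :: "real \<Rightarrow> real \<Rightarrow> real \<Rightarrow> real^'n \<Rightarrow> complex" where
  "kernel1 \<sigma> \<delta> t \<xi> =
     (let l1 = char_root1 \<sigma> \<delta> \<xi>; l2 = char_root2 \<sigma> \<delta> \<xi> in
      if l1 = l2 then of_real t * exp (l1 * of_real t)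
      else (exp (l1 * of_real t) - exp (l2 * of_real t)) / (l1 - l2))"

definition solution ::
    "real \<Rightarrow> real \<Rightarrow> (real^'n \<Rightarrow> complex) \<Rightarrow> (real^'n \<Rightarrow> complex) \<Rightarrow> real \<Rightarrow> real^'n \<Rightarrow> complex" where
  "solution \<sigma> \<delta> w0 w1 t =
     inv_fourier (\<lambda>\<xi>. kernel0 \<sigma> \<delta> t \<xi> * fourier w0 \<xi> + kernel1 \<sigma> \<delta> t \<xi> * fourier w1 \<xi>)"

end

theory Submission
  imports Defs "HOL-Probability.Probability"
begin

text \<open>
  On the Fourier side the solution is \<open>K\<^sub>0(t, \<xi>) w\<^sub>0(\<xi>) + K\<^sub>1(t, \<xi>) w\<^sub>1(\<xi>)\<close>, and by Plancherel's theorem the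
  norms to be estimated are \<open>L\<^sup>2\<close> norms of multiples of the transforms of the data. The proof thus rests on
  pointwise bounds for the kernels and on Plancherel's theorem.

  \<^bold>\<open>Kernels.\<close> The roots solve \<open>\<lambda>\<^sup>2 + b \<lambda> + p\<^sup>2 = 0\<close> with \<open>b = |\<xi>|\<^bsup>2\<delta>\<^esup>\<close> and \<open>p = |\<xi>|\<^sup>\<sigma>\<close>. Since \<open>\<sigma>/2 < \<delta> < \<sigma>\<close>, they
  are complex with real part \<open>-b/2\<close> near the origin, while at infinity they are real and the slow one
  behaves like \<open>-|\<xi>|\<^bsup>2(\<sigma>-\<delta>)\<^esup>\<close>; in both regimes their real parts are at most \<open>-min(1, b)/4\<close>. Hence all kernels
  are bounded by the common factor \<open>exp(-min(1, b) t/8)\<close> (\<open>envelope\<close>), times \<open>1\<close> for \<open>K\<^sub>0\<close> and for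
  \<open>\<partial>\<^sub>t K\<^sub>1\<close>, times \<open>t\<close> or \<open>1/b\<close> for \<open>K\<^sub>1\<close>, and times \<open>p\<close> or \<open>p\<^sup>2/b\<close> for \<open>\<partial>\<^sub>t K\<^sub>0 = -p\<^sup>2 K\<^sub>1\<close>
  (\<open>kernel_bounds\<close>, \<open>dkernel0_bound_high\<close>). For \<open>|\<xi>| > 1\<close> the factor decays exponentially in \<open>t\<close>, and
  the remaining powers of \<open>|\<xi>|\<close> do not exceed those of the Sobolev norms on the right-hand side. For
  \<open>|\<xi>| \<le> 1\<close> a power \<open>|\<xi>|\<^sup>\<beta>\<close> against \<open>exp(-|\<xi>|\<^bsup>2\<delta>\<^esup> t/8)\<close> yields \<open>(1 + t)\<^bsup>-\<beta>/(2\<delta>)\<^esup>\<close>.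

  \<^bold>\<open>Integrable data.\<close> The further decay \<open>(1 + t)\<^bsup>-n/(2\<delta>)(1/m - 1/2)\<^esup>\<close> for data in \<open>L\<^sup>m\<close> is obtained from a
  decomposition of the datum at a height that depends on \<open>t\<close>: the part above the height lies in \<open>L\<^sup>1\<close> and
  has a bounded transform, the part below is small in \<open>L\<^sup>2\<close> (\<open>damped_multiplier_estimate\<close>). This argument
  covers \<open>1 \<le> m \<le> 2\<close>, and the \<open>L\<^sup>2\<close> estimate is the case \<open>m = 2\<close>.

  \<^bold>\<open>Plancherel's theorem.\<close> Damping by a Gaussian gives Bessel's inequality on \<open>L\<^sup>1 \<inter> L\<^sup>2\<close>
  (\<open>fourier_L1_bessel\<close>), hence, with the completeness of \<open>L\<^sup>2\<close>, the existence of the transform. The same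
  damping gives Parseval's identity against indicator functions of boxes (\<open>parseval_box\<close>), and together
  with the multiplication formula \<open>\<integral> \<F>f g = \<integral> f \<F>g\<close> this determines the integrals over boxes of the
  inverse transform of \<open>\<F>f\<close>, which proves inversion (\<open>fourier_inversion\<close>). Isometry and surjectivity
  follow formally.

  \<^bold>\<open>Time derivatives.\<close> By Plancherel's theorem the difference quotients converge strongly as soon as their
  transforms do, which follows from dominated convergence, since the bounds on \<open>\<partial>\<^sub>t K\<^sub>0\<close> and \<open>\<partial>\<^sub>t K\<^sub>1\<close> are
  uniform in time (\<open>has_L2_deriv_fourier\<close>).
\<close>

section \<open>The space of square integrable functions\<close>

lemma ennreal_finiteE:
  assumes "I \<noteq> (\<infinity>::ennreal)"
  obtains r where "I = ennreal r" "0 \<le> r"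
  using assms by (cases I) auto

lemma in_Lp_2_iff:
  "in_Lp 2 f \<longleftrightarrow> f \<in> borel_measurable lborel \<and> (\<integral>\<^sup>+x. ennreal ((norm (f x))\<^sup>2) \<partial>lborel) < \<infinity>"
  unfolding in_Lp_def by (auto simp: integrable_iff_bounded)

lemma in_Lp_measurable: "in_Lp p f \<Longrightarrow> f \<in> borel_measurable lborel"
  by (simp add: in_Lp_def)

lemma Lp_norm_nonneg [simp]: "0 \<le> Lp_norm p f"
  by (simp add: Lp_norm_def)

lemma nn_integral_norm_square:
  assumes "in_Lp 2 f"
  shows "(\<integral>\<^sup>+x. ennreal ((norm (f x))\<^sup>2) \<partial>lborel) = ennreal ((Lp_norm 2 f)\<^sup>2)"
proof -
  have int: "integrable lborel (\<lambda>x. (norm (f x))\<^sup>2)"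
    using assms by (simp add: in_Lp_def)
  have "(Lp_norm 2 f)\<^sup>2 = (LINT x|lborel. (norm (f x))\<^sup>2)"
    by (simp add: Lp_norm_def powr_half_sqrt)
  with nn_integral_eq_integral[OF int] show ?thesis by simp
qed

lemma Lp_norm_2_leI:
  assumes "(\<integral>\<^sup>+x. ennreal ((norm (f x))\<^sup>2) \<partial>lborel) \<le> ennreal (c\<^sup>2)"
    and "f \<in> borel_measurable lborel" and "0 \<le> c"
  shows "in_Lp 2 f" "Lp_norm 2 f \<le> c"
proof -
  show 1: "in_Lp 2 f"
    using assms by (auto simp: in_Lp_2_iff intro: le_less_trans)
  show "Lp_norm 2 f \<le> c"
    using assms(1,3) unfolding nn_integral_norm_square[OF 1]
    by (auto intro: power2_le_imp_le)
qed

lemma Lp_2_mono: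
  assumes f: "in_Lp 2 f" and [measurable]: "g \<in> borel_measurable lborel" and c: "0 \<le> c"
    and le: "AE x in lborel. norm (g x) \<le> c * norm (f x)"
  shows "in_Lp 2 g" "Lp_norm 2 g \<le> c * Lp_norm 2 f"
proof -
  have [measurable]: "f \<in> borel_measurable lborel" using f by (rule in_Lp_measurable)
  have "(\<integral>\<^sup>+x. ennreal ((norm (g x))\<^sup>2) \<partial>lborel)
      \<le> (\<integral>\<^sup>+x. ennreal (c\<^sup>2) * ennreal ((norm (f x))\<^sup>2) \<partial>lborel)"
    using le
  proof (intro nn_integral_mono_AE, eventually_elim)
    case (elim x)
    then have "(norm (g x))\<^sup>2 \<le> (c * norm (f x))\<^sup>2" by (intro power_mono) auto
    then show ?case by (simp add: ennreal_mult[symmetric] power_mult_distrib ennreal_leI)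
  qed
  also have "\<dots> = ennreal ((c * Lp_norm 2 f)\<^sup>2)"
    by (subst nn_integral_cmult) (simp_all add: nn_integral_norm_square[OF f] ennreal_mult power_mult_distrib)
  finally have *: "(\<integral>\<^sup>+x. ennreal ((norm (g x))\<^sup>2) \<partial>lborel) \<le> ennreal ((c * Lp_norm 2 f)\<^sup>2)" .
  show "in_Lp 2 g" "Lp_norm 2 g \<le> c * Lp_norm 2 f"
    by (rule Lp_norm_2_leI[OF *]; use c in simp)+
qed

lemma Lp_2_cong_AE:
  assumes f: "in_Lp 2 f" and g: "g \<in> borel_measurable lborel" and eq: "AE x in lborel. g x = f x"
  shows "in_Lp 2 g" "Lp_norm 2 g = Lp_norm 2 f"
proof -
  have f': "f \<in> borel_measurable lborel" using f by (rule in_Lp_measurable)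
  have 1: "AE x in lborel. norm (g x) \<le> 1 * norm (f x)" using eq by eventually_elim simp
  have 2: "AE x in lborel. norm (f x) \<le> 1 * norm (g x)" using eq by eventually_elim simp
  show 3: "in_Lp 2 g" using Lp_2_mono(1)[OF f g _ 1] by simp
  show "Lp_norm 2 g = Lp_norm 2 f"
    using Lp_2_mono(2)[OF f g _ 1] Lp_2_mono(2)[OF 3 f' _ 2] by simp
qed

lemma Lp_norm_2_cmult:
  assumes "in_Lp 2 f"
  shows "in_Lp 2 (\<lambda>x. c * f x)" "Lp_norm 2 (\<lambda>x. c * f x) = norm c * Lp_norm 2 f"
proof -
  have [measurable]: "f \<in> borel_measurable lborel" using assms by (rule in_Lp_measurable)
  show "in_Lp 2 (\<lambda>x. c * f x)"
    by (rule Lp_2_mono(1)[OF assms, where c="norm c"]) (auto simp: norm_mult)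
  show "Lp_norm 2 (\<lambda>x. c * f x) = norm c * Lp_norm 2 f"
  proof (cases "c = 0")
    case False
    have le: "Lp_norm 2 (\<lambda>x. c * f x) \<le> norm c * Lp_norm 2 f"
      by (rule Lp_2_mono(2)[OF assms]) (auto simp: norm_mult)
    have "Lp_norm 2 f \<le> (1 / norm c) * Lp_norm 2 (\<lambda>x. c * f x)"
      by (rule Lp_2_mono(2)[OF \<open>in_Lp 2 (\<lambda>x. c * f x)\<close>]) (use False in \<open>auto simp: norm_mult\<close>)
    with le False show ?thesis by (simp add: field_simps)
  qed (simp add: Lp_norm_def)
qed

lemma cauchy_schwarz_nn_integral:
  assumes f: "in_Lp 2 f" and g: "in_Lp 2 g"
  shows "(\<integral>\<^sup>+x. ennreal (norm (f x) * norm (g x)) \<partial>lborel) \<le> ennreal (Lp_norm 2 f * Lp_norm 2 g)"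
proof -
  have [measurable]: "f \<in> borel_measurable lborel" "g \<in> borel_measurable lborel"
    using f g by (auto dest: in_Lp_measurable)
  define I where "I = (\<integral>\<^sup>+x. ennreal (norm (f x)) * ennreal (norm (g x)) \<partial>lborel)"
  have "I\<^sup>2 \<le> (\<integral>\<^sup>+x. (ennreal (norm (f x)))\<^sup>2 \<partial>lborel) * (\<integral>\<^sup>+x. (ennreal (norm (g x)))\<^sup>2 \<partial>lborel)"
    unfolding I_def by (rule Cauchy_Schwarz_nn_integral) auto
  also have "\<dots> = ennreal ((Lp_norm 2 f * Lp_norm 2 g)\<^sup>2)"
    by (simp add: ennreal_power nn_integral_norm_square f g ennreal_mult[symmetric] power_mult_distrib)
  finally have le: "I\<^sup>2 \<le> ennreal ((Lp_norm 2 f * Lp_norm 2 g)\<^sup>2)" .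
  then have "I \<noteq> \<infinity>"
    by (auto simp: top_unique)
  then obtain r where r: "I = ennreal r" "0 \<le> r"
    by (rule ennreal_finiteE)
  have "r\<^sup>2 \<le> (Lp_norm 2 f * Lp_norm 2 g)\<^sup>2"
    using le r by (simp add: ennreal_power)
  then have "I \<le> ennreal (Lp_norm 2 f * Lp_norm 2 g)"
    unfolding r(1) by (intro ennreal_leI) (erule power2_le_imp_le, simp)
  then show ?thesis by (simp add: I_def ennreal_mult)
qed

lemma Lp_2_mult_integrable:
  assumes f: "in_Lp 2 f" and g: "in_Lp 2 g"
  shows "integrable lborel (\<lambda>x. f x * g x)"
    and "norm (LINT x|lborel. f x * g x) \<le> Lp_norm 2 f * Lp_norm 2 g"
proof -
  have [measurable]: "f \<in> borel_measurable lborel" "g \<in> borel_measurable lborel"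
    using f g by (auto dest: in_Lp_measurable)
  note cs = cauchy_schwarz_nn_integral[OF f g]
  show int: "integrable lborel (\<lambda>x. f x * g x)"
    by (rule integrableI_bounded) (use cs in \<open>auto simp: norm_mult intro: le_less_trans\<close>)
  have "ennreal (norm (LINT x|lborel. f x * g x)) \<le> (\<integral>\<^sup>+x. ennreal (norm (f x * g x)) \<partial>lborel)"
    by (rule integral_norm_bound_ennreal[OF int])
  also have "\<dots> \<le> ennreal (Lp_norm 2 f * Lp_norm 2 g)" using cs by (simp add: norm_mult)
  finally show "norm (LINT x|lborel. f x * g x) \<le> Lp_norm 2 f * Lp_norm 2 g"
    by (simp add: ennreal_le_iff)
qed

lemma Lp_2_add:
  assumes f: "in_Lp 2 f" and g: "in_Lp 2 g"
  shows "in_Lp 2 (\<lambda>x. f x + g x)" "Lp_norm 2 (\<lambda>x. f x + g x) \<le> Lp_norm 2 f + Lp_norm 2 g"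
proof -
  have [measurable]: "f \<in> borel_measurable lborel" "g \<in> borel_measurable lborel"
    using f g by (auto dest: in_Lp_measurable)
  have "(\<integral>\<^sup>+x. ennreal ((norm (f x + g x))\<^sup>2) \<partial>lborel)
      \<le> (\<integral>\<^sup>+x. ennreal ((norm (f x))\<^sup>2) + (2 * ennreal (norm (f x) * norm (g x)) + ennreal ((norm (g x))\<^sup>2)) \<partial>lborel)"
  proof (rule nn_integral_mono)
    fix x
    have "(norm (f x + g x))\<^sup>2 \<le> (norm (f x) + norm (g x))\<^sup>2"
      by (intro power_mono norm_triangle_ineq) auto
    also have "\<dots> = (norm (f x))\<^sup>2 + (2 * (norm (f x) * norm (g x)) + (norm (g x))\<^sup>2)"
      by (simp add: power2_sum)
    finally show "ennreal ((norm (f x + g x))\<^sup>2) \<le> ennreal ((norm (f x))\<^sup>2)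
        + (2 * ennreal (norm (f x) * norm (g x)) + ennreal ((norm (g x))\<^sup>2))"
      by (rule order_trans[OF ennreal_leI]) (simp add: ennreal_mult)
  qed
  also have "\<dots> = (\<integral>\<^sup>+x. ennreal ((norm (f x))\<^sup>2) \<partial>lborel)
      + (2 * (\<integral>\<^sup>+x. ennreal (norm (f x) * norm (g x)) \<partial>lborel) + (\<integral>\<^sup>+x. ennreal ((norm (g x))\<^sup>2) \<partial>lborel))"
    by (simp add: nn_integral_add nn_integral_cmult)
  also have "\<dots> \<le> ennreal ((Lp_norm 2 f)\<^sup>2) + (2 * ennreal (Lp_norm 2 f * Lp_norm 2 g) + ennreal ((Lp_norm 2 g)\<^sup>2))"
    unfolding nn_integral_norm_square[OF f] nn_integral_norm_square[OF g]
    by (intro add_mono mult_left_mono cauchy_schwarz_nn_integral f g) auto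
  also have "\<dots> = ennreal ((Lp_norm 2 f)\<^sup>2 + (2 * (Lp_norm 2 f * Lp_norm 2 g) + (Lp_norm 2 g)\<^sup>2))"
    by (subst ennreal_plus, simp, simp, subst ennreal_plus, simp, simp, simp add: ennreal_mult)
  also have "\<dots> = ennreal ((Lp_norm 2 f + Lp_norm 2 g)\<^sup>2)"
    by (simp add: power2_sum ac_simps)
  finally have *: "(\<integral>\<^sup>+x. ennreal ((norm (f x + g x))\<^sup>2) \<partial>lborel) \<le> ennreal ((Lp_norm 2 f + Lp_norm 2 g)\<^sup>2)" .
  show "in_Lp 2 (\<lambda>x. f x + g x)" "Lp_norm 2 (\<lambda>x. f x + g x) \<le> Lp_norm 2 f + Lp_norm 2 g"
    by (rule Lp_norm_2_leI[OF *]; simp)+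
qed

lemma Lp_2_diff:
  assumes f: "in_Lp 2 f" and g: "in_Lp 2 g"
  shows "in_Lp 2 (\<lambda>x. f x - g x)" "Lp_norm 2 (\<lambda>x. f x - g x) \<le> Lp_norm 2 f + Lp_norm 2 g"
proof -
  have g': "in_Lp 2 (\<lambda>x. (-1) * g x)" "Lp_norm 2 (\<lambda>x. (-1) * g x) = Lp_norm 2 g"
    by (simp_all only: Lp_norm_2_cmult[OF g] norm_minus_cancel norm_one mult_1_left)
  show "in_Lp 2 (\<lambda>x. f x - g x)" "Lp_norm 2 (\<lambda>x. f x - g x) \<le> Lp_norm 2 f + Lp_norm 2 g"
    using Lp_2_add[OF f g'(1)] unfolding g'(2) by simp_all
qed

lemma Lp_norm_2_diff_commute:
  "Lp_norm 2 (\<lambda>x. f x - g x) = Lp_norm 2 (\<lambda>x. g x - f x)"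
  by (simp add: Lp_norm_def norm_minus_commute)

lemma Lp_norm_2_triangle:
  assumes "in_Lp 2 f" "in_Lp 2 g" "in_Lp 2 h"
  shows "Lp_norm 2 (\<lambda>x. f x - h x) \<le> Lp_norm 2 (\<lambda>x. f x - g x) + Lp_norm 2 (\<lambda>x. g x - h x)"
  using Lp_2_add(2)[OF Lp_2_diff(1)[OF assms(1,2)] Lp_2_diff(1)[OF assms(2,3)]] by simp

lemma cnj_measurable [measurable]: "cnj \<in> borel_measurable borel"
  by (intro borel_measurable_continuous_onI continuous_intros)

lemma borel_measurable_cnj_iff [simp]:
  "(\<lambda>x. cnj (f x)) \<in> borel_measurable M \<longleftrightarrow> f \<in> borel_measurable M"
proof
  assume "(\<lambda>x. cnj (f x)) \<in> borel_measurable M"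
  from measurable_compose[OF this cnj_measurable] show "f \<in> borel_measurable M" by simp
qed (rule measurable_compose[OF _ cnj_measurable])

lemma Lp_2_cnj [simp]:
  "in_Lp 2 (\<lambda>x. cnj (f x)) \<longleftrightarrow> in_Lp 2 f" "Lp_norm 2 (\<lambda>x. cnj (f x)) = Lp_norm 2 f"
  by (simp_all add: in_Lp_def Lp_norm_def)

lemma Lp_norm_2_eq_0:
  assumes "in_Lp 2 f" "Lp_norm 2 f = 0"
  shows "AE x in lborel. f x = 0"
proof -
  have [measurable]: "f \<in> borel_measurable lborel" using assms by (auto dest: in_Lp_measurable)
  have "AE x in lborel. ennreal ((norm (f x))\<^sup>2) = 0"
    using nn_integral_norm_square[OF assms(1)] assms(2) by (subst nn_integral_0_iff_AE[symmetric]) auto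
  then show ?thesis by eventually_elim simp
qed

lemma tendsto_zero_L2_iff:
  assumes "\<And>s. in_Lp 2 (h s)"
  shows "tendsto_zero_L2 h F \<longleftrightarrow> ((\<lambda>s. Lp_norm 2 (h s)) \<longlongrightarrow> 0) F"
proof -
  have "tendsto_zero_L2 h F \<longleftrightarrow> ((\<lambda>s. ennreal ((Lp_norm 2 (h s))\<^sup>2)) \<longlongrightarrow> ennreal 0) F"
    unfolding tendsto_zero_L2_def by (simp add: nn_integral_norm_square assms)
  also have "\<dots> \<longleftrightarrow> ((\<lambda>s. (Lp_norm 2 (h s))\<^sup>2) \<longlongrightarrow> 0) F"
    by (rule tendsto_ennreal_iff) auto
  also have "\<dots> \<longleftrightarrow> ((\<lambda>s. Lp_norm 2 (h s)) \<longlongrightarrow> 0) F"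
  proof
    assume "((\<lambda>s. (Lp_norm 2 (h s))\<^sup>2) \<longlongrightarrow> 0) F"
    from tendsto_real_sqrt[OF this] show "((\<lambda>s. Lp_norm 2 (h s)) \<longlongrightarrow> 0) F" by simp
  next
    assume "((\<lambda>s. Lp_norm 2 (h s)) \<longlongrightarrow> 0) F"
    from tendsto_power[OF this, of 2] show "((\<lambda>s. (Lp_norm 2 (h s))\<^sup>2) \<longlongrightarrow> 0) F" by simp
  qed
  finally show ?thesis .
qed

lemma Lp_norm_2_tendsto:
  assumes "\<And>s. in_Lp 2 (u s)" "in_Lp 2 v" "((\<lambda>s. Lp_norm 2 (\<lambda>x. u s x - v x)) \<longlongrightarrow> 0) F"
  shows "((\<lambda>s. Lp_norm 2 (u s)) \<longlongrightarrow> Lp_norm 2 v) F"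
proof (rule LIM_zero_cancel)
  show "((\<lambda>s. Lp_norm 2 (u s) - Lp_norm 2 v) \<longlongrightarrow> 0) F"
  proof (rule Lim_null_comparison[OF always_eventually assms(3)], intro allI)
    fix s
    have "Lp_norm 2 (u s) \<le> Lp_norm 2 (\<lambda>x. u s x - v x) + Lp_norm 2 v"
      using Lp_2_add(2)[OF Lp_2_diff(1)[OF assms(1)[of s] assms(2)] assms(2)] by simp
    moreover have "Lp_norm 2 v \<le> Lp_norm 2 (\<lambda>x. v x - u s x) + Lp_norm 2 (u s)"
      using Lp_2_add(2)[OF Lp_2_diff(1)[OF assms(2) assms(1)[of s]] assms(1)[of s]] by simp
    ultimately show "norm (Lp_norm 2 (u s) - Lp_norm 2 v) \<le> Lp_norm 2 (\<lambda>x. u s x - v x)"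
      using Lp_norm_2_diff_commute[of v "u s"] by auto
  qed
qed

lemma Lp_2_pairing_tendsto:
  assumes u: "\<And>s. in_Lp 2 (u s)" "in_Lp 2 f" "((\<lambda>s. Lp_norm 2 (\<lambda>x. u s x - f x)) \<longlongrightarrow> 0) F"
    and v: "\<And>s. in_Lp 2 (v s)" "in_Lp 2 g" "((\<lambda>s. Lp_norm 2 (\<lambda>x. v s x - g x)) \<longlongrightarrow> 0) F"
  shows "((\<lambda>s. LINT x|lborel. u s x * v s x) \<longlongrightarrow> (LINT x|lborel. f x * g x)) F"
proof -
  have "((\<lambda>s. (LINT x|lborel. u s x * v s x) - (LINT x|lborel. f x * g x)) \<longlongrightarrow> 0) F"
  proof (rule Lim_null_comparison[OF always_eventually], intro allI)
    fix s
    have d: "in_Lp 2 (\<lambda>x. u s x - f x)" "in_Lp 2 (\<lambda>x. v s x - g x)"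
      by (intro Lp_2_diff u v)+
    have "(LINT x|lborel. u s x * v s x) - (LINT x|lborel. f x * g x)
        = (LINT x|lborel. u s x * v s x - f x * g x)"
      by (intro Bochner_Integration.integral_diff[symmetric] Lp_2_mult_integrable u v)
    also have "\<dots> = (LINT x|lborel. (u s x - f x) * v s x + f x * (v s x - g x))"
      by (simp add: algebra_simps)
    also have "\<dots> = (LINT x|lborel. (u s x - f x) * v s x) + (LINT x|lborel. f x * (v s x - g x))"
      by (intro Bochner_Integration.integral_add Lp_2_mult_integrable u v d)
    finally show "norm ((LINT x|lborel. u s x * v s x) - (LINT x|lborel. f x * g x))
        \<le> Lp_norm 2 (\<lambda>x. u s x - f x) * Lp_norm 2 (v s) + Lp_norm 2 f * Lp_norm 2 (\<lambda>x. v s x - g x)"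
      by (simp only:) (intro norm_triangle_mono Lp_2_mult_integrable(2) u v d)
  next
    have "((\<lambda>s. Lp_norm 2 (\<lambda>x. u s x - f x) * Lp_norm 2 (v s) + Lp_norm 2 f * Lp_norm 2 (\<lambda>x. v s x - g x))
        \<longlongrightarrow> 0 * Lp_norm 2 g + Lp_norm 2 f * 0) F"
      by (intro tendsto_intros u v Lp_norm_2_tendsto)
    then show "((\<lambda>s. Lp_norm 2 (\<lambda>x. u s x - f x) * Lp_norm 2 (v s) + Lp_norm 2 f * Lp_norm 2 (\<lambda>x. v s x - g x))
        \<longlongrightarrow> 0) F" by simp
  qed
  then show ?thesis by (rule LIM_zero_cancel)
qed

lemma Lp_2_fatou:
  assumes v: "\<And>k. in_Lp 2 (v k)" "eventually (\<lambda>k. Lp_norm 2 (v k) \<le> c) sequentially"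
    and g: "g \<in> borel_measurable lborel" and lim: "AE x in lborel. (\<lambda>k. v k x) \<longlonglongrightarrow> g x"
  shows "in_Lp 2 g" "Lp_norm 2 g \<le> c"
proof -
  have [measurable]: "v k \<in> borel_measurable lborel" for k using v(1) by (rule in_Lp_measurable)
  obtain k0 where "Lp_norm 2 (v k0) \<le> c" using v(2) by (meson eventually_sequentially order_refl)
  then have c: "0 \<le> c" using Lp_norm_nonneg order_trans by blast
  have "(\<integral>\<^sup>+x. ennreal ((norm (g x))\<^sup>2) \<partial>lborel)
      = (\<integral>\<^sup>+x. liminf (\<lambda>k. ennreal ((norm (v k x))\<^sup>2)) \<partial>lborel)"
    using lim
  proof (intro nn_integral_cong_AE, eventually_elim)
    case (elim x)
    then have "(\<lambda>k. ennreal ((norm (v k x))\<^sup>2)) \<longlonglongrightarrow> ennreal ((norm (g x))\<^sup>2)"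
      by (intro tendsto_intros tendsto_ennrealI)
    then show ?case by (intro lim_imp_Liminf[symmetric]) auto
  qed
  also have "\<dots> \<le> liminf (\<lambda>k. \<integral>\<^sup>+x. ennreal ((norm (v k x))\<^sup>2) \<partial>lborel)"
    by (rule nn_integral_liminf) auto
  also have "\<dots> \<le> liminf (\<lambda>k::nat. ennreal (c\<^sup>2))"
    by (rule Liminf_mono, rule eventually_mono[OF v(2)])
      (auto simp: nn_integral_norm_square[OF v(1)] intro!: ennreal_leI power_mono)
  also have "\<dots> = ennreal (c\<^sup>2)" by (simp add: Liminf_const)
  finally show "in_Lp 2 g" "Lp_norm 2 g \<le> c"
    using Lp_norm_2_leI[OF _ g c] by auto
qed

lemma Lp_2_dominated:
  fixes u :: "nat \<Rightarrow> real^'n \<Rightarrow> complex"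
  assumes u: "\<And>k. u k \<in> borel_measurable lborel" and w: "in_Lp 2 w"
    and le: "\<And>k. AE x in lborel. norm (u k x) \<le> norm (w x)"
    and lim: "AE x in lborel. (\<lambda>k. u k x) \<longlonglongrightarrow> 0"
  shows "(\<lambda>k. Lp_norm 2 (u k)) \<longlonglongrightarrow> 0"
proof -
  have [measurable]: "u k \<in> borel_measurable lborel" for k by (rule u)
  have [measurable]: "w \<in> borel_measurable lborel" by (rule in_Lp_measurable[OF w])
  have u': "in_Lp 2 (u k)" for k
    using Lp_2_mono(1)[OF w u, of 1 k] le by simp
  have "(\<lambda>k. \<integral>\<^sup>+x. ennreal ((norm (u k x))\<^sup>2) \<partial>lborel) \<longlonglongrightarrow> (\<integral>\<^sup>+(x::real^'n). 0 \<partial>lborel)"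
  proof (rule nn_integral_dominated_convergence)
    show "AE x in lborel. ennreal ((norm (u k x))\<^sup>2) \<le> ennreal ((norm (w x))\<^sup>2)" for k
      using le[of k] by eventually_elim (auto intro!: ennreal_leI power_mono)
    show "(\<integral>\<^sup>+x. ennreal ((norm (w x))\<^sup>2) \<partial>lborel) < \<infinity>" using w by (simp add: in_Lp_2_iff)
    show "AE x in lborel. (\<lambda>k. ennreal ((norm (u k x))\<^sup>2)) \<longlonglongrightarrow> 0"
      using lim
    proof eventually_elim
      case (elim x)
      then have "(\<lambda>k. ennreal ((norm (u k x))\<^sup>2)) \<longlonglongrightarrow> ennreal ((norm (0::complex))\<^sup>2)"
        by (intro tendsto_intros tendsto_ennrealI)
      then show ?case by simp
    qed
  qed auto
  then show ?thesis
    using tendsto_zero_L2_iff[of u sequentially] u' by (simp add: tendsto_zero_L2_def)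
qed

text \<open>Along a subsequence whose increments have norms at most \<open>4\<^sup>-\<^sup>k\<close> the increments are
  almost everywhere \<open>O(2\<^sup>-\<^sup>k)\<close>, so that the subsequence converges pointwise; Fatou's lemma turns this
  pointwise limit into the limit in norm.\<close>

lemma riesz_fischer:
  fixes u :: "nat \<Rightarrow> real^'n \<Rightarrow> complex"
  assumes u: "\<And>k. in_Lp 2 (u k)"
    and cauchy: "\<And>e. e > 0 \<Longrightarrow> \<exists>N. \<forall>m\<ge>N. \<forall>n\<ge>N. Lp_norm 2 (\<lambda>x. u m x - u n x) \<le> e"
  shows "\<exists>g. in_Lp 2 g \<and> (\<lambda>k. Lp_norm 2 (\<lambda>x. u k x - g x)) \<longlonglongrightarrow> 0"
proof -
  have [measurable]: "u k \<in> borel_measurable lborel" for k using u by (rule in_Lp_measurable)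
  have "\<forall>k::nat. \<exists>N. \<forall>m\<ge>N. \<forall>n\<ge>N. Lp_norm 2 (\<lambda>x. u m x - u n x) \<le> (1/4)^k"
    by (intro allI cauchy) simp
  then obtain N where N: "\<And>k m n. N k \<le> m \<Longrightarrow> N k \<le> n \<Longrightarrow> Lp_norm 2 (\<lambda>x. u m x - u n x) \<le> (1/4)^k"
    by metis
  \<comment> \<open>Partial sums, because the \<open>N k\<close> themselves need not increase with \<open>k\<close>.\<close>
  define \<phi> where "\<phi> k = (\<Sum>i\<le>k. N i)" for k
  have \<phi>: "N i \<le> \<phi> k" if "i \<le> k" for i k
    unfolding \<phi>_def using that by (intro member_le_sum) auto
  define d where "d k x = u (\<phi> (Suc k)) x - u (\<phi> k) x" for k x
  have d2: "in_Lp 2 (d k)" and dle: "Lp_norm 2 (d k) \<le> (1/4)^k" for k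
    unfolding d_def by (auto intro!: Lp_2_diff u N \<phi>)
  have [measurable]: "d k \<in> borel_measurable lborel" for k using d2 by (rule in_Lp_measurable)
  have "(\<integral>\<^sup>+x. (\<Sum>k. ennreal (4^k * (norm (d k x))\<^sup>2)) \<partial>lborel)
      = (\<Sum>k. \<integral>\<^sup>+x. ennreal (4^k * (norm (d k x))\<^sup>2) \<partial>lborel)"
    by (rule nn_integral_suminf) auto
  also have "\<dots> \<le> (\<Sum>k. ennreal ((1/4)^k))"
  proof (intro suminf_le summableI)
    fix k
    have "(\<integral>\<^sup>+x. ennreal (4^k * (norm (d k x))\<^sup>2) \<partial>lborel) = ennreal (4^k) * ennreal ((Lp_norm 2 (d k))\<^sup>2)"
      by (subst nn_integral_norm_square[OF d2, symmetric], subst nn_integral_cmult[symmetric])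
        (auto simp: ennreal_mult)
    also have "\<dots> \<le> ennreal (4^k) * ennreal (((1/4)^k)\<^sup>2)"
      by (intro mult_left_mono ennreal_leI power_mono dle) auto
    also have "\<dots> = ennreal ((1/4)^k)"
      by (simp add: ennreal_mult[symmetric] power2_eq_square power_one_over)
    finally show "(\<integral>\<^sup>+x. ennreal (4^k * (norm (d k x))\<^sup>2) \<partial>lborel) \<le> ennreal ((1/4)^k)" .
  qed
  also have "\<dots> = ennreal (\<Sum>k. (1/4)^k)"
    by (intro suminf_ennreal2 summable_geometric) auto
  also have "\<dots> < \<infinity>" by simp
  finally have "AE x in lborel. (\<Sum>k. ennreal (4^k * (norm (d k x))\<^sup>2)) \<noteq> \<infinity>"
    by (intro nn_integral_noteq_infinite) auto
  then have conv: "AE x in lborel. convergent (\<lambda>k. u (\<phi> k) x)"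
  proof eventually_elim
    case (elim x)
    obtain M where M: "(\<Sum>k. ennreal (4^k * (norm (d k x))\<^sup>2)) = ennreal M" "0 \<le> M"
      by (rule ennreal_finiteE[OF elim])
    have le: "norm (d k x) \<le> sqrt M * (1/2)^k" for k
    proof -
      have "(\<Sum>k\<in>{k}. ennreal (4^k * (norm (d k x))\<^sup>2)) \<le> (\<Sum>k. ennreal (4^k * (norm (d k x))\<^sup>2))"
        by (intro sum_le_suminf summableI) auto
      then have "4^k * (norm (d k x))\<^sup>2 \<le> M" using M by simp
      moreover have "(4::real)^k = (2^k)\<^sup>2" by (simp add: power2_eq_square flip: power_mult_distrib)
      ultimately have "(2^k * norm (d k x))\<^sup>2 \<le> M" by (simp add: power_mult_distrib)
      then have "2^k * norm (d k x) \<le> sqrt M" by (rule real_le_rsqrt)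
      then show ?thesis by (simp add: field_simps power_one_over)
    qed
    have "summable (\<lambda>k. d k x)"
      by (rule summable_comparison_test'[where N=0 and g="\<lambda>k. sqrt M * (1/2)^k"])
        (auto intro!: le summable_mult summable_geometric)
    then have "convergent (\<lambda>k. u (\<phi> 0) x + (\<Sum>i<k. d i x))"
      by (intro convergent_add convergent_const) (simp add: summable_iff_convergent)
    moreover have "u (\<phi> 0) x + (\<Sum>i<k. d i x) = u (\<phi> k) x" for k
      unfolding d_def by (subst sum_lessThan_telescope) simp
    ultimately show ?case by simp
  qed
  define g where "g x = lim (\<lambda>k. u (\<phi> k) x)" for x
  have [measurable]: "g \<in> borel_measurable lborel"
    unfolding g_def by (rule borel_measurable_lim_metric) auto
  have lim: "AE x in lborel. (\<lambda>k. u (\<phi> k) x) \<longlonglongrightarrow> g x"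
    using conv by eventually_elim (simp add: g_def convergent_LIMSEQ_iff)
  have close: "in_Lp 2 (\<lambda>x. g x - u n x) \<and> Lp_norm 2 (\<lambda>x. g x - u n x) \<le> (1/4)^j" if n: "N j \<le> n" for n j
  proof -
    have ev: "eventually (\<lambda>k. Lp_norm 2 (\<lambda>x. u (\<phi> k) x - u n x) \<le> (1/4)^j) sequentially"
      unfolding eventually_sequentially by (intro exI[of _ j]) (auto intro!: N \<phi> n)
    have lim': "AE x in lborel. (\<lambda>k. u (\<phi> k) x - u n x) \<longlonglongrightarrow> g x - u n x"
      using lim by eventually_elim (intro tendsto_intros)
    show ?thesis
      using Lp_2_fatou[OF Lp_2_diff(1)[OF u u] ev _ lim'] by simp
  qed
  have g: "in_Lp 2 g"
    using Lp_2_add(1)[OF conjunct1[OF close[OF order_refl, of 0]] u[of "N 0"]] by simp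
  have "(\<lambda>k. Lp_norm 2 (\<lambda>x. u k x - g x)) \<longlonglongrightarrow> 0"
  proof (rule LIMSEQ_I)
    fix e :: real assume "0 < e"
    then obtain j where j: "(1/4)^j < e" using real_arch_pow_inv[of e "1/4"] by auto
    show "\<exists>no. \<forall>n\<ge>no. norm (Lp_norm 2 (\<lambda>x. u n x - g x) - 0) < e"
      using close j by (intro exI[of _ "N j"]) (fastforce simp: Lp_norm_2_diff_commute[of "u _"])
  qed
  with g show ?thesis by blast
qed

section \<open>Gaussians\<close>

lemma borel_measurable_cis [measurable]: "cis \<in> borel_measurable borel"
  by (intro borel_measurable_continuous_onI continuous_intros)

lemma integral_lborel_prod:
  fixes f :: "'a::euclidean_space \<Rightarrow> real \<Rightarrow> complex"
  assumes f: "\<And>b. b \<in> Basis \<Longrightarrow> integrable lborel (f b)"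
  shows "(LINT x|lborel. (\<Prod>b\<in>Basis. f b (x \<bullet> b))) = (\<Prod>b\<in>Basis. LINT u|lborel. f b u)"
proof -
  interpret product_sigma_finite "\<lambda>b::'a. lborel :: real measure" ..
  have [measurable]: "f b \<in> borel_measurable borel" if "b \<in> Basis" for b
    using borel_measurable_integrable[OF f[OF that]] by simp
  have "(LINT x|lborel. (\<Prod>b\<in>Basis. f b (x \<bullet> b)))
      = (LINT y|(\<Pi>\<^sub>M b\<in>(Basis::'a set). lborel). (\<Prod>b\<in>Basis. f b ((\<Sum>c\<in>Basis. y c *\<^sub>R c) \<bullet> b)))"
    by (subst lborel_eq, subst integral_distr) auto
  also have "\<dots> = (LINT y|(\<Pi>\<^sub>M b\<in>(Basis::'a set). lborel). (\<Prod>b\<in>Basis. f b (y b)))"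
    by (intro Bochner_Integration.integral_cong prod.cong refl) simp
  also have "\<dots> = (\<Prod>b\<in>Basis. LINT u|lborel. f b u)"
    by (rule product_integral_prod) (auto intro: f)
  finally show ?thesis .
qed

lemma integral_lborel_scale:
  fixes f :: "real^'n \<Rightarrow> complex"
  assumes [measurable]: "f \<in> borel_measurable borel" and c: "0 < c"
  shows "(LINT x|lborel. f x) = of_real (c ^ CARD('n)) * (LINT x|lborel. f (a + c *\<^sub>R x))"
proof -
  have "(LINT x|lborel. f x)
      = (LINT x|density (distr lborel borel (\<lambda>x. a + c *\<^sub>R x)) (\<lambda>_. \<bar>c\<bar> ^ DIM(real^'n)). f x)"
    using lborel_affine[of c a] c by (metis less_irrefl)
  also have "\<dots> = (LINT x|lborel. \<bar>c\<bar> ^ CARD('n) *\<^sub>R f (a + c *\<^sub>R x))"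
    by (subst integral_density) (auto simp: integral_distr)
  finally show ?thesis using c by (simp add: scaleR_conv_of_real)
qed

lemma nn_integral_lborel_scale:
  fixes f :: "real^'n \<Rightarrow> ennreal"
  assumes [measurable]: "f \<in> borel_measurable borel" and c: "0 < c"
  shows "(\<integral>\<^sup>+x. f x \<partial>lborel) = ennreal (c ^ CARD('n)) * (\<integral>\<^sup>+x. f (a + c *\<^sub>R x) \<partial>lborel)"
proof -
  have "(\<integral>\<^sup>+x. f x \<partial>lborel)
      = (\<integral>\<^sup>+x. f x \<partial>density (distr lborel borel (\<lambda>x. a + c *\<^sub>R x)) (\<lambda>_. \<bar>c\<bar> ^ DIM(real^'n)))"
    using lborel_affine[of c a] c by (metis less_irrefl)
  also have "\<dots> = (\<integral>\<^sup>+x. ennreal (\<bar>c\<bar> ^ CARD('n)) * f (a + c *\<^sub>R x) \<partial>lborel)"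
    by (subst nn_integral_density) (auto simp: nn_integral_distr ennreal_power)
  finally show ?thesis using c by (simp add: nn_integral_cmult)
qed

definition gauss :: "real \<Rightarrow> real^'n \<Rightarrow> real" where
  "gauss c x = exp (- (c * norm x)\<^sup>2 / 2)"

lemma gauss_measurable [measurable]: "gauss c \<in> borel_measurable borel"
  unfolding gauss_def by measurable

lemma gauss_pos [simp]: "0 < gauss c x" "0 \<le> gauss c x" "gauss c x \<le> 1" "gauss c (- x) = gauss c x"
  by (simp_all add: gauss_def)

text \<open>The integrand is a multiple of the normal density times a character, so the value is the characteristic
  function of the standard normal distribution.\<close>

lemma fourier_gaussian_1d:
  "integrable lborel (\<lambda>u::real. exp (of_real (- u\<^sup>2 / 2) - \<i> * of_real (t * u)))"
  "(LINT u|lborel. exp (of_real (- u\<^sup>2 / 2) - \<i> * of_real (t * u))) = of_real (sqrt (2 * pi) * exp (- t\<^sup>2 / 2))"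
proof -
  have eq: "exp (of_real (- u\<^sup>2 / 2) - \<i> * of_real (t * u))
      = of_real (sqrt (2 * pi)) * (std_normal_density u *\<^sub>R exp (\<i> * of_real ((- t) * u)))" for u :: real
    by (simp add: std_normal_density_def scaleR_conv_of_real mult_exp_exp flip: exp_of_real)
  have "integrable lborel (\<lambda>u. std_normal_density u *\<^sub>R exp (\<i> * of_real ((- t) * u)))"
    by (rule Bochner_Integration.integrable_bound[of _ std_normal_density])
      (auto intro!: integrable_normal_moment_nz_1 simp: norm_mult)
  then show "integrable lborel (\<lambda>u::real. exp (of_real (- u\<^sup>2 / 2) - \<i> * of_real (t * u)))"
    unfolding eq by (intro Bochner_Integration.integrable_mult_right)
  have int: "(LINT u|lborel. std_normal_density u *\<^sub>R exp (\<i> * of_real ((- t) * u))) = char std_normal_distribution (- t)"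
    unfolding char_def by (subst integral_density) auto
  show "(LINT u|lborel. exp (of_real (- u\<^sup>2 / 2) - \<i> * of_real (t * u))) = of_real (sqrt (2 * pi) * exp (- t\<^sup>2 / 2))"
    unfolding eq integral_mult_right_zero int by (simp add: char_std_normal_distribution)
qed

lemma gaussian_integral:
  fixes z :: "real^'n"
  shows "(LINT \<xi>|lborel. cis (- (z \<bullet> \<xi>)) * of_real (gauss 1 \<xi>))
      = of_real ((2 * pi) powr (real CARD('n) / 2) * gauss 1 z)"
proof -
  have "cis (- (z \<bullet> \<xi>)) * of_real (gauss 1 \<xi>)
      = (\<Prod>b\<in>Basis. exp (of_real (- (\<xi> \<bullet> b)\<^sup>2 / 2) - \<i> * of_real ((z \<bullet> b) * (\<xi> \<bullet> b))))" for \<xi> :: "real^'n"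
  proof -
    have "cis (- (z \<bullet> \<xi>)) * of_real (gauss 1 \<xi>)
        = exp (of_real (- (\<xi> \<bullet> \<xi>) / 2) - \<i> * of_real (z \<bullet> \<xi>))"
      by (simp add: cis_conv_exp gauss_def power2_norm_eq_inner mult_exp_exp flip: exp_of_real)
        (rule arg_cong[where f = exp], simp)
    also have "of_real (- (\<xi> \<bullet> \<xi>) / 2) - \<i> * of_real (z \<bullet> \<xi>)
        = (\<Sum>b\<in>Basis. of_real (- (\<xi> \<bullet> b)\<^sup>2 / 2) - \<i> * of_real ((z \<bullet> b) * (\<xi> \<bullet> b)))"
      by (subst (1 2) euclidean_inner)
        (simp add: sum_subtractf sum_negf sum_divide_distrib sum_distrib_left power2_eq_square)
    finally show ?thesis by (simp add: exp_sum)
  qed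
  then have "(LINT \<xi>|lborel. cis (- (z \<bullet> \<xi>)) * of_real (gauss 1 \<xi>))
      = (\<Prod>b\<in>(Basis::(real^'n) set). of_real (sqrt (2 * pi) * exp (- (z \<bullet> b)\<^sup>2 / 2)))"
    by (simp only:) (subst integral_lborel_prod[where f = "\<lambda>b u. exp (of_real (- u\<^sup>2 / 2) - \<i> * of_real ((z \<bullet> b) * u))"],
      simp_all only: fourier_gaussian_1d)
  also have "\<dots> = of_real (sqrt (2 * pi) ^ CARD('n) * exp (\<Sum>b\<in>Basis. - (z \<bullet> b)\<^sup>2 / 2))"
    by (simp add: prod.distrib exp_sum del: of_real_mult of_real_exp flip: of_real_prod)
  also have "(\<Sum>b\<in>Basis. - (z \<bullet> b)\<^sup>2 / 2) = - (norm z)\<^sup>2 / 2"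
    unfolding power2_norm_eq_inner by (subst euclidean_inner) (simp add: sum_negf sum_divide_distrib power2_eq_square)
  also have "sqrt (2 * pi) ^ CARD('n) = (2 * pi) powr (real CARD('n) / 2)"
    by (simp add: powr_half_sqrt[symmetric] powr_realpow[symmetric] powr_powr)
  finally show ?thesis by (simp add: gauss_def)
qed

text \<open>The normal density with standard deviation \<open>c\<close>. Up to the normalisation of the Fourier
  transform it is the transform of \<open>gauss c\<close>, and it is an approximate identity as \<open>c \<rightarrow> 0\<close>.\<close>

definition heat_kernel :: "real \<Rightarrow> real^'n \<Rightarrow> real" where
  "heat_kernel c z = (2 * pi) powr (- real CARD('n) / 2) / c ^ CARD('n) * gauss (1 / c) z"

lemma heat_kernel_measurable [measurable]: "heat_kernel c \<in> borel_measurable borel"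
  unfolding heat_kernel_def by measurable

lemma heat_kernel_nonneg [simp]: "0 < c \<Longrightarrow> 0 \<le> heat_kernel c z"
  by (simp add: heat_kernel_def)

lemma heat_kernel_minus [simp]: "heat_kernel c (- z) = heat_kernel c z"
  by (simp add: heat_kernel_def)

lemma heat_kernel_scale: 
  fixes z :: "real^'n"
  assumes "0 < c"
  shows "c ^ CARD('n) * heat_kernel c (c *\<^sub>R z) = heat_kernel 1 z"
  using assms by (simp add: heat_kernel_def gauss_def)

lemma fourier_gauss:
  fixes z :: "real^'n"
  assumes c: "0 < c"
  shows "of_real ((2 * pi) powr (- real CARD('n) / 2)) * (of_real ((2 * pi) powr (- real CARD('n) / 2)) *
      (LINT \<xi>|lborel. cis (- (z \<bullet> \<xi>)) * of_real (gauss c \<xi>))) = of_real (heat_kernel c z)"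
proof -
  have "(LINT \<xi>|lborel. cis (- (z \<bullet> \<xi>)) * of_real (gauss c \<xi>))
      = of_real ((1 / c) ^ CARD('n)) * (LINT \<xi>|lborel. cis (- (z \<bullet> (0 + (1 / c) *\<^sub>R \<xi>))) * of_real (gauss c (0 + (1 / c) *\<^sub>R \<xi>)))"
    by (rule integral_lborel_scale) (use c in auto)
  also have "(\<lambda>\<xi>. cis (- (z \<bullet> (0 + (1 / c) *\<^sub>R \<xi>))) * of_real (gauss c (0 + (1 / c) *\<^sub>R \<xi>)))
      = (\<lambda>\<xi>. cis (- (((1 / c) *\<^sub>R z) \<bullet> \<xi>)) * of_real (gauss 1 \<xi>))"
    using c by (auto simp: gauss_def fun_eq_iff)
  finally have "(LINT \<xi>|lborel. cis (- (z \<bullet> \<xi>)) * of_real (gauss c \<xi>))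
      = of_real ((2 * pi) powr (real CARD('n) / 2) * ((1 / c) ^ CARD('n) * gauss (1 / c) z))"
    unfolding gaussian_integral using c by (simp add: gauss_def power_divide)
  then show ?thesis
    using c by (simp add: heat_kernel_def power_divide powr_minus field_simps flip: of_real_mult of_real_divide)
qed

lemma integrable_gauss:
  assumes "0 < c"
  shows "integrable lborel (\<lambda>\<xi>::real^'n. complex_of_real (gauss c \<xi>))"
proof (rule ccontr)
  \<comment> \<open>The Bochner integral of a function that is not integrable is \<open>0\<close>, whereas the integral of the
    Gaussian has been computed to be positive.\<close>
  assume "\<not> ?thesis"
  then have "(LINT \<xi>|lborel. complex_of_real (gauss c (\<xi>::real^'n))) = 0"
    by (rule not_integrable_integral_eq)
  then have "(LINT \<xi>|lborel. cis (- ((0::real^'n) \<bullet> \<xi>)) * of_real (gauss c \<xi>)) = 0"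
    by simp
  with fourier_gauss[OF assms, of "0::real^'n"] assms show False by (simp add: heat_kernel_def gauss_def)
qed

lemma nn_integral_heat_kernel:
  fixes x :: "real^'n"
  assumes c: "0 < c"
  shows "(\<integral>\<^sup>+y. ennreal (heat_kernel c (y - x)) \<partial>lborel) = 1"
proof -
  let ?k = "(2 * pi) powr (- real CARD('n) / 2)"
  have "of_real (?k * (LINT y|lborel. gauss 1 (y::real^'n))) = complex_of_real 1"
  proof -
    have "complex_of_real (LINT y|lborel. gauss 1 (y::real^'n)) = of_real ((2 * pi) powr (real CARD('n) / 2) * gauss 1 (0::real^'n))"
      using gaussian_integral[of "0::real^'n"] by simp
    then show ?thesis by (simp add: gauss_def powr_minus field_simps flip: of_real_mult)
  qed
  then have 1: "?k * (LINT y|lborel. gauss 1 (y::real^'n)) = 1" by (simp only: of_real_eq_iff)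
  have int: "integrable lborel (gauss 1 :: real^'n \<Rightarrow> real)"
    using integrable_Re[OF integrable_gauss[of 1]] by simp
  have "(\<integral>\<^sup>+y. ennreal (heat_kernel c (y - x)) \<partial>lborel)
      = ennreal (c ^ CARD('n)) * (\<integral>\<^sup>+y. ennreal (heat_kernel c (x + c *\<^sub>R y - x)) \<partial>lborel)"
    by (rule nn_integral_lborel_scale) (use c in auto)
  also have "\<dots> = (\<integral>\<^sup>+y. ennreal (c ^ CARD('n) * heat_kernel c (c *\<^sub>R y)) \<partial>(lborel :: (real^'n) measure))"
    using c by (subst nn_integral_cmult[symmetric]) (auto simp: ennreal_mult)
  also have "\<dots> = (\<integral>\<^sup>+y. ennreal (?k * gauss 1 y) \<partial>(lborel :: (real^'n) measure))"
    using c by (simp add: heat_kernel_scale) (simp add: heat_kernel_def)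
  also have "\<dots> = ennreal (LINT y|lborel. ?k * gauss 1 (y::real^'n))"
    by (rule nn_integral_eq_integral) (auto intro: int)
  also have "\<dots> = 1" using 1 by simp
  finally show ?thesis .
qed

section \<open>The Fourier transform of integrable functions\<close>

text \<open>The integrand is dominated by \<open>|f(x)| |\<phi>(\<xi>)|\<close>, which is integrable over the product. The kernels
  \<open>exp(\<plusminus>i x \<bullet> \<xi>)\<close> are the ones of interest.\<close>

lemma fubini_bounded_kernel:
  fixes f \<phi> :: "real^'n \<Rightarrow> complex" and e :: "real^'n \<Rightarrow> real^'n \<Rightarrow> complex"
  assumes f: "integrable lborel f" and \<phi>: "integrable lborel \<phi>"
    and e: "(\<lambda>p. e (fst p) (snd p)) \<in> borel_measurable (borel \<Otimes>\<^sub>M borel)" and le: "\<And>x \<xi>. norm (e x \<xi>) \<le> 1"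
  shows "(LINT \<xi>|lborel. (LINT x|lborel. e x \<xi> * f x) * \<phi> \<xi>)
       = (LINT x|lborel. f x * (LINT \<xi>|lborel. e x \<xi> * \<phi> \<xi>))"
proof -
  have [measurable]: "f \<in> borel_measurable borel" "\<phi> \<in> borel_measurable borel"
    using f \<phi> by (auto dest: borel_measurable_integrable)
  note e[measurable]
  let ?h = "\<lambda>x \<xi>. e x \<xi> * f x * \<phi> \<xi>"
  have "integrable (lborel \<Otimes>\<^sub>M lborel) (case_prod ?h)"
  proof (rule Bochner_Integration.integrable_bound)
    show "integrable (lborel \<Otimes>\<^sub>M lborel) (\<lambda>(x, \<xi>). f x * \<phi> \<xi>)"
      by (rule lborel_pair.Fubini_integrable)
        (auto simp: norm_mult intro!: integrable_norm f \<phi> integrable_mult_left integrable_mult_right)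
    show "case_prod ?h \<in> borel_measurable (lborel \<Otimes>\<^sub>M lborel)"
      unfolding split_beta' by (intro borel_measurable_times) (auto intro: measurable_compose[OF _ e])
    show "AE p in lborel \<Otimes>\<^sub>M lborel. norm (case_prod ?h p) \<le> norm (case p of (x, \<xi>) \<Rightarrow> f x * \<phi> \<xi>)"
    proof (intro AE_I2)
      fix p :: "(real^'n) \<times> (real^'n)"
      have "norm (e (fst p) (snd p)) * (norm (f (fst p)) * norm (\<phi> (snd p))) \<le> norm (f (fst p)) * norm (\<phi> (snd p))"
        by (intro mult_left_le_one_le le) auto
      then show "norm (case_prod ?h p) \<le> norm (case p of (x, \<xi>) \<Rightarrow> f x * \<phi> \<xi>)"
        by (simp add: split_beta norm_mult mult.assoc)
    qed
  qed
  then have "(LINT \<xi>|lborel. LINT x|lborel. ?h x \<xi>) = (LINT x|lborel. LINT \<xi>|lborel. ?h x \<xi>)"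
    by (rule lborel_pair.Fubini_integral)
  moreover have "(LINT x|lborel. ?h x \<xi>) = (LINT x|lborel. e x \<xi> * f x) * \<phi> \<xi>" for \<xi>
    by simp
  moreover have "(LINT \<xi>|lborel. ?h x \<xi>) = f x * (LINT \<xi>|lborel. e x \<xi> * \<phi> \<xi>)" for x
    by (subst integral_mult_right_zero[symmetric]) (simp add: ac_simps)
  ultimately show ?thesis by simp
qed

lemma cis_inner_measurable:
  "(\<lambda>p. cis (- (fst p \<bullet> snd p))) \<in> borel_measurable (borel \<Otimes>\<^sub>M (borel :: (real^'n) measure))"
  "(\<lambda>p. cis (fst p \<bullet> snd p)) \<in> borel_measurable (borel \<Otimes>\<^sub>M (borel :: (real^'n) measure))"
  by measurable

lemma fourier_L1_measurable [measurable]: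
  assumes [measurable]: "f \<in> borel_measurable lborel"
  shows "fourier_L1 f \<in> borel_measurable borel"
proof -
  have [measurable]: "(\<lambda>(\<xi>, x). cis (- (x \<bullet> \<xi>)) * f x) \<in> borel_measurable (borel \<Otimes>\<^sub>M lborel)"
    by measurable
  show ?thesis unfolding fourier_L1_def
    by (intro borel_measurable_times borel_measurable_const lborel.borel_measurable_lebesgue_integral) simp
qed

lemma integrable_cis_mult:
  fixes f :: "real^'n \<Rightarrow> complex"
  assumes f: "integrable lborel f"
  shows "integrable lborel (\<lambda>x. cis (- (x \<bullet> \<xi>)) * f x)"
proof -
  have [measurable]: "f \<in> borel_measurable borel"
    using f by (auto dest: borel_measurable_integrable)
  show ?thesis
    by (rule Bochner_Integration.integrable_bound[OF f]) (auto simp: norm_mult)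
qed

lemma fourier_L1_diff:
  assumes "integrable lborel f" "integrable lborel g"
  shows "fourier_L1 (\<lambda>x. f x - g x) \<xi> = fourier_L1 f \<xi> - fourier_L1 g \<xi>"
  unfolding fourier_L1_def
  by (simp add: right_diff_distrib Bochner_Integration.integral_diff integrable_cis_mult assms)

lemma fourier_L1_bound:
  fixes f :: "real^'n \<Rightarrow> complex"
  assumes "integrable lborel f"
  shows "norm (fourier_L1 f \<xi>) \<le> (2 * pi) powr (- real CARD('n) / 2) * (LINT x|lborel. norm (f x))"
proof -
  have "norm (LINT x|lborel. cis (- (x \<bullet> \<xi>)) * f x) \<le> (LINT x|lborel. norm (cis (- (x \<bullet> \<xi>)) * f x))"
    by (rule integral_norm_bound)
  then show ?thesis
    by (auto simp: fourier_L1_def norm_mult intro!: mult_left_mono)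
qed

lemma multiplication_formula_L1:
  assumes f: "integrable lborel f" and g: "integrable lborel g"
  shows "(LINT \<xi>|lborel. fourier_L1 f \<xi> * g \<xi>) = (LINT x|lborel. f x * fourier_L1 g x)"
  using fubini_bounded_kernel[OF f g cis_inner_measurable(1)]
  by (simp add: fourier_L1_def inner_commute mult.assoc mult.left_commute[of "f _"])

text \<open>Damping the product of two transforms by a Gaussian makes all integrals absolutely convergent;
  in physical space the damping is mollification by the heat kernel.\<close>

lemma fourier_L1_regularised_inner:
  fixes f g :: "real^'n \<Rightarrow> complex"
  assumes f: "integrable lborel f" and g: "integrable lborel g" and c: "0 < c"
  shows "(LINT \<xi>|lborel. fourier_L1 f \<xi> * (cnj (fourier_L1 g \<xi>) * of_real (gauss c \<xi>)))
       = (LINT x|lborel. f x * (LINT y|lborel. cnj (g y) * of_real (heat_kernel c (y - x))))"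
proof -
  let ?k = "complex_of_real ((2 * pi) powr (- real CARD('n) / 2))"
  have [measurable]: "f \<in> borel_measurable borel" "g \<in> borel_measurable borel"
    using f g by (auto dest: borel_measurable_integrable)
  have g': "integrable lborel (\<lambda>y. cnj (g y))" using g by simp
  have cnj_fourier: "cnj (fourier_L1 g \<xi>) = ?k * (LINT y|lborel. cis (y \<bullet> \<xi>) * cnj (g y))" for \<xi>
    by (simp add: fourier_L1_def cis_cnj flip: Bochner_Integration.integral_cnj)
  have \<phi>: "integrable lborel (\<lambda>\<xi>. cnj (fourier_L1 g \<xi>) * of_real (gauss c \<xi>))"
  proof (rule Bochner_Integration.integrable_bound)
    let ?M = "(2 * pi) powr (- real CARD('n) / 2) * (LINT x|lborel. norm (g x))"
    show "integrable lborel (\<lambda>\<xi>::real^'n. of_real ?M * complex_of_real (gauss c \<xi>))"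
      by (intro integrable_mult_right integrable_gauss c)
    show "AE \<xi> in lborel. norm (cnj (fourier_L1 g \<xi>) * of_real (gauss c \<xi>)) \<le> norm (of_real ?M * complex_of_real (gauss c \<xi>))"
      using fourier_L1_bound[OF g] by (auto simp: norm_mult intro!: mult_right_mono)
  qed (auto intro!: borel_measurable_times fourier_L1_measurable)
  have inner: "fourier_L1 (\<lambda>\<xi>. cnj (fourier_L1 g \<xi>) * of_real (gauss c \<xi>)) x
      = (LINT y|lborel. cnj (g y) * of_real (heat_kernel c (y - x)))" for x
  proof -
    have \<psi>: "integrable lborel (\<lambda>\<xi>. cis (- (\<xi> \<bullet> x)) * complex_of_real (gauss c \<xi>))"
      by (intro integrable_cis_mult integrable_gauss c)
    have "fourier_L1 (\<lambda>\<xi>. cnj (fourier_L1 g \<xi>) * of_real (gauss c \<xi>)) x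
        = ?k * (?k * (LINT \<xi>|lborel. (LINT y|lborel. cis (y \<bullet> \<xi>) * cnj (g y)) * (cis (- (\<xi> \<bullet> x)) * of_real (gauss c \<xi>))))"
    proof -
      have "(\<lambda>\<xi>. cis (- (\<xi> \<bullet> x)) * (?k * (LINT y|lborel. cis (y \<bullet> \<xi>) * cnj (g y)) * of_real (gauss c \<xi>)))
          = (\<lambda>\<xi>. ?k * ((LINT y|lborel. cis (y \<bullet> \<xi>) * cnj (g y)) * (cis (- (\<xi> \<bullet> x)) * of_real (gauss c \<xi>))))"
        by (simp only: ac_simps)
      then show ?thesis
        unfolding cnj_fourier by (simp only: fourier_L1_def integral_mult_right_zero)
    qed
    also have "\<dots> = ?k * (?k * (LINT y|lborel. cnj (g y) * (LINT \<xi>|lborel. cis (y \<bullet> \<xi>) * (cis (- (\<xi> \<bullet> x)) * of_real (gauss c \<xi>)))))"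
      by (subst fubini_bounded_kernel[OF g' \<psi> cis_inner_measurable(2)]) auto
    also have "\<dots> = (LINT y|lborel. cnj (g y) * (?k * (?k * (LINT \<xi>|lborel. cis (- ((x - y) \<bullet> \<xi>)) * of_real (gauss c \<xi>)))))"
      by (simp add: cis_mult inner_diff_left inner_commute[of x] mult.assoc[symmetric] flip: integral_mult_right_zero)
        (simp add: ac_simps)
    also have "\<dots> = (LINT y|lborel. cnj (g y) * of_real (heat_kernel c (x - y)))"
      by (simp only: fourier_gauss[OF c])
    finally show ?thesis
      using heat_kernel_minus[of c "x - _"] by simp
  qed
  show ?thesis
    unfolding multiplication_formula_L1[OF f \<phi>] inner ..
qed

section \<open>Plancherel's theorem\<close>

lemma norm_integral_le_nn_integral:
  fixes f :: "'a \<Rightarrow> complex"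
  shows "ennreal (norm (LINT x|M. f x)) \<le> (\<integral>\<^sup>+x. norm (f x) \<partial>M)"
  by (cases "integrable M f") (simp_all add: integral_norm_bound_ennreal not_integrable_integral_eq)

lemma Lp_norm_zero [simp]: "Lp_norm p (\<lambda>x. 0) = 0"
  by (simp add: Lp_norm_def)

lemma in_Lp_2_indicator:
  assumes "A \<in> sets borel" "bounded A"
  shows "in_Lp 2 (indicator A :: real^'n \<Rightarrow> complex)" "integrable lborel (indicator A :: real^'n \<Rightarrow> complex)"
proof -
  note assms(1)[measurable]
  have fin: "emeasure lborel A < top" using emeasure_bounded_finite[OF assms(2)] by simp
  have "(norm (indicator A x :: complex))\<^sup>2 = indicator A x" for x
    by (simp add: indicator_def)
  then show "in_Lp 2 (indicator A :: real^'n \<Rightarrow> complex)"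
    using fin by (simp add: in_Lp_2_iff ennreal_indicator)
  have "ennreal (norm (indicator A x :: complex)) = indicator A x" for x
    by (simp add: indicator_def)
  then show "integrable lborel (indicator A :: real^'n \<Rightarrow> complex)"
    using fin by (intro integrableI_bounded) auto
qed

text \<open>Bessel's inequality on \<open>L\<^sup>1 \<inter> L\<^sup>2\<close>: the regularised square of the transform is
  \<open>\<integral>\<integral> f(x) cnj (f(y)) G(y - x) dx dy\<close> with \<open>G\<close> of mass one, which the inequality
  \<open>2 |f(x)| |f(y)| \<le> |f(x)|\<^sup>2 + |f(y)|\<^sup>2\<close> bounds by the square of the norm of \<open>f\<close>.\<close>

lemma fourier_L1_bessel:
  fixes f :: "real^'n \<Rightarrow> complex"
  assumes f1: "integrable lborel f" and f2: "in_Lp 2 f"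
  shows "in_Lp 2 (fourier_L1 f)" "Lp_norm 2 (fourier_L1 f) \<le> Lp_norm 2 f"
proof -
  have [measurable]: "f \<in> borel_measurable borel" using f2 by (auto dest: in_Lp_measurable)
  have [measurable]: "fourier_L1 f \<in> borel_measurable borel" by (rule fourier_L1_measurable) simp
  have le: "(\<integral>\<^sup>+\<xi>. ennreal ((norm (fourier_L1 f \<xi>))\<^sup>2 * gauss c \<xi>) \<partial>lborel) \<le> ennreal ((Lp_norm 2 f)\<^sup>2)"
    if c: "0 < c" for c
  proof -
    let ?H = "\<lambda>x y. ennreal (heat_kernel c (y - x))"
    let ?q = "\<lambda>x. ennreal ((norm (f x))\<^sup>2)"
    have int: "integrable lborel (\<lambda>\<xi>. (norm (fourier_L1 f \<xi>))\<^sup>2 * gauss c \<xi>)"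
    proof (rule Bochner_Integration.integrable_bound)
      let ?M = "((2 * pi) powr (- real CARD('n) / 2) * (LINT x|lborel. norm (f x)))\<^sup>2"
      show "integrable lborel (\<lambda>\<xi>::real^'n. ?M * gauss c \<xi>)"
        using integrable_Re[OF integrable_gauss[OF c]] by (intro integrable_mult_right) simp
      show "AE \<xi> in lborel. norm ((norm (fourier_L1 f \<xi>))\<^sup>2 * gauss c \<xi>) \<le> norm (?M * gauss c \<xi>)"
        using fourier_L1_bound[OF f1] by (auto simp: abs_mult intro!: mult_right_mono power_mono)
    qed auto
    have "(\<integral>\<^sup>+\<xi>. ennreal ((norm (fourier_L1 f \<xi>))\<^sup>2 * gauss c \<xi>) \<partial>lborel)
        = ennreal (LINT \<xi>|lborel. (norm (fourier_L1 f \<xi>))\<^sup>2 * gauss c \<xi>)"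
      by (rule nn_integral_eq_integral[OF int]) auto
    also have "(LINT \<xi>|lborel. (norm (fourier_L1 f \<xi>))\<^sup>2 * gauss c \<xi>)
        \<le> norm (complex_of_real (LINT \<xi>|lborel. (norm (fourier_L1 f \<xi>))\<^sup>2 * gauss c \<xi>))"
      by simp
    also have "complex_of_real (LINT \<xi>|lborel. (norm (fourier_L1 f \<xi>))\<^sup>2 * gauss c \<xi>)
        = (LINT \<xi>|lborel. fourier_L1 f \<xi> * (cnj (fourier_L1 f \<xi>) * of_real (gauss c \<xi>)))"
      by (simp only: integral_complex_of_real[symmetric] of_real_mult complex_norm_square mult.assoc)
    also have "\<dots> = (LINT x|lborel. f x * (LINT y|lborel. cnj (f y) * of_real (heat_kernel c (y - x))))"
      by (rule fourier_L1_regularised_inner[OF f1 f1 c])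
    also have "ennreal (norm \<dots>) \<le> (\<integral>\<^sup>+x. norm (f x * (LINT y|lborel. cnj (f y) * of_real (heat_kernel c (y - x)))) \<partial>lborel)"
      by (rule norm_integral_le_nn_integral)
    also have "\<dots> \<le> (\<integral>\<^sup>+x. ennreal (norm (f x)) * (\<integral>\<^sup>+y. norm (cnj (f y) * of_real (heat_kernel c (y - x))) \<partial>lborel) \<partial>lborel)"
      by (intro nn_integral_mono, subst norm_mult, subst ennreal_mult)
        (intro norm_ge_zero mult_left_mono norm_integral_le_nn_integral zero_le)+
    also have "\<dots> = (\<integral>\<^sup>+x. (\<integral>\<^sup>+y. ennreal (norm (f x)) * ennreal (norm (f y)) * ?H x y \<partial>lborel) \<partial>lborel)"
      using c by (simp add: nn_integral_cmult[symmetric] norm_mult ennreal_mult mult.assoc)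
    also have "\<dots> \<le> (\<integral>\<^sup>+x. (\<integral>\<^sup>+y. ennreal (1/2) * (?q x * ?H x y + ?q y * ?H x y) \<partial>lborel) \<partial>lborel)"
    proof (intro nn_integral_mono)
      fix x y
      have "norm (f x) * norm (f y) \<le> 1/2 * ((norm (f x))\<^sup>2 + (norm (f y))\<^sup>2)"
        using sum_squares_bound[of "norm (f x)" "norm (f y)"] by simp
      then have "ennreal (norm (f x) * norm (f y)) \<le> ennreal (1/2 * ((norm (f x))\<^sup>2 + (norm (f y))\<^sup>2))"
        by (rule ennreal_leI)
      also have "ennreal (1/2 * ((norm (f x))\<^sup>2 + (norm (f y))\<^sup>2)) = ennreal (1/2) * (?q x + ?q y)"
        using ennreal_mult'[of "1/2" "(norm (f x))\<^sup>2 + (norm (f y))\<^sup>2"] by simp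
      finally have "ennreal (norm (f x)) * ennreal (norm (f y)) \<le> ennreal (1/2) * (?q x + ?q y)"
        by (subst (asm) ennreal_mult) auto
      from mult_right_mono[OF this, of "?H x y"]
      show "ennreal (norm (f x)) * ennreal (norm (f y)) * ?H x y \<le> ennreal (1/2) * (?q x * ?H x y + ?q y * ?H x y)"
        by (simp add: algebra_simps)
    qed
    also have "\<dots> = ennreal (1/2) * ((\<integral>\<^sup>+x. (\<integral>\<^sup>+y. ?q x * ?H x y \<partial>lborel) \<partial>lborel) + (\<integral>\<^sup>+x. (\<integral>\<^sup>+y. ?q y * ?H x y \<partial>lborel) \<partial>lborel))"
      by (simp add: nn_integral_cmult nn_integral_add)
    also have "(\<integral>\<^sup>+x. (\<integral>\<^sup>+y. ?q x * ?H x y \<partial>lborel) \<partial>lborel) = (\<integral>\<^sup>+x. ?q x \<partial>lborel)"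
      by (simp add: nn_integral_cmult nn_integral_heat_kernel[OF c])
    also have "(\<integral>\<^sup>+x. (\<integral>\<^sup>+y. ?q y * ?H x y \<partial>lborel) \<partial>lborel) = (\<integral>\<^sup>+y. (\<integral>\<^sup>+x. ?q y * ?H x y \<partial>lborel) \<partial>lborel)"
      by (rule lborel_pair.Fubini') measurable
    also have "\<dots> = (\<integral>\<^sup>+y. (\<integral>\<^sup>+x. ?q y * ?H y x \<partial>lborel) \<partial>lborel)"
    proof -
      have "heat_kernel c (y - x) = heat_kernel c (x - y)" for x y :: "real^'n"
        using heat_kernel_minus[of c "x - y"] by simp
      then show ?thesis by simp
    qed
    also have "\<dots> = (\<integral>\<^sup>+y. ?q y \<partial>lborel)"
      by (simp add: nn_integral_cmult nn_integral_heat_kernel[OF c])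
    also have "(\<integral>\<^sup>+y. ?q y \<partial>lborel) = ennreal ((Lp_norm 2 f)\<^sup>2)"
      by (rule nn_integral_norm_square[OF f2])
    also have "ennreal (1/2) * (ennreal ((Lp_norm 2 f)\<^sup>2) + ennreal ((Lp_norm 2 f)\<^sup>2)) = ennreal ((Lp_norm 2 f)\<^sup>2)"
    proof -
      have "ennreal (1/2 * ((Lp_norm 2 f)\<^sup>2 + (Lp_norm 2 f)\<^sup>2)) = ennreal (1/2) * (ennreal ((Lp_norm 2 f)\<^sup>2) + ennreal ((Lp_norm 2 f)\<^sup>2))"
        using ennreal_mult'[of "1/2" "(Lp_norm 2 f)\<^sup>2 + (Lp_norm 2 f)\<^sup>2"]
        by (simp only: ennreal_plus zero_le_power2)
      then show ?thesis by simp
    qed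
    finally show ?thesis by (simp add: ennreal_leI)
  qed
  define v where "v k \<xi> = fourier_L1 f \<xi> * of_real (sqrt (gauss (1 / real (Suc k)) \<xi>))" for k \<xi>
  have [measurable]: "v k \<in> borel_measurable borel" for k unfolding v_def by measurable
  have v: "in_Lp 2 (v k) \<and> Lp_norm 2 (v k) \<le> Lp_norm 2 f" for k
    using le[of "1 / real (Suc k)"] by (intro conjI Lp_norm_2_leI) (auto simp: v_def norm_mult power_mult_distrib)
  have lim: "(\<lambda>k. v k \<xi>) \<longlonglongrightarrow> fourier_L1 f \<xi>" for \<xi>
  proof -
    have "(\<lambda>k. fourier_L1 f \<xi> * of_real (sqrt (exp (- ((1 / real (Suc k)) * norm \<xi>)\<^sup>2 / 2))))
        \<longlonglongrightarrow> fourier_L1 f \<xi> * of_real (sqrt (exp (- (0 * norm \<xi>)\<^sup>2 / 2)))"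
      by (intro tendsto_intros LIMSEQ_Suc[OF lim_1_over_n]) auto
    then show ?thesis by (simp add: v_def gauss_def)
  qed
  show "in_Lp 2 (fourier_L1 f)" "Lp_norm 2 (fourier_L1 f) \<le> Lp_norm 2 f"
    using Lp_2_fatou[of v "Lp_norm 2 f" "fourier_L1 f"] v lim by auto
qed

lemma truncation:
  fixes f :: "real^'n \<Rightarrow> complex"
  assumes f: "in_Lp 2 f"
  shows "in_Lp 2 (\<lambda>x. indicator (cball 0 R) x * f x)"
    and "integrable lborel (\<lambda>x. indicator (cball 0 R) x * f x)"
    and "((\<lambda>R. Lp_norm 2 (\<lambda>x. indicator (cball 0 R) x * f x - f x)) \<longlongrightarrow> 0) at_top"
proof -
  have [measurable]: "f \<in> borel_measurable borel" using f by (auto dest: in_Lp_measurable)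
  show tr: "in_Lp 2 (\<lambda>x. indicator (cball 0 R) x * f x)" for R
    by (rule Lp_2_mono(1)[OF f, of _ 1]) (auto simp: norm_mult indicator_def)
  show "integrable lborel (\<lambda>x. indicator (cball 0 R) x * f x)"
    by (intro Lp_2_mult_integrable in_Lp_2_indicator f) auto
  show "((\<lambda>R. Lp_norm 2 (\<lambda>x. indicator (cball 0 R) x * f x - f x)) \<longlongrightarrow> 0) at_top"
  proof (rule tendsto_at_topI_sequentially)
    fix X :: "nat \<Rightarrow> real" assume X: "filterlim X at_top sequentially"
    show "(\<lambda>k. Lp_norm 2 (\<lambda>x. indicator (cball 0 (X k)) x * f x - f x)) \<longlonglongrightarrow> 0"
    proof (rule Lp_2_dominated[OF _ f])
      show "AE x in lborel. norm (indicator (cball 0 (X k)) x * f x - f x) \<le> norm (f x)" for k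
        by (auto simp: indicator_def)
      show "AE x in lborel. (\<lambda>k. indicator (cball 0 (X k)) x * f x - f x) \<longlonglongrightarrow> 0"
      proof (intro AE_I2 tendsto_eventually)
        fix x :: "real^'n"
        have "eventually (\<lambda>k. norm x \<le> X k) sequentially"
          using X by (simp add: filterlim_at_top)
        then show "eventually (\<lambda>k. indicator (cball 0 (X k)) x * f x - f x = 0) sequentially"
          by eventually_elim (simp add: indicator_def)
      qed
      show "(\<lambda>x. indicator (cball 0 (X k)) x * f x - f x) \<in> borel_measurable lborel" for k
        by (intro in_Lp_measurable[of 2] Lp_2_diff tr f)
    qed
  qed
qed

lemma is_fourier_iff:
  "is_fourier f g \<longleftrightarrow> in_Lp 2 f \<and> in_Lp 2 g \<and>
     ((\<lambda>R. Lp_norm 2 (\<lambda>\<xi>. fourier_L1 (\<lambda>x. indicator (cball 0 R) x * f x) \<xi> - g \<xi>)) \<longlongrightarrow> 0) at_top"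
proof -
  have "in_Lp 2 (\<lambda>\<xi>. fourier_L1 (\<lambda>x. indicator (cball 0 R) x * f x) \<xi> - g \<xi>)" if "in_Lp 2 f" "in_Lp 2 g" for R
    using that by (intro Lp_2_diff(1) fourier_L1_bessel truncation)
  then show ?thesis
    unfolding is_fourier_def by (auto simp: tendsto_zero_L2_iff)
qed

lemma is_fourier_in_Lp: "is_fourier f g \<Longrightarrow> in_Lp 2 f" "is_fourier f g \<Longrightarrow> in_Lp 2 g"
  by (simp_all add: is_fourier_def)

lemma fourier_L1_diff_bound:
  assumes "in_Lp 2 f" "integrable lborel f" "in_Lp 2 g" "integrable lborel g"
  shows "Lp_norm 2 (\<lambda>\<xi>. fourier_L1 f \<xi> - fourier_L1 g \<xi>) \<le> Lp_norm 2 (\<lambda>x. f x - g x)"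
proof -
  have "fourier_L1 (\<lambda>x. f x - g x) = (\<lambda>\<xi>. fourier_L1 f \<xi> - fourier_L1 g \<xi>)"
    using fourier_L1_diff[OF assms(2,4)] by auto
  then show ?thesis
    using fourier_L1_bessel(2)[of "\<lambda>x. f x - g x"] assms by (simp add: Lp_2_diff)
qed

lemma is_fourier_fourier_L1:
  assumes "in_Lp 2 f" "integrable lborel f"
  shows "is_fourier f (fourier_L1 f)"
  unfolding is_fourier_iff
proof (intro conjI assms fourier_L1_bessel)
  show "((\<lambda>R. Lp_norm 2 (\<lambda>\<xi>. fourier_L1 (\<lambda>x. indicator (cball 0 R) x * f x) \<xi> - fourier_L1 f \<xi>)) \<longlongrightarrow> 0) at_top"
    by (rule Lim_null_comparison[OF always_eventually truncation(3)[OF assms(1)]])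
      (auto intro!: fourier_L1_diff_bound truncation assms)
qed

text \<open>By Bessel's inequality the transforms of the truncations form a Cauchy sequence along the integer radii.
  The same inequality compares an arbitrary radius with the integer ones, which gives the limit along all
  radii.\<close>

lemma is_fourier_exists:
  assumes f: "in_Lp 2 f"
  shows "\<exists>g. is_fourier f g"
proof -
  let ?f = "\<lambda>R x. indicator (cball 0 R) x * f x"
  let ?e = "\<lambda>R. Lp_norm 2 (\<lambda>x. ?f R x - f x)"
  note tr = truncation[OF f]
  have F2: "in_Lp 2 (fourier_L1 (?f R))" for R by (intro fourier_L1_bessel tr)
  have diff: "Lp_norm 2 (\<lambda>\<xi>. fourier_L1 (?f R) \<xi> - fourier_L1 (?f S) \<xi>) \<le> ?e R + ?e S" for R S
  proof -
    have "Lp_norm 2 (\<lambda>\<xi>. fourier_L1 (?f R) \<xi> - fourier_L1 (?f S) \<xi>) \<le> Lp_norm 2 (\<lambda>x. ?f R x - ?f S x)"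
      by (intro fourier_L1_diff_bound tr)
    also have "\<dots> \<le> ?e R + Lp_norm 2 (\<lambda>x. f x - ?f S x)"
      by (intro Lp_norm_2_triangle tr f)
    finally show ?thesis by (simp only: Lp_norm_2_diff_commute[of f])
  qed
  have e0: "(\<lambda>k. ?e (real k)) \<longlonglongrightarrow> 0"
    by (rule filterlim_compose[OF tr(3) filterlim_real_sequentially])
  have "\<exists>N. \<forall>m\<ge>N. \<forall>n\<ge>N. Lp_norm 2 (\<lambda>\<xi>. fourier_L1 (?f (real m)) \<xi> - fourier_L1 (?f (real n)) \<xi>) \<le> \<epsilon>"
    if \<epsilon>: "\<epsilon> > 0" for \<epsilon>
  proof -
    have "eventually (\<lambda>k. ?e (real k) < \<epsilon> / 2) sequentially"
      using order_tendstoD(2)[OF e0, of "\<epsilon> / 2"] \<epsilon> by simp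
    then obtain N where N: "\<And>k. k \<ge> N \<Longrightarrow> ?e (real k) < \<epsilon> / 2"
      unfolding eventually_sequentially by blast
    show ?thesis
    proof (intro exI allI impI)
      fix m n assume "m \<ge> N" "n \<ge> N"
      from diff[of "real m" "real n"] N[OF this(1)] N[OF this(2)]
      show "Lp_norm 2 (\<lambda>\<xi>. fourier_L1 (?f (real m)) \<xi> - fourier_L1 (?f (real n)) \<xi>) \<le> \<epsilon>" by linarith
    qed
  qed
  from riesz_fischer[OF F2 this]
  obtain g where g: "in_Lp 2 g" "(\<lambda>k. Lp_norm 2 (\<lambda>\<xi>. fourier_L1 (?f (real k)) \<xi> - g \<xi>)) \<longlonglongrightarrow> 0"
    by blast
  have le: "Lp_norm 2 (\<lambda>\<xi>. fourier_L1 (?f R) \<xi> - g \<xi>) \<le> ?e R" for R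
  proof (rule tendsto_lowerbound)
    show "(\<lambda>k. ?e R + ?e (real k) + Lp_norm 2 (\<lambda>\<xi>. fourier_L1 (?f (real k)) \<xi> - g \<xi>)) \<longlonglongrightarrow> ?e R"
      using tendsto_add[OF tendsto_add[OF tendsto_const e0] g(2)] by simp
    have "Lp_norm 2 (\<lambda>\<xi>. fourier_L1 (?f R) \<xi> - g \<xi>) \<le> ?e R + ?e (real k) + Lp_norm 2 (\<lambda>\<xi>. fourier_L1 (?f (real k)) \<xi> - g \<xi>)" for k
      using Lp_norm_2_triangle[OF F2[of R] F2[of "real k"] g(1)] diff[of R "real k"] by linarith
    then show "eventually (\<lambda>k. Lp_norm 2 (\<lambda>\<xi>. fourier_L1 (?f R) \<xi> - g \<xi>) \<le> ?e R + ?e (real k) + Lp_norm 2 (\<lambda>\<xi>. fourier_L1 (?f (real k)) \<xi> - g \<xi>)) sequentially"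
      by (rule always_eventually[OF allI])
  qed simp
  have "((\<lambda>R. Lp_norm 2 (\<lambda>\<xi>. fourier_L1 (?f R) \<xi> - g \<xi>)) \<longlongrightarrow> 0) at_top"
    by (rule Lim_null_comparison[OF always_eventually tr(3)]) (use le in auto)
  with f g(1) show ?thesis unfolding is_fourier_iff by blast
qed

lemma is_fourier_contraction:
  assumes "is_fourier f g"
  shows "Lp_norm 2 g \<le> Lp_norm 2 f"
proof (rule tendsto_le)
  let ?f = "\<lambda>R x. indicator (cball 0 R) x * f x"
  have f: "in_Lp 2 f" and g: "in_Lp 2 g"
    and lim: "((\<lambda>R. Lp_norm 2 (\<lambda>\<xi>. fourier_L1 (?f R) \<xi> - g \<xi>)) \<longlongrightarrow> 0) at_top"
    using assms by (simp_all add: is_fourier_iff)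
  show "((\<lambda>R. Lp_norm 2 (fourier_L1 (?f R))) \<longlongrightarrow> Lp_norm 2 g) at_top"
    by (intro Lp_norm_2_tendsto lim g fourier_L1_bessel truncation f)
  show "((\<lambda>R. Lp_norm 2 (?f R)) \<longlongrightarrow> Lp_norm 2 f) at_top"
    by (intro Lp_norm_2_tendsto f truncation)
  show "eventually (\<lambda>R. Lp_norm 2 (fourier_L1 (?f R)) \<le> Lp_norm 2 (?f R)) at_top"
    by (intro always_eventually allI fourier_L1_bessel truncation f)
qed simp

lemma is_fourier_lincomb:
  assumes "is_fourier f g" "is_fourier f' g'"
  shows "is_fourier (\<lambda>x. a * f x + b * f' x) (\<lambda>\<xi>. a * g \<xi> + b * g' \<xi>)"
proof -
  let ?T = "\<lambda>h R x. indicator (cball 0 R) x * h x"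
  have f: "in_Lp 2 f" "in_Lp 2 f'" and g: "in_Lp 2 g" "in_Lp 2 g'"
    and lim: "((\<lambda>R. Lp_norm 2 (\<lambda>\<xi>. fourier_L1 (?T f R) \<xi> - g \<xi>)) \<longlongrightarrow> 0) at_top"
      "((\<lambda>R. Lp_norm 2 (\<lambda>\<xi>. fourier_L1 (?T f' R) \<xi> - g' \<xi>)) \<longlongrightarrow> 0) at_top"
    using assms by (simp_all add: is_fourier_iff)
  have eq: "fourier_L1 (?T (\<lambda>x. a * f x + b * f' x) R) \<xi> = a * fourier_L1 (?T f R) \<xi> + b * fourier_L1 (?T f' R) \<xi>" for R \<xi>
  proof -
    have "(LINT x|lborel. cis (- (x \<bullet> \<xi>)) * (?T (\<lambda>x. a * f x + b * f' x) R x))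
        = (LINT x|lborel. a * (cis (- (x \<bullet> \<xi>)) * ?T f R x) + b * (cis (- (x \<bullet> \<xi>)) * ?T f' R x))"
      by (simp add: algebra_simps)
    also have "\<dots> = a * (LINT x|lborel. cis (- (x \<bullet> \<xi>)) * ?T f R x) + b * (LINT x|lborel. cis (- (x \<bullet> \<xi>)) * ?T f' R x)"
      by (subst Bochner_Integration.integral_add) (intro integrable_mult_right integrable_cis_mult truncation f | simp only: integral_mult_right_zero)+
    finally show ?thesis by (simp add: fourier_L1_def algebra_simps)
  qed
  have d: "in_Lp 2 (\<lambda>\<xi>. fourier_L1 (?T f R) \<xi> - g \<xi>)" "in_Lp 2 (\<lambda>\<xi>. fourier_L1 (?T f' R) \<xi> - g' \<xi>)" for R
    by (intro Lp_2_diff fourier_L1_bessel truncation f g)+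
  have "((\<lambda>R. Lp_norm 2 (\<lambda>\<xi>. fourier_L1 (?T (\<lambda>x. a * f x + b * f' x) R) \<xi> - (a * g \<xi> + b * g' \<xi>))) \<longlongrightarrow> 0) at_top"
  proof (rule Lim_null_comparison[OF always_eventually], intro allI)
    fix R
    have "Lp_norm 2 (\<lambda>\<xi>. a * (fourier_L1 (?T f R) \<xi> - g \<xi>) + b * (fourier_L1 (?T f' R) \<xi> - g' \<xi>))
        \<le> norm a * Lp_norm 2 (\<lambda>\<xi>. fourier_L1 (?T f R) \<xi> - g \<xi>) + norm b * Lp_norm 2 (\<lambda>\<xi>. fourier_L1 (?T f' R) \<xi> - g' \<xi>)"
      using Lp_2_add(2)[OF Lp_norm_2_cmult(1)[OF d(1)[of R], of a] Lp_norm_2_cmult(1)[OF d(2)[of R], of b]]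
      by (simp only: Lp_norm_2_cmult(2)[OF d(1)] Lp_norm_2_cmult(2)[OF d(2)])
    then show "norm (Lp_norm 2 (\<lambda>\<xi>. fourier_L1 (?T (\<lambda>x. a * f x + b * f' x) R) \<xi> - (a * g \<xi> + b * g' \<xi>)))
        \<le> norm a * Lp_norm 2 (\<lambda>\<xi>. fourier_L1 (?T f R) \<xi> - g \<xi>) + norm b * Lp_norm 2 (\<lambda>\<xi>. fourier_L1 (?T f' R) \<xi> - g' \<xi>)"
      unfolding eq by (simp add: algebra_simps)
  next
    show "((\<lambda>R. norm a * Lp_norm 2 (\<lambda>\<xi>. fourier_L1 (?T f R) \<xi> - g \<xi>) + norm b * Lp_norm 2 (\<lambda>\<xi>. fourier_L1 (?T f' R) \<xi> - g' \<xi>)) \<longlongrightarrow> 0) at_top"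
      using tendsto_add[OF tendsto_mult_left[OF lim(1), of "norm a"] tendsto_mult_left[OF lim(2), of "norm b"]] by simp
  qed
  moreover have "in_Lp 2 (\<lambda>x. a * f x + b * f' x)" "in_Lp 2 (\<lambda>\<xi>. a * g \<xi> + b * g' \<xi>)"
    by (intro Lp_2_add Lp_norm_2_cmult f g)+
  ultimately show ?thesis unfolding is_fourier_iff by blast
qed

lemma is_fourier_unique:
  assumes "is_fourier f g" "is_fourier f g'"
  shows "AE \<xi> in lborel. g \<xi> = g' \<xi>"
proof -
  have *: "is_fourier (\<lambda>x. 1 * f x + (-1) * f x) (\<lambda>\<xi>. 1 * g \<xi> + (-1) * g' \<xi>)"
    by (rule is_fourier_lincomb[OF assms])
  have "Lp_norm 2 (\<lambda>\<xi>. 1 * g \<xi> + (-1) * g' \<xi>) \<le> Lp_norm 2 (\<lambda>x. 1 * f x + (-1) * f x)"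
    by (rule is_fourier_contraction[OF *])
  also have "\<dots> = 0" by (simp add: Lp_norm_def)
  finally have "Lp_norm 2 (\<lambda>\<xi>. 1 * g \<xi> + (-1) * g' \<xi>) = 0"
    using Lp_norm_nonneg by (intro antisym)
  from Lp_norm_2_eq_0[OF is_fourier_in_Lp(2)[OF *] this] show ?thesis by simp
qed

lemma is_fourier_cong_AE:
  assumes g: "is_fourier f g" and g': "g' \<in> borel_measurable lborel" and eq: "AE \<xi> in lborel. g' \<xi> = g \<xi>"
  shows "is_fourier f g'"
proof -
  have [measurable]: "g' \<in> borel_measurable borel" using g' by simp
  have 1: "in_Lp 2 g'" by (rule Lp_2_cong_AE(1)[OF is_fourier_in_Lp(2)[OF g] g' eq])
  have "Lp_norm 2 (\<lambda>\<xi>. fourier_L1 (\<lambda>x. indicator (cball 0 R) x * f x) \<xi> - g' \<xi>)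
      = Lp_norm 2 (\<lambda>\<xi>. fourier_L1 (\<lambda>x. indicator (cball 0 R) x * f x) \<xi> - g \<xi>)" for R
  proof (rule Lp_2_cong_AE(2))
    show "in_Lp 2 (\<lambda>\<xi>. fourier_L1 (\<lambda>x. indicator (cball 0 R) x * f x) \<xi> - g \<xi>)"
      by (intro Lp_2_diff fourier_L1_bessel truncation is_fourier_in_Lp[OF g])
    show "(\<lambda>\<xi>. fourier_L1 (\<lambda>x. indicator (cball 0 R) x * f x) \<xi> - g' \<xi>) \<in> borel_measurable lborel"
      by (intro in_Lp_measurable[of 2] Lp_2_diff fourier_L1_bessel truncation is_fourier_in_Lp[OF g] 1)
    show "AE \<xi> in lborel. fourier_L1 (\<lambda>x. indicator (cball 0 R) x * f x) \<xi> - g' \<xi>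
        = fourier_L1 (\<lambda>x. indicator (cball 0 R) x * f x) \<xi> - g \<xi>"
      using eq by eventually_elim simp
  qed
  with g 1 show ?thesis by (simp add: is_fourier_iff)
qed

text \<open>The Fourier transform is its own transpose. This passes from \<open>L\<^sup>1\<close> to \<open>L\<^sup>2\<close> because the pairing
  \<open>\<integral> f g\<close> is continuous.\<close>

lemma multiplication_formula:
  assumes "is_fourier f g" "is_fourier f' g'"
  shows "(LINT \<xi>|lborel. g \<xi> * f' \<xi>) = (LINT x|lborel. f x * g' x)"
proof (rule tendsto_unique)
  let ?T = "\<lambda>h R x. indicator (cball 0 R) x * h x"
  have f: "in_Lp 2 f" "in_Lp 2 f'" and g: "in_Lp 2 g" "in_Lp 2 g'"
    and lim: "((\<lambda>R. Lp_norm 2 (\<lambda>\<xi>. fourier_L1 (?T f R) \<xi> - g \<xi>)) \<longlongrightarrow> 0) at_top"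
      "((\<lambda>R. Lp_norm 2 (\<lambda>\<xi>. fourier_L1 (?T f' R) \<xi> - g' \<xi>)) \<longlongrightarrow> 0) at_top"
    using assms by (simp_all add: is_fourier_iff)
  show "((\<lambda>R. LINT x|lborel. ?T f R x * fourier_L1 (?T f' R) x) \<longlongrightarrow> (LINT x|lborel. f x * g' x)) at_top"
    by (intro Lp_2_pairing_tendsto f g lim truncation fourier_L1_bessel)
  have "((\<lambda>R. LINT x|lborel. fourier_L1 (?T f R) x * ?T f' R x) \<longlongrightarrow> (LINT x|lborel. g x * f' x)) at_top"
    by (intro Lp_2_pairing_tendsto f g lim truncation fourier_L1_bessel)
  then show "((\<lambda>R. LINT x|lborel. ?T f R x * fourier_L1 (?T f' R) x) \<longlongrightarrow> (LINT x|lborel. g x * f' x)) at_top"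
    by (simp only: multiplication_formula_L1[OF truncation(2)[OF f(1)] truncation(2)[OF f(2)]])
qed simp

text \<open>The heat kernel mollifies the indicator function of a box to a function with the same limit
  off the boundary; with the regularised inner product this yields Parseval's identity against boxes.\<close>

lemma heat_kernel_indicator_box:
  fixes x :: "real^'n"
  assumes x: "x \<notin> frontier (box l u)"
  shows "(\<lambda>k. LINT y|lborel. cnj (indicator (box l u) y) * of_real (heat_kernel (1 / real (Suc k)) (y - x)))
    \<longlonglongrightarrow> indicator (box l u) x"
proof -
  let ?B = "box l u"
  let ?c = "\<lambda>k. 1 / real (Suc k)"
  have mass: "(\<integral>\<^sup>+y. ennreal (heat_kernel 1 (y :: real^'n)) \<partial>lborel) = 1"
    using nn_integral_heat_kernel[of 1 0] by simp
  then have int: "integrable lborel (heat_kernel 1 :: real^'n \<Rightarrow> real)"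
    by (intro integrableI_nonneg) auto
  have one: "(LINT y|lborel. heat_kernel 1 (y :: real^'n)) = 1"
    using nn_integral_eq_integral[OF int] mass by simp
  have eq: "(LINT y|lborel. cnj (indicator ?B y) * of_real (heat_kernel (?c k) (y - x)))
      = (LINT z|lborel. indicator ?B (x + ?c k *\<^sub>R z) * complex_of_real (heat_kernel 1 z))" for k
  proof -
    have c: "?c k > 0" by simp
    have "(LINT y|lborel. cnj (indicator ?B y) * of_real (heat_kernel (?c k) (y - x)))
      = of_real (?c k ^ CARD('n)) * (LINT z|lborel. cnj (indicator ?B (x + ?c k *\<^sub>R z)) * of_real (heat_kernel (?c k) (x + ?c k *\<^sub>R z - x)))"
      by (rule integral_lborel_scale[OF _ c]) measurable
    also have "\<dots> = (LINT z|lborel. indicator ?B (x + ?c k *\<^sub>R z) * complex_of_real (?c k ^ CARD('n) * heat_kernel (?c k) (?c k *\<^sub>R z)))"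
      unfolding integral_mult_right_zero[symmetric]
      by (intro Bochner_Integration.integral_cong) (auto simp: indicator_def)
    finally show ?thesis by (simp only: heat_kernel_scale[OF c])
  qed
  have "(\<lambda>k. LINT z|lborel. indicator ?B (x + ?c k *\<^sub>R z) * complex_of_real (heat_kernel 1 z))
      \<longlonglongrightarrow> (LINT z|lborel. indicator ?B x * complex_of_real (heat_kernel 1 (z :: real^'n)))"
  proof (rule integral_dominated_convergence[where w = "heat_kernel 1"])
    show "AE z in lborel. (\<lambda>k. indicator ?B (x + ?c k *\<^sub>R z) * complex_of_real (heat_kernel 1 z))
        \<longlonglongrightarrow> indicator ?B x * complex_of_real (heat_kernel 1 z)"
    proof (intro AE_I2)
      fix z :: "real^'n"
      have lim: "(\<lambda>k. x + ?c k *\<^sub>R z) \<longlonglongrightarrow> x + 0 *\<^sub>R z"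
        by (intro tendsto_intros LIMSEQ_Suc[OF lim_1_over_n])
      have "eventually (\<lambda>k. (x + ?c k *\<^sub>R z \<in> ?B) = (x \<in> ?B)) sequentially"
      proof (cases "x \<in> ?B")
        case True
        then show ?thesis using topological_tendstoD[OF lim open_box, of l u] by simp
      next
        case False
        then have "x \<in> - closure ?B" using x by (simp add: frontier_def interior_open[OF open_box])
        then have "eventually (\<lambda>k. x + ?c k *\<^sub>R z \<in> - closure ?B) sequentially"
          using topological_tendstoD[OF lim, of "- closure ?B"] by (simp add: open_Compl)
        then show ?thesis
          by eventually_elim (use False closure_subset[of ?B] in blast)
      qed
      then have "eventually (\<lambda>k. indicator ?B (x + ?c k *\<^sub>R z) * complex_of_real (heat_kernel 1 z)
          = indicator ?B x * complex_of_real (heat_kernel 1 z)) sequentially"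
        by eventually_elim (simp add: indicator_def)
      then show "(\<lambda>k. indicator ?B (x + ?c k *\<^sub>R z) * complex_of_real (heat_kernel 1 z))
        \<longlonglongrightarrow> indicator ?B x * complex_of_real (heat_kernel 1 z)"
        by (rule tendsto_eventually)
    qed
    show "AE z in lborel. norm (indicator ?B (x + ?c k *\<^sub>R z) * complex_of_real (heat_kernel 1 z)) \<le> heat_kernel 1 z" for k
      by (auto simp: norm_mult indicator_def)
  qed (auto intro: int)
  also have "(LINT z|lborel. indicator ?B x * complex_of_real (heat_kernel 1 (z :: real^'n))) = indicator ?B x"
    by (simp add: one)
  finally show ?thesis unfolding eq .
qed

lemma parseval_box:
  fixes f :: "real^'n \<Rightarrow> complex"
  assumes f1: "integrable lborel f" and f2: "in_Lp 2 f"
  shows "(LINT \<xi>|lborel. fourier_L1 f \<xi> * cnj (fourier_L1 (indicator (box l u)) \<xi>))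
       = (LINT x|lborel. f x * indicator (box l u) x)"
proof (rule LIMSEQ_unique)
  let ?B = "box l u"
  let ?c = "\<lambda>k. 1 / real (Suc k)"
  let ?F = "fourier_L1 f" and ?G = "fourier_L1 (indicator ?B :: real^'n \<Rightarrow> complex)"
  have B: "in_Lp 2 (indicator ?B :: real^'n \<Rightarrow> complex)" "integrable lborel (indicator ?B :: real^'n \<Rightarrow> complex)"
    by (rule in_Lp_2_indicator; simp)+
  have FG: "integrable lborel (\<lambda>\<xi>. ?F \<xi> * cnj (?G \<xi>))"
    by (intro Lp_2_mult_integrable fourier_L1_bessel f1 f2) (simp add: fourier_L1_bessel B)
  have [measurable]: "f \<in> borel_measurable borel" using f2 by (auto dest: in_Lp_measurable)
  have [measurable]: "?F \<in> borel_measurable borel" "?G \<in> borel_measurable borel"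
    by (rule fourier_L1_measurable; simp)+
  have "(\<lambda>k. LINT \<xi>|lborel. ?F \<xi> * (cnj (?G \<xi>) * of_real (gauss (?c k) \<xi>))) \<longlonglongrightarrow> (LINT \<xi>|lborel. ?F \<xi> * cnj (?G \<xi>))"
  proof (rule integral_dominated_convergence[where w = "\<lambda>\<xi>. norm (?F \<xi> * cnj (?G \<xi>))"])
    show "AE \<xi> in lborel. (\<lambda>k. ?F \<xi> * (cnj (?G \<xi>) * of_real (gauss (?c k) \<xi>))) \<longlonglongrightarrow> ?F \<xi> * cnj (?G \<xi>)"
    proof (intro AE_I2)
      fix \<xi>
      have "(\<lambda>k. ?F \<xi> * (cnj (?G \<xi>) * of_real (exp (- (?c k * norm \<xi>)\<^sup>2 / 2))))
          \<longlonglongrightarrow> ?F \<xi> * (cnj (?G \<xi>) * of_real (exp (- (0 * norm \<xi>)\<^sup>2 / 2)))"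
        by (intro tendsto_intros LIMSEQ_Suc[OF lim_1_over_n]) auto
      then show "(\<lambda>k. ?F \<xi> * (cnj (?G \<xi>) * of_real (gauss (?c k) \<xi>))) \<longlonglongrightarrow> ?F \<xi> * cnj (?G \<xi>)"
        by (simp add: gauss_def)
    qed
    show "AE \<xi> in lborel. norm (?F \<xi> * (cnj (?G \<xi>) * of_real (gauss (?c k) \<xi>))) \<le> norm (?F \<xi> * cnj (?G \<xi>))" for k
      by (auto simp: norm_mult simp del: complex_mod_cnj intro!: mult_left_mono mult_left_le)
    show "integrable lborel (\<lambda>\<xi>. norm (?F \<xi> * cnj (?G \<xi>)))"
      by (rule integrable_norm[OF FG])
  qed (intro borel_measurable_times; simp)+
  then show "(\<lambda>k. LINT x|lborel. f x * (LINT y|lborel. cnj (indicator ?B y) * of_real (heat_kernel (?c k) (y - x))))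
      \<longlonglongrightarrow> (LINT \<xi>|lborel. ?F \<xi> * cnj (?G \<xi>))"
    by (subst fourier_L1_regularised_inner[OF f1 B(2), symmetric]) auto
  show "(\<lambda>k. LINT x|lborel. f x * (LINT y|lborel. cnj (indicator ?B y) * of_real (heat_kernel (?c k) (y - x))))
      \<longlonglongrightarrow> (LINT x|lborel. f x * indicator ?B x)"
  proof (rule integral_dominated_convergence[where w = "\<lambda>x. norm (f x)"])
    have "AE x in lborel. x \<notin> frontier ?B"
    proof (rule AE_not_in)
      have "negligible (frontier ?B)" by (rule negligible_convex_frontier) simp
      moreover have "frontier ?B \<in> sets borel" by simp
      ultimately show "frontier ?B \<in> null_sets lborel"
        by (simp add: negligible_iff_null_sets null_sets_completion_iff)
    qed
    then show "AE x in lborel. (\<lambda>k. f x * (LINT y|lborel. cnj (indicator ?B y) * of_real (heat_kernel (?c k) (y - x)))) \<longlonglongrightarrow> f x * indicator ?B x"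
      by eventually_elim (intro tendsto_mult_left heat_kernel_indicator_box)
    show "AE x in lborel. norm (f x * (LINT y|lborel. cnj (indicator ?B y) * of_real (heat_kernel (?c k) (y - x)))) \<le> norm (f x)" for k
    proof (intro AE_I2)
      fix x
      have "ennreal (norm (LINT y|lborel. cnj (indicator ?B y) * complex_of_real (heat_kernel (?c k) (y - x))))
          \<le> (\<integral>\<^sup>+y. norm (cnj (indicator ?B y) * complex_of_real (heat_kernel (?c k) (y - x))) \<partial>lborel)"
        by (rule norm_integral_le_nn_integral)
      also have "\<dots> \<le> (\<integral>\<^sup>+y. heat_kernel (?c k) (y - x) \<partial>lborel)"
        by (intro nn_integral_mono ennreal_leI) (auto simp: norm_mult indicator_def)
      also have "\<dots> = 1" by (rule nn_integral_heat_kernel) simp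
      finally have "norm (LINT y|lborel. cnj (indicator ?B y) * complex_of_real (heat_kernel (?c k) (y - x))) \<le> 1"
        by (simp add: ennreal_le_1)
      then show "norm (f x * (LINT y|lborel. cnj (indicator ?B y) * of_real (heat_kernel (?c k) (y - x)))) \<le> norm (f x)"
        by (simp add: norm_mult mult_left_le)
    qed
    have "(\<lambda>x. LINT y|lborel. cnj (indicator ?B y) * complex_of_real (heat_kernel (?c k) (y - x))) \<in> borel_measurable borel" for k
      by (rule lborel.borel_measurable_lebesgue_integral) measurable
    then show "(\<lambda>x. f x * (LINT y|lborel. cnj (indicator ?B y) * of_real (heat_kernel (?c k) (y - x)))) \<in> borel_measurable lborel" for k
      by (intro borel_measurable_times) auto
  qed (auto intro: f1 integrable_norm)
qed

text \<open>The positive and the negative part of \<open>h\<close> are densities of two measures that agree on boxes. Boxes are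
  closed under intersection and generate the Borel sets, so the measures, and with them the densities,
  coincide.\<close>

lemma zero_of_box_integrals_real:
  fixes h :: "real^'n \<Rightarrow> real"
  assumes int: "\<And>l u. integrable lborel (\<lambda>x. h x * indicator (box l u) x)"
    and zero: "\<And>l u. (LINT x|lborel. h x * indicator (box l u) x) = 0"
    and [measurable]: "h \<in> borel_measurable borel"
  shows "AE x in lborel. h x = 0"
proof -
  let ?P = "density lborel (\<lambda>x. ennreal (h x))" and ?N = "density lborel (\<lambda>x. ennreal (- h x))"
  let ?E = "range (\<lambda>(a, b). box a b :: (real^'n) set)"
  have emeasure: "emeasure (density lborel (\<lambda>x. ennreal (g x))) (box l u) = ennreal (LINT x|lborel. max 0 (g x * indicator (box l u) x))"
    if [measurable]: "g \<in> borel_measurable borel" and "integrable lborel (\<lambda>x. g x * indicator (box l u) x)"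
    for g :: "real^'n \<Rightarrow> real" and l u
  proof -
    have "emeasure (density lborel (\<lambda>x. ennreal (g x))) (box l u) = (\<integral>\<^sup>+x. ennreal (max 0 (g x * indicator (box l u) x)) \<partial>lborel)"
      by (subst emeasure_density) (auto intro!: nn_integral_cong simp: indicator_def max_def ennreal_neg)
    also have "\<dots> = ennreal (LINT x|lborel. max 0 (g x * indicator (box l u) x))"
      by (rule nn_integral_eq_integral) (auto intro: that)
    finally show ?thesis .
  qed
  have eq: "emeasure ?P (box l u) = emeasure ?N (box l u)" for l u
  proof -
    have "(LINT x|lborel. max 0 (h x * indicator (box l u) x)) - (LINT x|lborel. max 0 (- h x * indicator (box l u) x))
        = (LINT x|lborel. max 0 (h x * indicator (box l u) x) - max 0 (- h x * indicator (box l u) x))"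
      by (rule Bochner_Integration.integral_diff[symmetric]) (use int[of l u] in auto)
    also have "\<dots> = (LINT x|lborel. h x * indicator (box l u) x)"
      by (intro Bochner_Integration.integral_cong) (auto simp: max_def)
    finally show ?thesis
      using zero[of l u] int[of l u] by (subst (1 2) emeasure) auto
  qed
  have "?P = ?N"
  proof (rule measure_eqI_generator_eq)
    show "Int_stable ?E" by (auto simp: Int_stable_def box_Int_box)
    show "?E \<subseteq> Pow UNIV" "sets ?P = sigma_sets UNIV ?E" "sets ?N = sigma_sets UNIV ?E"
      by (simp_all add: borel_eq_box)
    let ?A = "\<lambda>n::nat. box (- (real n *\<^sub>R One)) (real n *\<^sub>R One) :: (real^'n) set"
    show "range ?A \<subseteq> ?E" "(\<Union>i. ?A i) = UNIV" unfolding UN_box_eq_UNIV by auto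
    show "emeasure ?P (?A i) \<noteq> \<infinity>" for i by (subst emeasure) (auto intro: int)
    show "emeasure ?P X = emeasure ?N X" if "X \<in> ?E" for X using that eq by auto
  qed
  then have "AE x in lborel. ennreal (h x) = ennreal (- h x)"
    by (intro sigma_finite_measure.density_unique[OF sigma_finite_lborel]) auto
  then show ?thesis
    by eventually_elim (metis ennreal_eq_0_iff ennreal_neg linorder_linear neg_0_le_iff_le neg_le_0_iff_le order_antisym)
qed

lemma zero_of_box_integrals:
  fixes h :: "real^'n \<Rightarrow> complex"
  assumes h: "in_Lp 2 h" and zero: "\<And>l u. (LINT x|lborel. h x * indicator (box l u) x) = 0"
  shows "AE x in lborel. h x = 0"
proof -
  have [measurable]: "h \<in> borel_measurable borel" using h by (auto dest: in_Lp_measurable)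
  have int: "integrable lborel (\<lambda>x. h x * indicator (box l u) x)" for l u
    by (intro Lp_2_mult_integrable h in_Lp_2_indicator) auto
  have Re: "Re (h x * indicator (box l u) x) = Re (h x) * indicator (box l u) x"
    and Im: "Im (h x * indicator (box l u) x) = Im (h x) * indicator (box l u) x" for x l u
    by (auto simp: indicator_def)
  have "AE x in lborel. Re (h x) = 0"
  proof (rule zero_of_box_integrals_real)
    show "integrable lborel (\<lambda>x. Re (h x) * indicator (box l u) x)" for l u
      using integrable_Re[OF int[of l u]] by (simp only: Re)
    show "(LINT x|lborel. Re (h x) * indicator (box l u) x) = 0" for l u
      using integral_Re[OF int[of l u]] zero[of l u] by (simp only: Re) simp
  qed measurable
  moreover have "AE x in lborel. Im (h x) = 0"
  proof (rule zero_of_box_integrals_real)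
    show "integrable lborel (\<lambda>x. Im (h x) * indicator (box l u) x)" for l u
      using integrable_Im[OF int[of l u]] by (simp only: Im)
    show "(LINT x|lborel. Im (h x) * indicator (box l u) x) = 0" for l u
      using integral_Im[OF int[of l u]] zero[of l u] by (simp only: Im) simp
  qed measurable
  ultimately show ?thesis by eventually_elim (simp add: complex_eq_iff)
qed

text \<open>The inversion formula, in the form that conjugating, transforming, conjugating and transforming
  again is the identity. Both sides have the same integral over every box, by the multiplication formula
  and Parseval's identity for the box.\<close>

lemma fourier_inversion:
  assumes fg: "is_fourier f g" and gk: "is_fourier (\<lambda>x. cnj (g x)) k"
  shows "AE x in lborel. k x = cnj (f x)"
proof -
  note L2 = is_fourier_in_Lp[OF fg] is_fourier_in_Lp[OF gk]
  have "(LINT x|lborel. (k x - cnj (f x)) * indicator (box l u) x) = 0" for l u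
  proof -
    let ?I = "indicator (box l u) :: real^'a \<Rightarrow> complex"
    let ?T = "\<lambda>R x. indicator (cball 0 R) x * f x"
    have B: "in_Lp 2 ?I" "integrable lborel ?I"
      by (rule in_Lp_2_indicator; simp)+
    note F1 = is_fourier_fourier_L1[OF B]
    have c: "in_Lp 2 (\<lambda>x. cnj (fourier_L1 ?I x))" by (simp add: is_fourier_in_Lp(2)[OF F1])
    have "((\<lambda>R. LINT x|lborel. fourier_L1 (?T R) x * cnj (fourier_L1 ?I x)) \<longlongrightarrow> (LINT x|lborel. g x * cnj (fourier_L1 ?I x))) at_top"
      by (rule Lp_2_pairing_tendsto)
        (use fg in \<open>auto simp: is_fourier_iff c B intro!: fourier_L1_bessel truncation L2\<close>)
    then have "((\<lambda>R. LINT x|lborel. ?T R x * ?I x) \<longlongrightarrow> (LINT x|lborel. g x * cnj (fourier_L1 ?I x))) at_top"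
      by (simp only: parseval_box truncation L2)
    moreover have "((\<lambda>R. LINT x|lborel. ?T R x * ?I x) \<longlongrightarrow> (LINT x|lborel. f x * ?I x)) at_top"
      by (rule Lp_2_pairing_tendsto) (auto intro!: truncation L2 B)
    ultimately have 1: "(LINT x|lborel. g x * cnj (fourier_L1 ?I x)) = (LINT x|lborel. f x * ?I x)"
      by (rule tendsto_unique[rotated]) simp
    have "(LINT x|lborel. k x * ?I x) = (LINT x|lborel. cnj (g x) * fourier_L1 ?I x)"
      by (rule multiplication_formula[OF gk F1])
    also have "\<dots> = (LINT x|lborel. cnj (g x * cnj (fourier_L1 ?I x)))"
      by simp
    also have "\<dots> = cnj (LINT x|lborel. f x * ?I x)"
      by (simp only: 1 Bochner_Integration.integral_cnj)
    also have "\<dots> = (LINT x|lborel. cnj (f x) * ?I x)"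
      unfolding Bochner_Integration.integral_cnj[symmetric]
      by (intro Bochner_Integration.integral_cong) (auto simp: indicator_def)
    finally show ?thesis
      by (simp add: left_diff_distrib Bochner_Integration.integral_diff Lp_2_mult_integrable L2 B)
  qed
  from zero_of_box_integrals[OF Lp_2_diff(1)[OF L2(4)] this] L2(1)
  show ?thesis by simp
qed

text \<open>A preimage of \<open>g\<close> is the conjugate of the transform of the conjugate of \<open>g\<close>.\<close>

lemma is_fourier_surj:
  assumes g: "in_Lp 2 g"
  shows "\<exists>f. is_fourier f g"
proof -
  obtain k where k: "is_fourier (\<lambda>x. cnj (g x)) k" using is_fourier_exists[of "\<lambda>x. cnj (g x)"] g by auto
  obtain g' where g': "is_fourier (\<lambda>x. cnj (k x)) g'"
    using is_fourier_exists[of "\<lambda>x. cnj (k x)"] is_fourier_in_Lp(2)[OF k] by auto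
  have "AE x in lborel. g' x = cnj (cnj (g x))" by (rule fourier_inversion[OF k g'])
  then have "AE x in lborel. g x = g' x" by eventually_elim simp
  from is_fourier_cong_AE[OF g' in_Lp_measurable[OF g] this] show ?thesis by blast
qed

text \<open>The transform is a contraction, and by the inversion formula so is its inverse.\<close>

theorem plancherel:
  assumes fg: "is_fourier f g"
  shows "Lp_norm 2 g = Lp_norm 2 f"
proof (rule antisym)
  show "Lp_norm 2 g \<le> Lp_norm 2 f" by (rule is_fourier_contraction[OF fg])
  obtain k where k: "is_fourier (\<lambda>x. cnj (g x)) k"
    using is_fourier_exists[of "\<lambda>x. cnj (g x)"] is_fourier_in_Lp(2)[OF fg] by auto
  have f: "in_Lp 2 (\<lambda>x. cnj (f x))" using is_fourier_in_Lp(1)[OF fg] by simp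
  have "Lp_norm 2 f = Lp_norm 2 k"
    using Lp_2_cong_AE(2)[OF f in_Lp_measurable[OF is_fourier_in_Lp(2)[OF k]] fourier_inversion[OF fg k]] by simp
  also have "\<dots> \<le> Lp_norm 2 g" using is_fourier_contraction[OF k] by simp
  finally show "Lp_norm 2 f \<le> Lp_norm 2 g" .
qed

lemma is_fourier_fourier: "in_Lp 2 f \<Longrightarrow> is_fourier f (fourier f)"
  unfolding fourier_def by (rule someI_ex[OF is_fourier_exists])

lemma is_fourier_inv_fourier: "in_Lp 2 g \<Longrightarrow> is_fourier (inv_fourier g) g"
  unfolding inv_fourier_def by (rule someI_ex[OF is_fourier_surj])

section \<open>Bounds for the kernels\<close>

text \<open>The kernels as functions of two roots \<open>l1\<close>, \<open>l2\<close>: the solutions of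
  \<open>y'' - (l1 + l2) y' + l1 l2 y = 0\<close> with initial data \<open>(1, 0)\<close> and \<open>(0, 1)\<close>.\<close>

definition fund0 :: "complex \<Rightarrow> complex \<Rightarrow> real \<Rightarrow> complex" where
  "fund0 l1 l2 t = (if l1 = l2 then (1 - l1 * of_real t) * exp (l1 * of_real t)
     else (l1 * exp (l2 * of_real t) - l2 * exp (l1 * of_real t)) / (l1 - l2))"

definition fund1 :: "complex \<Rightarrow> complex \<Rightarrow> real \<Rightarrow> complex" where
  "fund1 l1 l2 t = (if l1 = l2 then of_real t * exp (l1 * of_real t)
     else (exp (l1 * of_real t) - exp (l2 * of_real t)) / (l1 - l2))"

lemma fund0_conv_fund1: "fund0 l1 l2 t = exp (l1 * of_real t) - l1 * fund1 l1 l2 t"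
proof (cases "l1 = l2")
  case False
  let ?e1 = "exp (l1 * of_real t)" and ?e2 = "exp (l2 * of_real t)"
  have "?e1 - l1 * ((?e1 - ?e2) / (l1 - l2)) = (?e1 * (l1 - l2) - l1 * (?e1 - ?e2)) / (l1 - l2)"
    using False by (subst diff_divide_distrib) simp
  also have "?e1 * (l1 - l2) - l1 * (?e1 - ?e2) = l1 * ?e2 - l2 * ?e1"
    by (simp add: algebra_simps)
  finally show ?thesis using False by (simp add: fund0_def fund1_def)
qed (simp add: fund0_def fund1_def algebra_simps)

lemma exp_of_real_deriv:
  "((\<lambda>t. exp (l * complex_of_real t)) has_vector_derivative l * exp (l * of_real t)) (at t within S)"
proof -
  have "((\<lambda>z. exp (l * z)) has_field_derivative l * exp (l * of_real t)) (at (of_real t))"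
    by (auto intro!: derivative_eq_intros)
  then show ?thesis by (rule has_vector_derivative_real_field[THEN has_vector_derivative_at_within])
qed

lemma fund_deriv:
  "(fund1 l1 l2 has_vector_derivative fund0 l1 l2 t + (l1 + l2) * fund1 l1 l2 t) (at t within S)"
  "(fund0 l1 l2 has_vector_derivative - (l1 * l2) * fund1 l1 l2 t) (at t within S)"
proof -
  have 1: "(fund1 l1 l2 has_vector_derivative fund0 l1 l2 t + (l1 + l2) * fund1 l1 l2 t) (at t within S)" for S
  proof (cases "l1 = l2")
    case True
    have "((\<lambda>t. of_real t * exp (l1 * of_real t)) has_vector_derivative
        1 * exp (l1 * of_real t) + of_real t * (l1 * exp (l1 * of_real t))) (at t within S)"
      by (auto intro!: derivative_eq_intros exp_of_real_deriv has_vector_derivative_of_real)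
    then show ?thesis using True by (simp add: fund1_def[abs_def] fund0_def algebra_simps)
  next
    case False
    have "((\<lambda>t. (exp (l1 * of_real t) - exp (l2 * of_real t)) / (l1 - l2)) has_vector_derivative
        (l1 * exp (l1 * of_real t) - l2 * exp (l2 * of_real t)) / (l1 - l2)) (at t within S)"
      by (intro has_vector_derivative_divide has_vector_derivative_diff exp_of_real_deriv)
    moreover have "fund0 l1 l2 t + (l1 + l2) * fund1 l1 l2 t = (l1 * exp (l1 * of_real t) - l2 * exp (l2 * of_real t)) / (l1 - l2)"
      using False by (simp add: fund0_def fund1_def algebra_simps flip: add_divide_distrib)
    ultimately show ?thesis using False by (simp add: fund1_def[abs_def])
  qed
  then show "(fund1 l1 l2 has_vector_derivative fund0 l1 l2 t + (l1 + l2) * fund1 l1 l2 t) (at t within S)" .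
  have "((\<lambda>t. exp (l1 * of_real t) - l1 * fund1 l1 l2 t) has_vector_derivative
      l1 * exp (l1 * of_real t) - l1 * (fund0 l1 l2 t + (l1 + l2) * fund1 l1 l2 t)) (at t within S)"
    by (intro has_vector_derivative_diff exp_of_real_deriv has_vector_derivative_mult_right 1)
  then show "(fund0 l1 l2 has_vector_derivative - (l1 * l2) * fund1 l1 l2 t) (at t within S)"
    unfolding fund0_conv_fund1[abs_def] by (simp add: algebra_simps)
qed

lemma norm_fund1_le_t:
  assumes "Re l1 \<le> M" "Re l2 \<le> M" "0 \<le> t"
  shows "norm (fund1 l1 l2 t) \<le> t * exp (M * t)"
proof (cases "l1 = l2")
  case True
  have "exp (Re l1 * t) \<le> exp (M * t)" using assms by (simp add: mult_right_mono)
  with True assms show ?thesis by (auto simp: fund1_def norm_mult intro!: mult_left_mono)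
next
  case False
  have "norm (exp (l1 * of_real t) - exp (l2 * of_real t)) \<le> exp (M * t) * norm (l1 * of_real t - l2 * of_real t)"
  proof (rule field_differentiable_bound)
    show "convex {z. Re z \<le> M * t}" by (rule convex_halfspace_Re_le)
    show "(exp has_field_derivative exp z) (at z within {z. Re z \<le> M * t})" for z
      by (rule DERIV_exp[THEN has_field_derivative_at_within])
    show "norm (exp z) \<le> exp (M * t)" if "z \<in> {z. Re z \<le> M * t}" for z
      using that by simp
  qed (use assms in \<open>auto intro: mult_right_mono\<close>)
  also have "norm (l1 * of_real t - l2 * of_real t) = norm (l1 - l2) * t"
    using assms(3) by (simp add: norm_mult flip: left_diff_distrib)
  finally show ?thesis using False by (simp add: fund1_def norm_divide field_simps)
qed

lemma norm_fund1_le_inverse: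
  assumes "Re l1 \<le> M" "Re l2 \<le> M" "0 \<le> t"
  shows "norm (l1 - l2) * norm (fund1 l1 l2 t) \<le> 2 * exp (M * t)"
proof -
  have "exp (Re l1 * t) \<le> exp (M * t)" "exp (Re l2 * t) \<le> exp (M * t)"
    using assms by (simp_all add: mult_right_mono)
  then have "norm (exp (l1 * of_real t) - exp (l2 * of_real t)) \<le> exp (M * t) + exp (M * t)"
    by (intro order_trans[OF norm_triangle_ineq4] add_mono) auto
  then show ?thesis by (simp add: fund1_def norm_divide)
qed

text \<open>The bounds for the roots of \<open>\<lambda>\<^sup>2 + b \<lambda> + p\<^sup>2\<close>, in the regime of real and in that of complex roots at
  once. The two bounds on \<open>b fund1\<close> and \<open>p\<^sup>2 fund1\<close> distinguish whether the roots are well separated. If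
  they are, the difference of exponentials divided by the distance of the roots is small enough. If their
  distance is less than \<open>b/2\<close>, then both have real part at most \<open>-b/4\<close>, and \<open>b t exp(-b t/4) \<le> 8 exp(-b t/8)\<close>;
  if it is less than \<open>p\<close>, then the discriminant forces \<open>p \<le> b\<close>, and the first bound implies the second.
  Half of the exponential rate is given up to absorb the factor \<open>b t\<close>.\<close>

lemma fund_bounds:
  fixes b p t :: real
  assumes sum: "l1 + l2 = - of_real b" and prod: "l1 * l2 = of_real (p\<^sup>2)"
    and gap: "(norm (l1 - l2))\<^sup>2 = \<bar>b\<^sup>2 - 4 * p\<^sup>2\<bar>"
    and rate: "Re l1 \<le> - min 1 b / 4" "Re l2 \<le> - min 1 b / 4"
    and near: "Re l1 \<le> - b / 2 + norm (l1 - l2) / 2" "Re l2 \<le> - b / 2 + norm (l1 - l2) / 2"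
    and b: "0 \<le> b" and p: "0 \<le> p" and t: "0 \<le> t"
  defines "E \<equiv> exp (- min 1 b * t / 8)"
  shows "norm (fund1 l1 l2 t) \<le> t * E"
    and "b * norm (fund1 l1 l2 t) \<le> 8 * E"
    and "norm (fund0 l1 l2 t) \<le> 6 * E"
    and "norm (fund0 l1 l2 t - of_real b * fund1 l1 l2 t) \<le> 14 * E"
    and "p\<^sup>2 * norm (fund1 l1 l2 t) \<le> 8 * p * E"
proof -
  let ?s = "norm (l1 - l2)" and ?N = "norm (fund1 l1 l2 t)"
  have "- min 1 b / 4 * t \<le> - min 1 b * t / 8" using b t by (simp add: field_simps)
  then have E: "exp (- min 1 b / 4 * t) \<le> E" unfolding E_def by simp
  have E0: "0 < E" unfolding E_def by simp
  have "?N \<le> t * exp (- min 1 b / 4 * t)" by (rule norm_fund1_le_t[OF rate t])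
  with E t show "?N \<le> t * E" by (meson mult_left_mono order_trans)
  have "?s * ?N \<le> 2 * exp (- min 1 b / 4 * t)" by (rule norm_fund1_le_inverse[OF rate t])
  then have sN: "?s * ?N \<le> 2 * E" using E by linarith
  show bN: "b * ?N \<le> 8 * E"
  proof (cases "b / 2 \<le> ?s")
    case True
    then have "b * ?N \<le> 2 * (?s * ?N)" using mult_right_mono[OF True norm_ge_zero[of "fund1 l1 l2 t"]] by simp
    with sN E0 show ?thesis by linarith
  next
    case False
    then have "Re l1 \<le> - b / 4" "Re l2 \<le> - b / 4" using near by linarith+
    then have "?N \<le> t * exp (- b / 4 * t)" by (rule norm_fund1_le_t[OF _ _ t])
    then have "b * ?N \<le> b * (t * exp (- b / 4 * t))" using b by (rule mult_left_mono)
    also have "\<dots> = 8 * ((b * t / 8) * exp (- (b * t / 8))) * exp (- (b * t / 8))"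
      by (simp add: field_simps flip: exp_add)
    also have "\<dots> \<le> 8 * 1 * exp (- (b * t / 8))"
    proof (intro mult_right_mono mult_left_mono)
      have "b * t / 8 \<le> exp (b * t / 8)" using exp_ge_add_one_self[of "b * t / 8"] by linarith
      then show "(b * t / 8) * exp (- (b * t / 8)) \<le> 1" by (simp add: exp_minus field_simps)
    qed auto
    also have "exp (- (b * t / 8)) \<le> E"
      unfolding E_def using b t by (simp add: mult_right_mono)
    finally show ?thesis by simp
  qed
  show pN: "p\<^sup>2 * ?N \<le> 8 * p * E"
  proof (cases "p \<le> ?s")
    case True
    then have "p * ?N \<le> ?s * ?N" by (intro mult_right_mono) auto
    with sN E0 have "p * ?N \<le> 8 * E" by linarith
    from mult_left_mono[OF this p] show ?thesis by (simp add: power2_eq_square mult_ac)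
  next
    case False
    then have "?s\<^sup>2 < p\<^sup>2" by (intro power_strict_mono) auto
    then have "p\<^sup>2 \<le> b\<^sup>2" unfolding gap using zero_le_power2[of p] zero_le_power2[of b] by linarith
    then have "p \<le> b" using b by (rule power2_le_imp_le)
    then have "p * ?N \<le> b * ?N" by (intro mult_right_mono) auto
    with bN have "p * ?N \<le> 8 * E" by linarith
    from mult_left_mono[OF this p] show ?thesis by (simp add: power2_eq_square mult_ac)
  qed
  show N0: "norm (fund0 l1 l2 t) \<le> 6 * E"
  proof -
    have "(l1 - l2) - of_real b = (l1 - l2) + (l1 + l2)" by (simp only: sum diff_conv_add_uminus)
    then have "2 * l1 = (l1 - l2) - of_real b" by simp
    then have "norm (2 * l1) \<le> ?s + norm (complex_of_real b)" by (simp only: norm_triangle_ineq4)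
    then have "norm l1 \<le> ?s / 2 + b / 2" using b by (simp add: norm_mult)
    then have "norm l1 * ?N \<le> (?s / 2 + b / 2) * ?N" by (intro mult_right_mono) auto
    also have "\<dots> = (?s * ?N) / 2 + (b * ?N) / 2" by (simp add: field_simps)
    finally have "norm l1 * ?N \<le> 5 * E" using sN bN by linarith
    moreover have "norm (exp (l1 * of_real t)) \<le> E"
    proof -
      have "Re l1 * t \<le> - min 1 b / 4 * t" using rate t by (intro mult_right_mono)
      then have "exp (Re l1 * t) \<le> exp (- min 1 b / 4 * t)" by (subst exp_le_cancel_iff)
      from order_trans[OF this E] show ?thesis by simp
    qed
    ultimately show ?thesis
      unfolding fund0_conv_fund1 using norm_triangle_ineq4[of "exp (l1 * of_real t)" "l1 * fund1 l1 l2 t"]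
      by (simp add: norm_mult)
  qed
  show "norm (fund0 l1 l2 t - of_real b * fund1 l1 l2 t) \<le> 14 * E"
    using norm_triangle_ineq4[of "fund0 l1 l2 t" "of_real b * fund1 l1 l2 t"] N0 bN b by (simp add: norm_mult)
qed

text \<open>The hypothesis \<open>b min(1, b) \<le> p\<^sup>2\<close> keeps the slow real root away from \<open>0\<close>: it is of size \<open>p\<^sup>2/b\<close>.\<close>

lemma quadratic_roots:
  fixes b p :: real
  assumes b: "0 \<le> b" and bp: "b * min 1 b \<le> p\<^sup>2"
  defines "s \<equiv> csqrt (of_real (b\<^sup>2 - 4 * p\<^sup>2))"
  defines "l1 \<equiv> (- of_real b + s) / 2" and "l2 \<equiv> (- of_real b - s) / 2"
  shows "l1 + l2 = - of_real b" and "l1 * l2 = of_real (p\<^sup>2)"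
    and "(norm (l1 - l2))\<^sup>2 = \<bar>b\<^sup>2 - 4 * p\<^sup>2\<bar>"
    and "Re l1 \<le> - min 1 b / 4" and "Re l2 \<le> - min 1 b / 4"
    and "Re l1 \<le> - b / 2 + norm (l1 - l2) / 2" and "Re l2 \<le> - b / 2 + norm (l1 - l2) / 2"
proof -
  have s2: "s\<^sup>2 = of_real (b\<^sup>2 - 4 * p\<^sup>2)" unfolding s_def by simp
  have diff: "l1 - l2 = s" unfolding l1_def l2_def by (simp add: field_simps)
  show "l1 + l2 = - of_real b" unfolding l1_def l2_def by (simp add: field_simps)
  have "l1 * l2 = ((of_real b)\<^sup>2 - s\<^sup>2) / 4" unfolding l1_def l2_def by (simp add: field_simps power2_eq_square)
  then show "l1 * l2 = of_real (p\<^sup>2)" unfolding s2 by simp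
  show "(norm (l1 - l2))\<^sup>2 = \<bar>b\<^sup>2 - 4 * p\<^sup>2\<bar>"
    unfolding diff norm_power[symmetric] s2 by (simp only: norm_of_real)
  have Re: "Re l1 = - b / 2 + Re s / 2" "Re l2 = - b / 2 - Re s / 2" unfolding l1_def l2_def by simp_all
  have Re_s: "0 \<le> Re s" unfolding s_def using csqrt_principal[of "of_real (b\<^sup>2 - 4 * p\<^sup>2)"] by auto
  have "Re s \<le> norm s" by (rule complex_Re_le_cmod)
  with Re Re_s show "Re l1 \<le> - b / 2 + norm (l1 - l2) / 2" "Re l2 \<le> - b / 2 + norm (l1 - l2) / 2"
    unfolding diff by linarith+
  have "Re s \<le> b - min 1 b / 2"
  proof (cases "0 \<le> b\<^sup>2 - 4 * p\<^sup>2")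
    case True
    let ?m = "min 1 b"
    have m: "0 \<le> ?m" "?m \<le> b" using b by auto
    have "b\<^sup>2 - 4 * p\<^sup>2 \<le> b\<^sup>2 - b * ?m"
      using bp m b mult_nonneg_nonneg[OF b m(1)] by linarith
    also have "\<dots> \<le> (b - ?m / 2)\<^sup>2" by (simp add: power2_eq_square algebra_simps)
    finally have "sqrt (b\<^sup>2 - 4 * p\<^sup>2) \<le> b - ?m / 2" using m by (intro real_le_lsqrt True) auto
    moreover have "s = of_real (sqrt (b\<^sup>2 - 4 * p\<^sup>2))" unfolding s_def using True by (subst csqrt_of_real_nonneg) simp_all
    ultimately show ?thesis by simp
  next
    case False
    then have "Re s = 0" unfolding s_def by (subst csqrt_of_real_nonpos) auto
    with b show ?thesis by auto
  qed
  with Re Re_s show "Re l1 \<le> - min 1 b / 4" "Re l2 \<le> - min 1 b / 4" by linarith+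
qed

lemma kernel_conv_fund:
  "kernel0 \<sigma> \<delta> t \<xi> = fund0 (char_root1 \<sigma> \<delta> \<xi>) (char_root2 \<sigma> \<delta> \<xi>) t"
  "kernel1 \<sigma> \<delta> t \<xi> = fund1 (char_root1 \<sigma> \<delta> \<xi>) (char_root2 \<sigma> \<delta> \<xi>) t"
  by (simp_all add: kernel0_def kernel1_def fund0_def fund1_def Let_def)

text \<open>The differential equation expresses the time derivatives of the kernels through the kernels
  themselves; see \<open>kernel_deriv\<close>.\<close>

definition dkernel0 :: "real \<Rightarrow> real \<Rightarrow> real \<Rightarrow> real^'n \<Rightarrow> complex" where
  "dkernel0 \<sigma> \<delta> t \<xi> = - of_real ((norm \<xi> powr \<sigma>)\<^sup>2) * kernel1 \<sigma> \<delta> t \<xi>"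

definition dkernel1 :: "real \<Rightarrow> real \<Rightarrow> real \<Rightarrow> real^'n \<Rightarrow> complex" where
  "dkernel1 \<sigma> \<delta> t \<xi> = kernel0 \<sigma> \<delta> t \<xi> - of_real (norm \<xi> powr (2 * \<delta>)) * kernel1 \<sigma> \<delta> t \<xi>"

text \<open>The decay that all kernels share: at low frequencies the parabolic rate \<open>|\<xi>|\<^bsup>2\<delta>\<^esup>/8\<close>, at high frequencies,
  where the slow root behaves like \<open>-|\<xi>|\<^bsup>2(\<sigma>-\<delta>)\<^esup>\<close>, an exponential rate that does not depend on \<open>\<xi>\<close>.\<close>

definition envelope :: "real \<Rightarrow> real \<Rightarrow> real^'n \<Rightarrow> real" where
  "envelope \<delta> t \<xi> = exp (- min 1 (norm \<xi> powr (2 * \<delta>)) * t / 8)"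

context
  fixes \<sigma> \<delta> :: real and \<xi> :: "real^'n"
  assumes \<sigma>\<delta>: "0 < \<delta>" "\<sigma> \<le> 2 * \<delta>" "\<delta> \<le> \<sigma>"
begin

lemma char_roots_conv:
  "char_root1 \<sigma> \<delta> \<xi> = (- of_real (norm \<xi> powr (2 * \<delta>)) + csqrt (of_real ((norm \<xi> powr (2 * \<delta>))\<^sup>2 - 4 * (norm \<xi> powr \<sigma>)\<^sup>2))) / 2"
  "char_root2 \<sigma> \<delta> \<xi> = (- of_real (norm \<xi> powr (2 * \<delta>)) - csqrt (of_real ((norm \<xi> powr (2 * \<delta>))\<^sup>2 - 4 * (norm \<xi> powr \<sigma>)\<^sup>2))) / 2"
  unfolding char_root1_def char_root2_def by (simp_all add: power2_eq_square flip: powr_add)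

lemma damping_le_restoring:
  "norm \<xi> powr (2 * \<delta>) * min 1 (norm \<xi> powr (2 * \<delta>)) \<le> (norm \<xi> powr \<sigma>)\<^sup>2"
proof (cases "norm \<xi> \<le> 1")
  case True
  have "norm \<xi> powr (2 * \<delta>) * min 1 (norm \<xi> powr (2 * \<delta>)) \<le> norm \<xi> powr (2 * \<delta>) * norm \<xi> powr (2 * \<delta>)"
    by (intro mult_left_mono) auto
  also have "\<dots> = norm \<xi> powr (4 * \<delta>)" by (simp flip: powr_add)
  also have "\<dots> \<le> norm \<xi> powr (2 * \<sigma>)" using True \<sigma>\<delta> by (intro powr_mono') auto
  finally show ?thesis by (simp add: power2_eq_square flip: powr_add)
next
  case False
  have "norm \<xi> powr (2 * \<delta>) * min 1 (norm \<xi> powr (2 * \<delta>)) \<le> norm \<xi> powr (2 * \<delta>) * 1"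
    by (intro mult_left_mono) auto
  also have "\<dots> \<le> norm \<xi> powr (2 * \<sigma>)" using False \<sigma>\<delta> by (simp add: powr_mono)
  finally show ?thesis by (simp add: power2_eq_square flip: powr_add)
qed

lemmas char_roots = quadratic_roots[OF powr_ge_zero damping_le_restoring, folded char_roots_conv]

lemma kernel_bounds:
  assumes t: "0 \<le> t"
  shows "norm (kernel1 \<sigma> \<delta> t \<xi>) \<le> t * envelope \<delta> t \<xi>"
    and "norm \<xi> powr (2 * \<delta>) * norm (kernel1 \<sigma> \<delta> t \<xi>) \<le> 8 * envelope \<delta> t \<xi>"
    and "norm (kernel0 \<sigma> \<delta> t \<xi>) \<le> 6 * envelope \<delta> t \<xi>"
    and "norm (dkernel1 \<sigma> \<delta> t \<xi>) \<le> 14 * envelope \<delta> t \<xi>"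
    and "norm (dkernel0 \<sigma> \<delta> t \<xi>) \<le> 8 * norm \<xi> powr \<sigma> * envelope \<delta> t \<xi>"
  using fund_bounds[OF char_roots powr_ge_zero powr_ge_zero t]
  unfolding envelope_def dkernel1_def dkernel0_def kernel_conv_fund by (simp_all add: norm_mult norm_power)

text \<open>The price of the time derivative on the first datum at high frequencies: \<open>2(\<sigma> - \<delta>)\<close> derivatives. At low
  frequencies \<open>kernel_bounds\<close> instead provides the gain \<open>|\<xi>|\<^sup>\<sigma>\<close>.\<close>

lemma dkernel0_bound_high:
  assumes t: "0 \<le> t"
  shows "norm (dkernel0 \<sigma> \<delta> t \<xi>) \<le> 8 * norm \<xi> powr (2 * (\<sigma> - \<delta>)) * envelope \<delta> t \<xi>"
proof -
  have "norm (dkernel0 \<sigma> \<delta> t \<xi>) = norm \<xi> powr (2 * (\<sigma> - \<delta>)) * (norm \<xi> powr (2 * \<delta>) * norm (kernel1 \<sigma> \<delta> t \<xi>))"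
    by (simp add: dkernel0_def norm_mult power2_eq_square mult.assoc[symmetric] flip: powr_add)
  also have "\<dots> \<le> norm \<xi> powr (2 * (\<sigma> - \<delta>)) * (8 * envelope \<delta> t \<xi>)"
    by (intro mult_left_mono kernel_bounds t) auto
  finally show ?thesis by (simp add: mult_ac)
qed

lemma kernel_deriv:
  "((\<lambda>t. kernel0 \<sigma> \<delta> t \<xi>) has_vector_derivative dkernel0 \<sigma> \<delta> t \<xi>) (at t within S)"
  "((\<lambda>t. kernel1 \<sigma> \<delta> t \<xi>) has_vector_derivative dkernel1 \<sigma> \<delta> t \<xi>) (at t within S)"
  using fund_deriv[of "char_root1 \<sigma> \<delta> \<xi>" "char_root2 \<sigma> \<delta> \<xi>" t S]
  unfolding char_roots(1,2) kernel_conv_fund dkernel0_def dkernel1_def by simp_all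

end

lemma envelope_le_1: "0 \<le> t \<Longrightarrow> envelope \<delta> t \<xi> \<le> 1"
  by (simp add: envelope_def)

lemma csqrt_of_real_measurable [measurable]: "(\<lambda>x. csqrt (complex_of_real x)) \<in> borel_measurable borel"
proof -
  have "csqrt (complex_of_real x) = (if 0 \<le> x then of_real (sqrt x) else \<i> * of_real (sqrt \<bar>x\<bar>))" for x
    by (simp add: csqrt_of_real_nonneg csqrt_of_real_nonpos)
  then show ?thesis by simp
qed

lemma exp_complex_measurable [measurable]: "(exp :: complex \<Rightarrow> complex) \<in> borel_measurable borel"
  by (intro borel_measurable_continuous_onI continuous_intros)

lemma char_root_measurable [measurable]:
  "char_root1 \<sigma> \<delta> \<in> borel_measurable borel" "char_root2 \<sigma> \<delta> \<in> borel_measurable borel"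
  unfolding char_root1_def[abs_def] char_root2_def[abs_def] by measurable

lemma kernel_measurable [measurable]:
  "kernel0 \<sigma> \<delta> t \<in> borel_measurable borel" "kernel1 \<sigma> \<delta> t \<in> borel_measurable borel"
  unfolding kernel_conv_fund[abs_def] fund0_def[abs_def] fund1_def[abs_def] by measurable

lemma dkernel_measurable [measurable]:
  "dkernel0 \<sigma> \<delta> t \<in> borel_measurable borel" "dkernel1 \<sigma> \<delta> t \<in> borel_measurable borel"
  unfolding dkernel0_def[abs_def] dkernel1_def[abs_def] by measurable

section \<open>Decay from integrability of the data\<close>

lemma powr_le_exp:
  assumes "0 \<le> \<kappa>" "0 < c"
  shows "\<exists>C>0. \<forall>y\<ge>0. y powr \<kappa> \<le> C * exp (c * (y::real))"
proof (cases "\<kappa> = 0")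
  case True
  then show ?thesis using assms by (intro exI[of _ 1]) auto
next
  case False
  with assms have k: "0 < \<kappa>" by simp
  show ?thesis
  proof (intro exI[of _ "(\<kappa> / c) powr \<kappa>"] conjI allI impI)
    show "0 < (\<kappa> / c) powr \<kappa>" using k assms by simp
    fix y :: real assume y: "0 \<le> y"
    let ?u = "y * c / \<kappa>"
    have u: "0 \<le> ?u" using y k assms by simp
    have "?u powr \<kappa> \<le> exp ?u powr \<kappa>"
      using exp_ge_add_one_self[of ?u] u k by (intro powr_mono2) linarith+
    also have "\<dots> = exp (c * y)" using k by (simp add: powr_def)
    finally have "(\<kappa> / c) powr \<kappa> * ?u powr \<kappa> \<le> (\<kappa> / c) powr \<kappa> * exp (c * y)" by (intro mult_left_mono) auto
    moreover have "(\<kappa> / c) powr \<kappa> * ?u powr \<kappa> = y powr \<kappa>"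
      using u k assms y by (subst powr_mult[symmetric]) (auto simp: field_simps)
    ultimately show "y powr \<kappa> \<le> (\<kappa> / c) powr \<kappa> * exp (c * y)" by simp
  qed
qed

text \<open>With \<open>c = \<tau>\<^bsup>1/(2\<delta>)\<^esup>\<close> the integrand is a function of \<open>c |\<xi>|\<close> that is dominated by a multiple of the product
  of the functions \<open>1/(1 + (c \<xi>\<^sub>i)\<^sup>2)\<close>; each of these has an integral proportional to \<open>1/c\<close>.\<close>

lemma nn_integral_damping:
  fixes \<delta> :: real
  assumes \<delta>: "0 < \<delta>"
  shows "\<exists>M>0. \<forall>\<tau>>0. (\<integral>\<^sup>+\<xi>. ennreal (exp (- (norm (\<xi>::real^'n) powr (2 * \<delta>) * \<tau> / 8))) \<partial>lborel)
     \<le> ennreal (M * \<tau> powr (- (real CARD('n) / (2 * \<delta>))))"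
proof -
  let ?n = "CARD('n)"
  have "integrable lborel (\<lambda>x::real. inverse (1 + x\<^sup>2))"
    using integrable_inverse_1_plus_square by (simp add: set_integrable_def)
  then have J0: "(\<integral>\<^sup>+(x::real). ennreal (inverse (1 + x\<^sup>2)) \<partial>lborel) < \<infinity>"
    by (simp add: integrable_iff_bounded)
  then obtain J where J: "(\<integral>\<^sup>+(x::real). ennreal (inverse (1 + x\<^sup>2)) \<partial>lborel) = ennreal J" "0 \<le> J"
    by (metis ennreal_finiteE less_irrefl)
  have scaled: "(\<integral>\<^sup>+(x::real). ennreal (inverse (1 + (c * x)\<^sup>2)) \<partial>lborel) = ennreal (J / c)" if c: "0 < c" for c
  proof -
    have "(\<integral>\<^sup>+(x::real). ennreal (inverse (1 + (c * x)\<^sup>2)) \<partial>lborel)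
        = ennreal \<bar>1 / c\<bar> * (\<integral>\<^sup>+(x::real). ennreal (inverse (1 + (c * (0 + 1 / c * x))\<^sup>2)) \<partial>lborel)"
      using c by (intro nn_integral_real_affine) auto
    also have "\<dots> = ennreal (1 / c) * ennreal J" using c J by simp
    finally show ?thesis using c J by (simp flip: ennreal_mult)
  qed
  obtain A where A: "0 < A" "\<And>y. 0 \<le> y \<Longrightarrow> y powr (real ?n / \<delta>) \<le> A * exp (1/8 * y)"
    using powr_le_exp[of "real ?n / \<delta>" "1/8"] \<delta> by auto
  let ?B = "2 ^ ?n * (1 + A)"
  have decay: "exp (- (z powr (2 * \<delta>) / 8)) \<le> ?B * inverse ((1 + z\<^sup>2) ^ ?n)" if z: "0 \<le> z" for z
  proof -
    let ?y = "z powr (2 * \<delta>)"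
    have "(1 + z\<^sup>2) ^ ?n \<le> 2 ^ ?n * (1 + z powr (2 * real ?n))"
    proof (cases "z \<le> 1")
      case True
      then have "(1 + z\<^sup>2) ^ ?n \<le> 2 ^ ?n * 1" using z by (simp add: power_mono power_le_one)
      also have "\<dots> \<le> 2 ^ ?n * (1 + z powr (2 * real ?n))" by (intro mult_left_mono) auto
      finally show ?thesis .
    next
      case False
      then have "(1 + z\<^sup>2) ^ ?n \<le> (2 * z\<^sup>2) ^ ?n" by (intro power_mono) auto
      also have "\<dots> = 2 ^ ?n * z ^ (2 * ?n)" by (simp only: power_mult_distrib power_mult)
      also have "z ^ (2 * ?n) = z powr (2 * real ?n)" using False by (subst powr_realpow[symmetric]) simp_all
      also have "2 ^ ?n * z powr (2 * real ?n) \<le> 2 ^ ?n * (1 + z powr (2 * real ?n))" by (intro mult_left_mono) auto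
      finally show ?thesis .
    qed
    also have "z powr (2 * real ?n) = ?y powr (real ?n / \<delta>)" using \<delta> by (simp add: powr_powr)
    also have "2 ^ ?n * (1 + ?y powr (real ?n / \<delta>)) \<le> 2 ^ ?n * (exp (1/8 * ?y) + A * exp (1/8 * ?y))"
      by (intro mult_left_mono add_mono A) auto
    also have "\<dots> = ?B * exp (?y / 8)" by (simp add: algebra_simps)
    finally have "(1 + z\<^sup>2) ^ ?n \<le> ?B * exp (?y / 8)" .
    then show ?thesis
      by (simp add: exp_minus field_simps add_pos_nonneg)
  qed
  have main: "(\<integral>\<^sup>+\<xi>. ennreal (exp (- (norm (\<xi>::real^'n) powr (2 * \<delta>) * \<tau> / 8))) \<partial>lborel)
     \<le> ennreal (?B * J ^ ?n * \<tau> powr (- (real ?n / (2 * \<delta>))))" if \<tau>: "0 < \<tau>" for \<tau>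
  proof -
    let ?c = "\<tau> powr (1 / (2 * \<delta>))"
    have c: "0 < ?c" using \<tau> by simp
    have le: "exp (- (norm \<xi> powr (2 * \<delta>) * \<tau> / 8)) \<le> ?B * (\<Prod>b\<in>Basis. inverse (1 + (?c * (\<xi> \<bullet> b))\<^sup>2))" for \<xi> :: "real^'n"
    proof -
      have "norm \<xi> powr (2 * \<delta>) * \<tau> = (?c * norm \<xi>) powr (2 * \<delta>)"
        using \<delta> \<tau> by (simp add: powr_mult powr_powr)
      then have "exp (- (norm \<xi> powr (2 * \<delta>) * \<tau> / 8)) \<le> ?B * inverse ((1 + (?c * norm \<xi>)\<^sup>2) ^ ?n)"
        using decay[of "?c * norm \<xi>"] by simp
      also have "inverse ((1 + (?c * norm \<xi>)\<^sup>2) ^ ?n) = (\<Prod>b\<in>(Basis::(real^'n) set). inverse (1 + (?c * norm \<xi>)\<^sup>2))"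
        by (simp add: power_inverse)
      also have "\<dots> \<le> (\<Prod>b\<in>Basis. inverse (1 + (?c * (\<xi> \<bullet> b))\<^sup>2))"
      proof (intro prod_mono conjI le_imp_inverse_le add_left_mono)
        fix b :: "real^'n" assume b: "b \<in> Basis"
        have "\<bar>\<xi> \<bullet> b\<bar> \<le> norm \<xi>" by (rule Basis_le_norm[OF b])
        then have "(?c * \<bar>\<xi> \<bullet> b\<bar>)\<^sup>2 \<le> (?c * norm \<xi>)\<^sup>2" by (intro power_mono mult_left_mono) auto
        then show "(?c * (\<xi> \<bullet> b))\<^sup>2 \<le> (?c * norm \<xi>)\<^sup>2" by (simp add: power_mult_distrib)
      qed (auto intro: add_pos_nonneg)
      finally show ?thesis using A by (simp add: mult_left_mono)
    qed
    have "(\<integral>\<^sup>+\<xi>. ennreal (exp (- (norm (\<xi>::real^'n) powr (2 * \<delta>) * \<tau> / 8))) \<partial>lborel)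
        \<le> (\<integral>\<^sup>+\<xi>. ennreal ?B * (\<Prod>b\<in>Basis. ennreal (inverse (1 + (?c * ((\<xi>::real^'n) \<bullet> b))\<^sup>2))) \<partial>lborel)"
    proof (rule nn_integral_mono)
      fix \<xi> :: "real^'n"
      have "ennreal (?B * (\<Prod>b\<in>Basis. inverse (1 + (?c * (\<xi> \<bullet> b))\<^sup>2))) = ennreal ?B * (\<Prod>b\<in>Basis. ennreal (inverse (1 + (?c * (\<xi> \<bullet> b))\<^sup>2)))"
        using A by (subst ennreal_mult) (auto simp: prod_nonneg prod_ennreal)
      with ennreal_leI[OF le[of \<xi>]]
      show "ennreal (exp (- (norm \<xi> powr (2 * \<delta>) * \<tau> / 8))) \<le> ennreal ?B * (\<Prod>b\<in>Basis. ennreal (inverse (1 + (?c * (\<xi> \<bullet> b))\<^sup>2)))"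
        by simp
    qed
    also have "\<dots> = ennreal ?B * (\<Prod>b\<in>(Basis::(real^'n) set). ennreal (J / ?c))"
      by (subst nn_integral_cmult, measurable, subst nn_integral_lborel_prod) (simp_all only: scaled[OF c], auto)
    also have "\<dots> = ennreal (?B * (J / ?c) ^ ?n)"
      using A J by (subst ennreal_mult) (auto simp: ennreal_power)
    also have "?B * (J / ?c) ^ ?n = ?B * J ^ ?n * \<tau> powr (- (real ?n / (2 * \<delta>)))"
    proof -
      have "?c ^ ?n = \<tau> powr (real ?n / (2 * \<delta>))" using \<tau> by (simp add: powr_powr flip: powr_realpow)
      then show ?thesis by (simp add: power_divide powr_minus_divide)
    qed
    finally show ?thesis .
  qed
  then have "(\<integral>\<^sup>+\<xi>. ennreal (exp (- (norm (\<xi>::real^'n) powr (2 * \<delta>) * \<tau> / 8))) \<partial>lborel)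
     \<le> ennreal ((?B * J ^ ?n + 1) * \<tau> powr (- (real ?n / (2 * \<delta>))))" if \<tau>: "0 < \<tau>" for \<tau>
  proof -
    have "?B * J ^ ?n * \<tau> powr (- (real ?n / (2 * \<delta>))) \<le> (?B * J ^ ?n + 1) * \<tau> powr (- (real ?n / (2 * \<delta>)))"
      by (rule mult_right_mono) simp_all
    from order_trans[OF main[OF \<tau>] ennreal_leI[OF this]] show ?thesis .
  qed
  moreover have "0 < ?B * J ^ ?n + 1" using A J by (intro add_nonneg_pos) auto
  ultimately show ?thesis by blast
qed

text \<open>The decomposition behind real interpolation between \<open>L\<^sup>1\<close> and \<open>L\<^sup>2\<close>: where \<open>|w| > l\<close>, the value \<open>|w|\<close> is
  at most \<open>l\<^bsup>1-m\<^esup> |w|\<^sup>m\<close>, and elsewhere \<open>|w|\<^sup>2\<close> is at most \<open>l\<^bsup>2-m\<^esup> |w|\<^sup>m\<close>.\<close>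

lemma level_split:
  fixes w :: "real^'n \<Rightarrow> complex"
  assumes w: "in_Lp m w" "in_Lp 2 w" and m: "1 \<le> m" "m \<le> 2" and l: "0 < l"
  defines "big \<equiv> \<lambda>x. indicator {x. l < norm (w x)} x * w x"
    and "small \<equiv> \<lambda>x. indicator {x. norm (w x) \<le> l} x * w x"
  shows "integrable lborel big" "in_Lp 2 big" "in_Lp 2 small" "w = (\<lambda>x. 1 * big x + 1 * small x)"
    and "(LINT x|lborel. norm (big x)) \<le> l powr (1 - m) * Lp_norm m w powr m"
    and "Lp_norm 2 small \<le> sqrt (l powr (2 - m) * Lp_norm m w powr m)"
proof -
  have [measurable]: "w \<in> borel_measurable borel" using w(2) by (auto dest: in_Lp_measurable)
  have int: "integrable lborel (\<lambda>x. norm (w x) powr m)" using w(1) by (simp add: in_Lp_def)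
  have I: "(LINT x|lborel. norm (w x) powr m) = Lp_norm m w powr m"
  proof -
    have "0 \<le> (LINT x|lborel. norm (w x) powr m)" by (rule Bochner_Integration.integral_nonneg) simp
    then show ?thesis using m by (simp add: Lp_norm_def powr_powr)
  qed
  have [measurable]: "big \<in> borel_measurable borel" "small \<in> borel_measurable borel"
    unfolding big_def small_def by measurable
  have big_le: "norm (big x) \<le> l powr (1 - m) * norm (w x) powr m" for x
  proof (cases "l < norm (w x)")
    case True
    then have "norm (w x) powr (1 - m) \<le> l powr (1 - m)" using l m by (intro powr_mono2') auto
    then have "norm (w x) powr (1 - m) * norm (w x) powr m \<le> l powr (1 - m) * norm (w x) powr m"
      by (rule mult_right_mono) auto
    with True l show ?thesis by (simp add: big_def norm_mult flip: powr_add)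
  qed (simp add: big_def)
  have small_le: "(norm (small x))\<^sup>2 \<le> l powr (2 - m) * norm (w x) powr m" for x
  proof (cases "norm (w x) \<le> l \<and> w x \<noteq> 0")
    case True
    then have "norm (w x) powr (2 - m) \<le> l powr (2 - m)" using m by (intro powr_mono2) auto
    then have "norm (w x) powr (2 - m) * norm (w x) powr m \<le> l powr (2 - m) * norm (w x) powr m"
      by (rule mult_right_mono) auto
    with True show ?thesis by (simp add: small_def norm_mult flip: powr_add)
  qed (auto simp: small_def)
  have rhs: "integrable lborel (\<lambda>x. l powr (1 - m) * norm (w x) powr m)"
    "integrable lborel (\<lambda>x. l powr (2 - m) * norm (w x) powr m)"
    using int by (auto intro: integrable_mult_right)
  show bigI: "integrable lborel big"
    by (rule Bochner_Integration.integrable_bound[OF rhs(1)]) (use big_le in auto)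
  show "in_Lp 2 big"
    by (rule Lp_2_mono(1)[OF w(2), of _ 1]) (auto simp: big_def norm_mult indicator_def)
  show "in_Lp 2 small"
    by (rule Lp_2_mono(1)[OF w(2), of _ 1]) (auto simp: small_def norm_mult indicator_def)
  show "w = (\<lambda>x. 1 * big x + 1 * small x)"
    by (auto simp: big_def small_def indicator_def)
  have "(LINT x|lborel. norm (big x)) \<le> (LINT x|lborel. l powr (1 - m) * norm (w x) powr m)"
    by (intro integral_mono integrable_norm bigI rhs big_le)
  then show "(LINT x|lborel. norm (big x)) \<le> l powr (1 - m) * Lp_norm m w powr m" by (simp add: I)
  have "(\<integral>\<^sup>+x. ennreal ((norm (small x))\<^sup>2) \<partial>lborel) \<le> (\<integral>\<^sup>+x. ennreal (l powr (2 - m) * norm (w x) powr m) \<partial>lborel)"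
    by (intro nn_integral_mono ennreal_leI small_le)
  also have "\<dots> = ennreal (l powr (2 - m) * Lp_norm m w powr m)"
    using nn_integral_eq_integral[OF rhs(2)] by (simp add: I)
  also have "\<dots> = ennreal ((sqrt (l powr (2 - m) * Lp_norm m w powr m))\<^sup>2)" by simp
  finally show "Lp_norm 2 small \<le> sqrt (l powr (2 - m) * Lp_norm m w powr m)"
    by (rule Lp_norm_2_leI(2)) auto
qed

text \<open>With \<open>T = \<tau>\<^bsup>-n/(2\<delta>)\<^esup>\<close> the two sides are the contributions of the high and the low part of a function of
  \<open>L\<^sup>m\<close> norm \<open>N\<close> to the low-frequency estimate; the height \<open>l = N T\<^bsup>1/m\<^esup>\<close> makes them equal.\<close>

lemma splitting_height:
  fixes N T m :: real
  assumes "0 \<le> N" "0 < T" "1 \<le> m" "m \<le> 2"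
  shows "\<exists>l>0. T powr (1/2) * (l powr (1 - m) * N powr m) = N * T powr (1/m - 1/2)
    \<and> sqrt (l powr (2 - m) * N powr m) = N * T powr (1/m - 1/2)"
proof (cases "N = 0")
  case False
  with assms have N: "0 < N" by simp
  show ?thesis
  proof (intro exI[of _ "N * T powr (1/m)"] conjI)
    show "0 < N * T powr (1/m)" using N assms by simp
    have "T powr (1/2) * ((N * T powr (1/m)) powr (1 - m) * N powr m)
        = (N powr (1 - m) * N powr m) * (T powr (1/2) * T powr (1/m * (1 - m)))"
      using N assms by (simp add: powr_mult powr_powr)
    also have "\<dots> = N * T powr (1/2 + 1/m * (1 - m))" using N by (simp flip: powr_add)
    also have "1/2 + 1/m * (1 - m) = 1/m - 1/2" using assms by (simp add: field_simps)
    finally show "T powr (1/2) * ((N * T powr (1/m)) powr (1 - m) * N powr m) = N * T powr (1/m - 1/2)" .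
    have e: "(N * T powr (1/m)) powr (2 - m) * N powr m = (N powr (2 - m) * N powr m) * T powr (1/m * (2 - m))"
      using N assms by (simp add: powr_mult powr_powr mult_ac)
    have "sqrt ((N * T powr (1/m)) powr (2 - m) * N powr m)
        = ((N powr (2 - m) * N powr m) * T powr (1/m * (2 - m))) powr (1/2)"
      unfolding e by (rule powr_half_sqrt[symmetric]) simp
    also have "\<dots> = (N powr 2 * T powr (1/m * (2 - m))) powr (1/2)" by (simp flip: powr_add)
    also have "\<dots> = N * T powr (1/m * (2 - m) * (1/2))" using N by (simp add: powr_mult powr_powr)
    also have "1/m * (2 - m) * (1/2) = 1/m - 1/2" using assms by (simp add: field_simps)
    finally show "sqrt ((N * T powr (1/m)) powr (2 - m) * N powr m) = N * T powr (1/m - 1/2)" .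
  qed
qed (use assms in \<open>auto intro: exI[of _ 1]\<close>)

abbreviation (input) decay_exponent :: "nat \<Rightarrow> real \<Rightarrow> real \<Rightarrow> real \<Rightarrow> real" where
  "decay_exponent n \<delta> m \<beta> \<equiv> - (real n / (2 * \<delta>)) * (1 / m - 1 / 2) - \<beta> / (2 * \<delta>)"

text \<open>The gain from integrability of the data. Let \<open>w\<close> be split at height \<open>l\<close>. The transform of the high
  part is bounded by its \<open>L\<^sup>1\<close> norm and is paired with the \<open>L\<^sup>2\<close> norm of the multiplier, which is of size
  \<open>\<tau>\<^bsup>-\<beta>/(2\<delta>) - n/(4\<delta>)\<^esup>\<close>; the transform of the low part is square integrable and is paired with the supremum
  of the multiplier, of size \<open>\<tau>\<^bsup>-\<beta>/(2\<delta>)\<^esup>\<close>. The choice of \<open>l\<close> in \<open>splitting_height\<close> then produces the factor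
  \<open>\<tau>\<^bsup>-n/(2\<delta>)(1/m - 1/2)\<^esup>\<close> that Hoelder's inequality and the Hausdorff--Young inequality would give.\<close>

lemma damped_multiplier_estimate:
  fixes \<delta> \<beta> m :: real
  assumes \<delta>: "0 < \<delta>" and \<beta>: "0 \<le> \<beta>" and m: "1 \<le> m" "m \<le> 2"
  obtains (bound) C where "0 < C"
    and "\<And>(w :: real^'n \<Rightarrow> complex) g \<tau> (P :: real^'n \<Rightarrow> complex).
      0 < \<tau> \<Longrightarrow> in_Lp m w \<Longrightarrow> is_fourier w g \<Longrightarrow> P \<in> borel_measurable borel \<Longrightarrow>
      (\<And>\<xi>. norm (P \<xi>) \<le> norm \<xi> powr \<beta> * exp (- (norm \<xi> powr (2 * \<delta>) * \<tau> / 8))) \<Longrightarrow>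
      in_Lp 2 (\<lambda>\<xi>. P \<xi> * g \<xi>) \<and>
      Lp_norm 2 (\<lambda>\<xi>. P \<xi> * g \<xi>) \<le> C * \<tau> powr decay_exponent CARD('n) \<delta> m \<beta> * Lp_norm m w"
proof -
  let ?n = "real CARD('n)"
  let ?k = "(2 * pi) powr (- ?n / 2)"
  obtain M where M: "0 < M" "\<And>\<tau>. 0 < \<tau> \<Longrightarrow> (\<integral>\<^sup>+\<xi>. ennreal (exp (- (norm (\<xi>::real^'n) powr (2 * \<delta>) * \<tau> / 8))) \<partial>lborel)
     \<le> ennreal (M * \<tau> powr (- (?n / (2 * \<delta>))))"
    using nn_integral_damping[OF \<delta>, where 'n = 'n] by blast
  obtain L where L: "0 < L" "\<And>y. 0 \<le> y \<Longrightarrow> y powr (\<beta> / (2 * \<delta>)) \<le> L * exp (1/16 * y)"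
    using powr_le_exp[of "\<beta> / (2 * \<delta>)" "1/16"] \<beta> \<delta> by auto
  let ?C = "L * (?k * sqrt M + 1)"
  show ?thesis
  proof (rule bound[of ?C]; (rule conjI)?)
    show "0 < ?C" using L M by (intro mult_pos_pos add_nonneg_pos) auto
    fix w g P :: "real^'n \<Rightarrow> complex" and \<tau> :: real
    assume \<tau>: "0 < \<tau>" and wm: "in_Lp m w" and wg: "is_fourier w g" and [measurable]: "P \<in> borel_measurable borel"
      and P: "\<And>\<xi>. norm (P \<xi>) \<le> norm \<xi> powr \<beta> * exp (- (norm \<xi> powr (2 * \<delta>) * \<tau> / 8))"
    have w2: "in_Lp 2 w" and g2: "in_Lp 2 g" using is_fourier_in_Lp[OF wg] .
    have [measurable]: "g \<in> borel_measurable borel" using g2 by (auto dest: in_Lp_measurable)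
    let ?S = "L * \<tau> powr (- (\<beta> / (2 * \<delta>)))"
    let ?T = "\<tau> powr (- (?n / (2 * \<delta>)))"
    have S: "0 \<le> ?S" using L by simp
    have P_le: "norm (P \<xi>) \<le> ?S * exp (- (norm \<xi> powr (2 * \<delta>) * \<tau> / 16))" for \<xi>
    proof -
      let ?y = "norm \<xi> powr (2 * \<delta>) * \<tau>"
      have y: "0 \<le> ?y" using \<tau> by simp
      have "norm \<xi> powr \<beta> = \<tau> powr (- (\<beta> / (2 * \<delta>))) * ?y powr (\<beta> / (2 * \<delta>))"
        using \<tau> \<delta> by (simp add: powr_mult powr_powr powr_minus field_simps)
      also have "\<dots> \<le> \<tau> powr (- (\<beta> / (2 * \<delta>))) * (L * exp (1/16 * ?y))"
        by (intro mult_left_mono L y) auto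
      finally have "norm \<xi> powr \<beta> * exp (- (?y / 8)) \<le> \<tau> powr (- (\<beta> / (2 * \<delta>))) * (L * exp (1/16 * ?y)) * exp (- (?y / 8))"
        by (intro mult_right_mono) auto
      also have "\<dots> = ?S * (exp (1/16 * ?y) * exp (- (?y / 8)))" by (simp only: ac_simps)
      also have "exp (1/16 * ?y) * exp (- (?y / 8)) = exp (- (?y / 16))" by (simp flip: exp_add)
      finally show ?thesis using P[of \<xi>] by simp
    qed
    have P_sup: "norm (P \<xi>) \<le> ?S" for \<xi>
    proof -
      have "?S * exp (- (norm \<xi> powr (2 * \<delta>) * \<tau> / 16)) \<le> ?S * 1"
        using S \<tau> by (intro mult_left_mono) auto
      with P_le[of \<xi>] show ?thesis by linarith
    qed
    have P2: "in_Lp 2 P" "Lp_norm 2 P \<le> ?S * sqrt M * ?T powr (1/2)"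
    proof -
      have "(\<integral>\<^sup>+\<xi>. ennreal ((norm (P \<xi>))\<^sup>2) \<partial>lborel) \<le> (\<integral>\<^sup>+\<xi>. ennreal (?S\<^sup>2) * ennreal (exp (- (norm (\<xi>::real^'n) powr (2 * \<delta>) * \<tau> / 8))) \<partial>lborel)"
      proof (rule nn_integral_mono)
        fix \<xi> :: "real^'n"
        have "(norm (P \<xi>))\<^sup>2 \<le> (?S * exp (- (norm \<xi> powr (2 * \<delta>) * \<tau> / 16)))\<^sup>2"
          by (intro power_mono P_le) auto
        also have "\<dots> = ?S\<^sup>2 * exp (- (norm \<xi> powr (2 * \<delta>) * \<tau> / 8))"
          by (simp only: power_mult_distrib power2_eq_square[of "exp _"] exp_add[symmetric]) simp
        finally show "ennreal ((norm (P \<xi>))\<^sup>2) \<le> ennreal (?S\<^sup>2) * ennreal (exp (- (norm \<xi> powr (2 * \<delta>) * \<tau> / 8)))"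
          by (subst ennreal_mult[symmetric]) (auto intro: ennreal_leI)
      qed
      also have "\<dots> = ennreal (?S\<^sup>2) * (\<integral>\<^sup>+\<xi>. ennreal (exp (- (norm (\<xi>::real^'n) powr (2 * \<delta>) * \<tau> / 8))) \<partial>lborel)"
        by (rule nn_integral_cmult) measurable
      also have "\<dots> \<le> ennreal (?S\<^sup>2) * ennreal (M * ?T)"
        by (intro mult_left_mono M \<tau>) auto
      also have "\<dots> = ennreal ((?S * sqrt M * ?T powr (1/2))\<^sup>2)"
        using M \<tau> by (subst ennreal_mult[symmetric]) (auto simp: power_mult_distrib powr_half_sqrt)
      finally have *: "(\<integral>\<^sup>+\<xi>. ennreal ((norm (P \<xi>))\<^sup>2) \<partial>lborel) \<le> ennreal ((?S * sqrt M * ?T powr (1/2))\<^sup>2)" .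
      have "P \<in> borel_measurable lborel" "0 \<le> ?S * sqrt M * ?T powr (1/2)"
        using S M by auto
      then show "in_Lp 2 P" "Lp_norm 2 P \<le> ?S * sqrt M * ?T powr (1/2)"
        using Lp_norm_2_leI[OF *] by auto
    qed
    let ?N = "Lp_norm m w"
    have "0 < ?T" using \<tau> by simp
    then obtain l where l: "0 < l" and l1: "?T powr (1/2) * (l powr (1 - m) * ?N powr m) = ?N * ?T powr (1/m - 1/2)"
      and l2: "sqrt (l powr (2 - m) * ?N powr m) = ?N * ?T powr (1/m - 1/2)"
      using splitting_height[of ?N ?T m] m by auto
    let ?big = "\<lambda>x. indicator {x. l < norm (w x)} x * w x"
    let ?small = "\<lambda>x. indicator {x. norm (w x) \<le> l} x * w x"
    note split = level_split[OF wm w2 m l]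
    have Fbig: "is_fourier ?big (fourier_L1 ?big)" by (rule is_fourier_fourier_L1[OF split(2,1)])
    have Fsmall: "is_fourier ?small (fourier ?small)" by (rule is_fourier_fourier[OF split(3)])
    have "is_fourier w (\<lambda>\<xi>. 1 * fourier_L1 ?big \<xi> + 1 * fourier ?small \<xi>)"
      using is_fourier_lincomb[OF Fbig Fsmall, of 1 1] split(4) by simp
    from is_fourier_unique[OF wg this]
    have eq: "AE \<xi> in lborel. P \<xi> * g \<xi> = P \<xi> * fourier_L1 ?big \<xi> + P \<xi> * fourier ?small \<xi>"
      by eventually_elim (simp add: distrib_left)
    have b2: "in_Lp 2 (fourier_L1 ?big)" and s2: "in_Lp 2 (fourier ?small)"
      using is_fourier_in_Lp(2)[OF Fbig] is_fourier_in_Lp(2)[OF Fsmall] .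
    have [measurable]: "fourier_L1 ?big \<in> borel_measurable borel" "fourier ?small \<in> borel_measurable borel"
      using in_Lp_measurable[OF b2] in_Lp_measurable[OF s2] by auto
    have 1: "in_Lp 2 (\<lambda>\<xi>. P \<xi> * fourier_L1 ?big \<xi>)"
      "Lp_norm 2 (\<lambda>\<xi>. P \<xi> * fourier_L1 ?big \<xi>) \<le> (?k * (l powr (1 - m) * ?N powr m)) * Lp_norm 2 P"
    proof -
      have "norm (fourier_L1 ?big \<xi>) \<le> ?k * (l powr (1 - m) * ?N powr m)" for \<xi>
        by (rule order_trans[OF fourier_L1_bound[OF split(1)] mult_left_mono[OF split(5)]]) simp
      then have "AE \<xi> in lborel. norm (P \<xi> * fourier_L1 ?big \<xi>) \<le> (?k * (l powr (1 - m) * ?N powr m)) * norm (P \<xi>)"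
        by (auto simp: norm_mult mult.commute[of "norm (P _)"] intro!: mult_right_mono)
      then show "in_Lp 2 (\<lambda>\<xi>. P \<xi> * fourier_L1 ?big \<xi>)"
        "Lp_norm 2 (\<lambda>\<xi>. P \<xi> * fourier_L1 ?big \<xi>) \<le> (?k * (l powr (1 - m) * ?N powr m)) * Lp_norm 2 P"
        by (rule Lp_2_mono[OF P2(1), rotated 2]; simp)+
    qed
    have 2: "in_Lp 2 (\<lambda>\<xi>. P \<xi> * fourier ?small \<xi>)"
      "Lp_norm 2 (\<lambda>\<xi>. P \<xi> * fourier ?small \<xi>) \<le> ?S * Lp_norm 2 (fourier ?small)"
    proof -
      have "AE \<xi> in lborel. norm (P \<xi> * fourier ?small \<xi>) \<le> ?S * norm (fourier ?small \<xi>)"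
        using P_sup by (auto simp: norm_mult intro!: mult_right_mono)
      then show "in_Lp 2 (\<lambda>\<xi>. P \<xi> * fourier ?small \<xi>)"
        "Lp_norm 2 (\<lambda>\<xi>. P \<xi> * fourier ?small \<xi>) \<le> ?S * Lp_norm 2 (fourier ?small)"
        by (rule Lp_2_mono[OF s2, rotated 2]; use S in simp)+
    qed
    have "Lp_norm 2 (\<lambda>\<xi>. P \<xi> * fourier_L1 ?big \<xi>) \<le> (?k * (l powr (1 - m) * ?N powr m)) * (?S * sqrt M * ?T powr (1/2))"
      by (rule order_trans[OF 1(2)]) (intro mult_left_mono P2, simp)
    also have "\<dots> = ?S * ?k * sqrt M * (?T powr (1/2) * (l powr (1 - m) * ?N powr m))" by (simp only: ac_simps)
    finally have A: "Lp_norm 2 (\<lambda>\<xi>. P \<xi> * fourier_L1 ?big \<xi>) \<le> ?S * ?k * sqrt M * (?N * ?T powr (1/m - 1/2))"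
      unfolding l1 .
    have "Lp_norm 2 (fourier ?small) \<le> ?N * ?T powr (1/m - 1/2)"
      using split(6) unfolding l2 plancherel[OF Fsmall] .
    then have B: "Lp_norm 2 (\<lambda>\<xi>. P \<xi> * fourier ?small \<xi>) \<le> ?S * (?N * ?T powr (1/m - 1/2))"
      using 2(2) S by (meson mult_left_mono order_trans)
    note sum = Lp_2_add[OF 1(1) 2(1)]
    have meas: "(\<lambda>\<xi>. P \<xi> * g \<xi>) \<in> borel_measurable lborel" by simp
    show "in_Lp 2 (\<lambda>\<xi>. P \<xi> * g \<xi>)" by (rule Lp_2_cong_AE(1)[OF sum(1) meas eq])
    have "Lp_norm 2 (\<lambda>\<xi>. P \<xi> * g \<xi>) \<le> ?S * ?k * sqrt M * (?N * ?T powr (1/m - 1/2)) + ?S * (?N * ?T powr (1/m - 1/2))"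
      unfolding Lp_2_cong_AE(2)[OF sum(1) meas eq] using sum(2) A B by linarith
    also have "\<dots> = ?C * (\<tau> powr (- (\<beta> / (2 * \<delta>))) * ?T powr (1/m - 1/2)) * ?N"
      by (simp add: algebra_simps)
    also have "\<tau> powr (- (\<beta> / (2 * \<delta>))) * ?T powr (1/m - 1/2) = \<tau> powr (- (?n / (2 * \<delta>)) * (1 / m - 1 / 2) - \<beta> / (2 * \<delta>))"
      by (simp only: powr_powr powr_add[symmetric] diff_conv_add_uminus add.commute)
    finally show "Lp_norm 2 (\<lambda>\<xi>. P \<xi> * g \<xi>) \<le> ?C * \<tau> powr (- (?n / (2 * \<delta>)) * (1 / m - 1 / 2) - \<beta> / (2 * \<delta>)) * ?N" .
  qed
qed

text \<open>Low and high frequencies together. On \<open>|\<xi>| \<le> 1\<close> replacing \<open>t\<close> by \<open>1 + t\<close> in the exponential costs only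
  the factor \<open>exp(1/8)\<close>, which makes the low-frequency estimate uniform down to \<open>t = 0\<close>. On \<open>|\<xi>| > 1\<close> the
  exponential decay in time beats every power of \<open>1 + t\<close>, and the Sobolev weight pays for the growth of
  the multiplier.\<close>

lemma multiplier_estimate:
  fixes \<delta> \<beta> m s :: real
  assumes \<delta>: "0 < \<delta>" and \<beta>: "0 \<le> \<beta>" and m: "1 \<le> m" "m \<le> 2"
  obtains (bound) C where "0 < C"
    and "\<And>(w :: real^'n \<Rightarrow> complex) t (P :: real^'n \<Rightarrow> complex) M.
      0 \<le> t \<Longrightarrow> 0 < M \<Longrightarrow> in_Lp m w \<Longrightarrow> in_Hs s w \<Longrightarrow> P \<in> borel_measurable borel \<Longrightarrow>
      (\<And>\<xi>. norm \<xi> \<le> 1 \<Longrightarrow>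
        norm (P \<xi>) \<le> M * (norm \<xi> powr \<beta> * exp (- (norm \<xi> powr (2 * \<delta>) * t / 8)))) \<Longrightarrow>
      (\<And>\<xi>. 1 < norm \<xi> \<Longrightarrow>
        norm (P \<xi>) \<le> M * ((1 + (norm \<xi>)\<^sup>2) powr (s / 2) * exp (- (t / 8)))) \<Longrightarrow>
      in_Lp 2 (\<lambda>\<xi>. P \<xi> * fourier w \<xi>) \<and>
      Lp_norm 2 (\<lambda>\<xi>. P \<xi> * fourier w \<xi>)
        \<le> C * M * (1 + t) powr decay_exponent CARD('n) \<delta> m \<beta> * Lm_Hs_norm m s w"
proof -
  let ?\<kappa> = "decay_exponent CARD('n) \<delta> m \<beta>"
  have "(1::real) / 2 \<le> 1 / m" using m by (simp add: field_simps)
  then have "0 \<le> (real CARD('n) / (2 * \<delta>)) * (1 / m - 1 / 2)" using \<delta> by (intro mult_nonneg_nonneg) auto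
  moreover have "0 \<le> \<beta> / (2 * \<delta>)" using \<delta> \<beta> by simp
  ultimately have \<kappa>: "0 \<le> - ?\<kappa>" by simp
  obtain B where B: "0 < B" "\<And>y. 0 \<le> y \<Longrightarrow> y powr (- ?\<kappa>) \<le> B * exp (1/8 * y)"
    using powr_le_exp[OF \<kappa>, of "1/8"] by auto
  show ?thesis
  proof (cases rule: damped_multiplier_estimate[OF \<delta> \<beta> m, where 'n = 'n, case_names bound])
    case A: (bound A)
    let ?e = "exp (1/8 :: real)"
    let ?C = "?e * (A + B)"
    show ?thesis
    proof (rule that[of ?C]; (rule conjI)?)
      show "0 < ?C" using A B by simp
      fix w P :: "real^'n \<Rightarrow> complex" and t M :: real
      assume t: "0 \<le> t" and M: "0 < M" and wm: "in_Lp m w" and ws: "in_Hs s w" and [measurable]: "P \<in> borel_measurable borel"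
        and low: "\<And>\<xi>. norm \<xi> \<le> 1 \<Longrightarrow> norm (P \<xi>) \<le> M * (norm \<xi> powr \<beta> * exp (- (norm \<xi> powr (2 * \<delta>) * t / 8)))"
        and high: "\<And>\<xi>. 1 < norm \<xi> \<Longrightarrow> norm (P \<xi>) \<le> M * ((1 + (norm \<xi>)\<^sup>2) powr (s / 2) * exp (- (t / 8)))"
      have wF: "is_fourier w (fourier w)" using ws by (intro is_fourier_fourier) (simp add: in_Hs_def)
      have [measurable]: "fourier w \<in> borel_measurable borel"
        using in_Lp_measurable[OF is_fourier_in_Lp(2)[OF wF]] by simp
      let ?B = "cball 0 1 :: (real^'n) set"
      have [measurable]: "?B \<in> sets borel" by simp
      let ?Q = "\<lambda>\<xi>. of_real (1 / (M * ?e)) * (indicator ?B \<xi> * P \<xi>)"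
      let ?R = "\<lambda>\<xi>. indicator (- ?B) \<xi> * (P \<xi> * fourier w \<xi>)"
      have tpos: "0 < 1 + t" using t by simp
      have Q: "norm (?Q \<xi>) \<le> norm \<xi> powr \<beta> * exp (- (norm \<xi> powr (2 * \<delta>) * (1 + t) / 8))" for \<xi>
      proof (cases "norm \<xi> \<le> 1")
        case True
        have "norm \<xi> powr (2 * \<delta>) \<le> 1 powr (2 * \<delta>)" using True \<delta> by (intro powr_mono2) auto
        then have "exp (- (norm \<xi> powr (2 * \<delta>) * t / 8)) \<le> exp (1/8 + - (norm \<xi> powr (2 * \<delta>) * (1 + t) / 8))"
          by (subst exp_le_cancel_iff) (simp add: field_simps)
        then have "norm (P \<xi>) \<le> M * (norm \<xi> powr \<beta> * (?e * exp (- (norm \<xi> powr (2 * \<delta>) * (1 + t) / 8))))"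
          unfolding exp_add using M by (intro order_trans[OF low[OF True]] mult_left_mono) auto
        then show ?thesis using True M by (simp add: norm_mult norm_divide field_simps)
      qed simp
      have QL: "in_Lp 2 (\<lambda>\<xi>. ?Q \<xi> * fourier w \<xi>)" "Lp_norm 2 (\<lambda>\<xi>. ?Q \<xi> * fourier w \<xi>) \<le> A * (1 + t) powr ?\<kappa> * Lp_norm m w"
        using A(2)[OF tpos wm wF _ Q] by auto
      let ?W = "\<lambda>\<xi>. of_real ((1 + (norm \<xi>)\<^sup>2) powr (s / 2)) * fourier w \<xi>"
      have W: "in_Lp 2 ?W" using ws by (simp add: in_Hs_def)
      have "(1 + t) powr (- ?\<kappa>) \<le> B * (?e * exp (t / 8))"
        using B(2)[of "1 + t"] t by (simp add: distrib_left exp_add)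
      then have "exp (- (t / 8)) \<le> B * ?e * (1 + t) powr ?\<kappa>"
        using tpos by (simp only: powr_minus exp_minus) (simp add: field_simps)
      then have et: "M * exp (- (t / 8)) \<le> M * (B * ?e * (1 + t) powr ?\<kappa>)" using M by (intro mult_left_mono) auto
      have R_le: "AE \<xi> in lborel. norm (?R \<xi>) \<le> (M * (B * ?e * (1 + t) powr ?\<kappa>)) * norm (?W \<xi>)"
      proof (intro AE_I2)
        fix \<xi> :: "real^'n"
        show "norm (?R \<xi>) \<le> (M * (B * ?e * (1 + t) powr ?\<kappa>)) * norm (?W \<xi>)"
        proof (cases "norm \<xi> \<le> 1")
          case True
          then show ?thesis using M B by simp
        next
          case False
          then have "norm (P \<xi>) \<le> (M * exp (- (t / 8))) * (1 + (norm \<xi>)\<^sup>2) powr (s / 2)" using high[of \<xi>] by (simp add: mult_ac)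
          also have "\<dots> \<le> (M * (B * ?e * (1 + t) powr ?\<kappa>)) * (1 + (norm \<xi>)\<^sup>2) powr (s / 2)"
            by (rule mult_right_mono[OF et]) simp
          finally have "norm (P \<xi>) * norm (fourier w \<xi>) \<le> (M * (B * ?e * (1 + t) powr ?\<kappa>)) * (1 + (norm \<xi>)\<^sup>2) powr (s / 2) * norm (fourier w \<xi>)"
            by (rule mult_right_mono) simp
          with False show ?thesis by (simp add: norm_mult mult.assoc)
        qed
      qed
      have RL: "in_Lp 2 ?R" "Lp_norm 2 ?R \<le> (M * (B * ?e * (1 + t) powr ?\<kappa>)) * Hs_norm s w"
        unfolding Hs_norm_def by (rule Lp_2_mono[OF W _ _ R_le]; use M B in simp)+
      have eq: "(\<lambda>\<xi>. P \<xi> * fourier w \<xi>) = (\<lambda>\<xi>. of_real (M * ?e) * (?Q \<xi> * fourier w \<xi>) + ?R \<xi>)"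
        using M by (auto simp: indicator_def fun_eq_iff)
      note QM = Lp_norm_2_cmult[OF QL(1), of "of_real (M * ?e)"]
      show "in_Lp 2 (\<lambda>\<xi>. P \<xi> * fourier w \<xi>)"
        unfolding eq by (rule Lp_2_add(1)[OF QM(1) RL(1)])
      have "Lp_norm 2 (\<lambda>\<xi>. P \<xi> * fourier w \<xi>) \<le> norm (complex_of_real (M * ?e)) * Lp_norm 2 (\<lambda>\<xi>. ?Q \<xi> * fourier w \<xi>) + Lp_norm 2 ?R"
        unfolding eq QM(2)[symmetric] by (rule Lp_2_add(2)[OF QM(1) RL(1)])
      also have "norm (complex_of_real (M * ?e)) = M * ?e" using M by (simp add: norm_mult)
      also have "M * ?e * Lp_norm 2 (\<lambda>\<xi>. ?Q \<xi> * fourier w \<xi>) + Lp_norm 2 ?R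
          \<le> M * ?e * (A * (1 + t) powr ?\<kappa> * Lp_norm m w) + (M * (B * ?e * (1 + t) powr ?\<kappa>)) * Hs_norm s w"
        using M by (intro add_mono mult_left_mono QL RL) auto
      also have "\<dots> = (M * ?e * (1 + t) powr ?\<kappa>) * (A * Lp_norm m w + B * Hs_norm s w)"
        by (simp add: algebra_simps)
      also have "\<dots> \<le> (M * ?e * (1 + t) powr ?\<kappa>) * ((A + B) * Lm_Hs_norm m s w)"
      proof (rule mult_left_mono)
        have "0 \<le> A * Hs_norm s w" "0 \<le> B * Lp_norm m w" using A B by (simp_all add: Hs_norm_def)
        then show "A * Lp_norm m w + B * Hs_norm s w \<le> (A + B) * Lm_Hs_norm m s w"
          by (simp add: Lm_Hs_norm_def algebra_simps)
      qed (use M in simp)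
      finally show "Lp_norm 2 (\<lambda>\<xi>. P \<xi> * fourier w \<xi>) \<le> ?C * M * (1 + t) powr ?\<kappa> * Lm_Hs_norm m s w"
        by (simp only: ac_simps)
    qed
  qed
qed

section \<open>Strong time derivatives on the Fourier side\<close>

lemma tendsto_zero_L2_cong:
  assumes "eventually (\<lambda>s. h s = h' s) F"
  shows "tendsto_zero_L2 h F \<longleftrightarrow> tendsto_zero_L2 h' F"
  unfolding tendsto_zero_L2_def by (rule tendsto_cong) (use assms in eventually_elim, simp)

lemma at_within_atLeast_nontrivial:
  fixes t :: real
  assumes "0 \<le> t"
  shows "at t within {0..} \<noteq> bot"
proof -
  have "at_right t \<le> at t within {0..}" using assms by (intro at_le) auto
  then show ?thesis using trivial_limit_at_right_real[of t] by (metis le_bot trivial_limit_def)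
qed

text \<open>A strong derivative has the limit of the norms of the difference quotients as its norm, so that all
  strong derivatives at a point have the same norm, among them the one that \<open>L2_deriv\<close> picks.\<close>

lemma L2_deriv_norm:
  assumes u: "\<And>s. 0 \<le> s \<Longrightarrow> in_Lp 2 (u s)" and t: "0 \<le> t" and v: "has_L2_deriv u v t"
  shows "in_Lp 2 (L2_deriv u t)" "Lp_norm 2 (L2_deriv u t) = Lp_norm 2 v"
proof -
  define q where "q s = (if 0 \<le> s then (\<lambda>x. (1 / of_real (s - t)) * (u s x - u t x)) else (\<lambda>x. 0))" for s
  have q: "in_Lp 2 (q s)" for s
  proof (cases "0 \<le> s")
    case True
    then show ?thesis unfolding q_def using t by (simp only: if_True) (intro Lp_norm_2_cmult(1) Lp_2_diff(1) u)
  next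
    case False
    then show ?thesis by (simp add: q_def in_Lp_2_iff)
  qed
  have lim: "((\<lambda>s. Lp_norm 2 (q s)) \<longlongrightarrow> Lp_norm 2 v') (at t within {0..})" if v': "has_L2_deriv u v' t" for v'
  proof -
    have v'2: "in_Lp 2 v'" using v' by (simp add: has_L2_deriv_def)
    have ev: "eventually (\<lambda>s. (\<lambda>x. (u s x - u t x) / of_real (s - t) - v' x) = (\<lambda>x. q s x - v' x)) (at t within {0..})"
      unfolding eventually_at_filter by (rule always_eventually) (simp add: q_def)
    have "tendsto_zero_L2 (\<lambda>s x. q s x - v' x) (at t within {0..})"
      using v' unfolding has_L2_deriv_def tendsto_zero_L2_cong[OF ev] by simp
    then have "((\<lambda>s. Lp_norm 2 (\<lambda>x. q s x - v' x)) \<longlongrightarrow> 0) (at t within {0..})"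
      by (subst (asm) tendsto_zero_L2_iff) (intro Lp_2_diff q v'2)
    then show ?thesis by (rule Lp_norm_2_tendsto[OF q v'2])
  qed
  have D: "has_L2_deriv u (L2_deriv u t) t"
    unfolding L2_deriv_def by (rule someI[where P = "\<lambda>v. has_L2_deriv u v t", OF v])
  then show "in_Lp 2 (L2_deriv u t)" by (simp add: has_L2_deriv_def)
  show "Lp_norm 2 (L2_deriv u t) = Lp_norm 2 v"
    by (rule tendsto_unique[OF at_within_atLeast_nontrivial[OF t] lim[OF D] lim[OF v]])
qed

lemma Lp_2_of_norm:
  assumes f: "in_Lp 2 f"
  shows "in_Lp 2 (\<lambda>\<xi>. complex_of_real (norm (f \<xi>)))"
proof -
  have [measurable]: "f \<in> borel_measurable borel" using f by (auto dest: in_Lp_measurable)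
  show ?thesis by (rule Lp_2_mono(1)[OF f, of _ 1]) auto
qed

lemma lipschitz_of_vector_derivative:
  fixes f :: "real \<Rightarrow> complex"
  assumes "convex S" "x \<in> S" "y \<in> S" and B: "0 \<le> B"
    and "\<And>s. s \<in> S \<Longrightarrow> (f has_vector_derivative D s) (at s within S)" "\<And>s. s \<in> S \<Longrightarrow> norm (D s) \<le> B"
  shows "norm (f x - f y) \<le> \<bar>x - y\<bar> * B"
proof -
  have "norm (f x - f y) \<le> B * norm (x - y)"
  proof (rule differentiable_bound[OF assms(1)])
    show "(f has_derivative (\<lambda>h. h *\<^sub>R D s)) (at s within S)" if "s \<in> S" for s
      using assms(5)[OF that] by (simp add: has_vector_derivative_def)
    show "onorm (\<lambda>h. h *\<^sub>R D s) \<le> B" if "s \<in> S" for s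
      using assms(6)[OF that] B by (intro onorm_bound) (auto simp: mult.commute[of B] intro: mult_left_mono)
  qed (use assms in auto)
  then show ?thesis by (simp add: mult.commute)
qed

lemma vector_derivative_quotient_tendsto:
  fixes f :: "real \<Rightarrow> complex"
  assumes "(f has_vector_derivative D) (at t within S)"
  shows "((\<lambda>s. (1 / of_real (s - t)) * (f s - f t) - D) \<longlongrightarrow> 0) (at t within S)"
proof -
  have "((\<lambda>s. (1 / norm (s - t)) *\<^sub>R (f s - (f t + (s - t) *\<^sub>R D))) \<longlongrightarrow> 0) (at t within S)"
    using assms unfolding has_vector_derivative_def has_derivative_within by simp
  then have lim: "((\<lambda>s. norm ((1 / norm (s - t)) *\<^sub>R (f s - (f t + (s - t) *\<^sub>R D)))) \<longlongrightarrow> 0) (at t within S)"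
    by (rule tendsto_norm_zero)
  show ?thesis
  proof (rule Lim_null_comparison[OF _ lim])
    have "norm ((1 / of_real (s - t)) * (f s - f t) - D) \<le> norm ((1 / norm (s - t)) *\<^sub>R (f s - (f t + (s - t) *\<^sub>R D)))"
      if "s \<noteq> t" for s
    proof -
      have "(1 / of_real (s - t)) * (f s - f t) - D = (1 / of_real (s - t)) * (f s - (f t + (s - t) *\<^sub>R D))"
        using that by (simp add: scaleR_conv_of_real field_simps)
      then show ?thesis by (simp add: norm_mult norm_divide flip: of_real_diff)
    qed
    then show "eventually (\<lambda>s. norm ((1 / of_real (s - t)) * (f s - f t) - D)
        \<le> norm ((1 / norm (s - t)) *\<^sub>R (f s - (f t + (s - t) *\<^sub>R D)))) (at t within S)"
      unfolding eventually_at_filter by (intro always_eventually) blast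
  qed
qed

text \<open>By Plancherel's theorem and dominated convergence, a curve whose transforms are pointwise
  differentiable in time and Lipschitz with a square integrable constant is strongly differentiable.\<close>

lemma has_L2_deriv_fourier:
  fixes u :: "real \<Rightarrow> real^'n \<Rightarrow> complex"
  assumes uU: "\<And>s. 0 \<le> s \<Longrightarrow> is_fourier (u s) (U s)" and vV: "is_fourier v V" and W: "in_Lp 2 W" and t: "0 \<le> t"
    and lip: "\<And>s \<xi>. 0 \<le> s \<Longrightarrow> norm (U s \<xi> - U t \<xi>) \<le> \<bar>s - t\<bar> * norm (W \<xi>)"
    and deriv: "\<And>\<xi>. ((\<lambda>s. U s \<xi>) has_vector_derivative V \<xi>) (at t within {0..})"
  shows "has_L2_deriv u v t"
proof -
  let ?F = "at t within {0..}"
  have v2: "in_Lp 2 v" and V2: "in_Lp 2 V" using is_fourier_in_Lp[OF vV] .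
  define h where "h s = (if 0 \<le> s then (\<lambda>x. 1 * ((1 / of_real (s - t)) * u s x + (- (1 / of_real (s - t))) * u t x) + (-1) * v x) else (\<lambda>x. 0))" for s
  define H where "H s = (if 0 \<le> s then (\<lambda>x. 1 * ((1 / of_real (s - t)) * U s x + (- (1 / of_real (s - t))) * U t x) + (-1) * V x) else (\<lambda>x. 0))" for s
  have fou: "is_fourier (h s) (H s)" if "0 \<le> s" for s
    using that t unfolding h_def H_def by (simp only: if_True) (intro is_fourier_lincomb uU vV)
  have zero: "in_Lp 2 (\<lambda>x. 0 :: complex)" by (simp add: in_Lp_2_iff)
  have h2: "in_Lp 2 (h s)" for s
    using is_fourier_in_Lp(1)[OF fou[of s]] zero by (cases "0 \<le> s") (auto simp: h_def)
  have H2: "in_Lp 2 (H s)" for s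
    using is_fourier_in_Lp(2)[OF fou[of s]] zero by (cases "0 \<le> s") (auto simp: H_def)
  have norm_eq: "Lp_norm 2 (h s) = Lp_norm 2 (H s)" for s
    using plancherel[OF fou[of s]] by (cases "0 \<le> s") (auto simp: h_def H_def)
  have "((\<lambda>s. Lp_norm 2 (H s)) \<longlongrightarrow> 0) ?F"
    unfolding tendsto_at_iff_sequentially comp_def
  proof (intro allI impI)
    fix X :: "nat \<Rightarrow> real" assume X: "\<forall>i. X i \<in> {0..} - {t}" "X \<longlonglongrightarrow> t"
    let ?w = "\<lambda>\<xi>. complex_of_real (norm (W \<xi>)) + complex_of_real (norm (V \<xi>))"
    have H_X: "H (X k) = (\<lambda>\<xi>. (1 / of_real (X k - t)) * (U (X k) \<xi> - U t \<xi>) - V \<xi>)" for k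
      using X(1) by (auto simp: H_def diff_divide_distrib)
    show "(\<lambda>k. Lp_norm 2 (H (X k))) \<longlonglongrightarrow> 0"
    proof (rule Lp_2_dominated)
      show "H (X k) \<in> borel_measurable lborel" for k by (rule in_Lp_measurable[OF H2])
      show "in_Lp 2 ?w" by (intro Lp_2_add Lp_2_of_norm W V2)
      show "AE \<xi> in lborel. norm (H (X k) \<xi>) \<le> norm (?w \<xi>)" for k
      proof (intro AE_I2)
        fix \<xi>
        have Xk: "0 \<le> X k" "X k \<noteq> t" using X(1) by auto
        have "norm ((1 / of_real (X k - t)) * (U (X k) \<xi> - U t \<xi>)) = norm (U (X k) \<xi> - U t \<xi>) / \<bar>X k - t\<bar>"
          by (simp add: norm_mult norm_divide flip: of_real_diff)
        also have "\<dots> \<le> norm (W \<xi>)" using lip[OF Xk(1), of \<xi>] Xk(2) by (simp add: field_simps)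
        finally have "norm ((1 / of_real (X k - t)) * (U (X k) \<xi> - U t \<xi>) - V \<xi>) \<le> norm (W \<xi>) + norm (V \<xi>)"
          using norm_triangle_ineq4 order_trans add_right_mono by meson
        also have "norm (W \<xi>) + norm (V \<xi>) = norm (?w \<xi>)"
          by (simp flip: of_real_add)
        finally show "norm (H (X k) \<xi>) \<le> norm (?w \<xi>)" unfolding H_X .
      qed
      show "AE \<xi> in lborel. (\<lambda>k. H (X k) \<xi>) \<longlonglongrightarrow> 0"
      proof (intro AE_I2)
        fix \<xi>
        show "(\<lambda>k. H (X k) \<xi>) \<longlonglongrightarrow> 0"
          using vector_derivative_quotient_tendsto[OF deriv[of \<xi>]] X
          unfolding tendsto_at_iff_sequentially comp_def H_X by blast
      qed
    qed
  qed
  then have "tendsto_zero_L2 h ?F"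
    unfolding tendsto_zero_L2_iff[OF h2] norm_eq .
  moreover have ev: "eventually (\<lambda>s. (\<lambda>x. (u s x - u t x) / of_real (s - t) - v x) = h s) ?F"
    unfolding eventually_at_filter
    by (rule always_eventually) (auto simp: h_def diff_divide_distrib)
  ultimately show ?thesis
    unfolding has_L2_deriv_def tendsto_zero_L2_cong[OF ev] using v2 by simp
qed

section \<open>The decay estimates\<close>

lemma envelope_low_high:
  assumes "0 < \<delta>"
  shows "norm \<xi> \<le> 1 \<Longrightarrow> envelope \<delta> t \<xi> = exp (- (norm \<xi> powr (2 * \<delta>) * t / 8))"
    and "1 < norm \<xi> \<Longrightarrow> envelope \<delta> t \<xi> = exp (- (t / 8))"
proof -
  show "envelope \<delta> t \<xi> = exp (- (norm \<xi> powr (2 * \<delta>) * t / 8))" if "norm \<xi> \<le> 1"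
  proof -
    have "norm \<xi> powr (2 * \<delta>) \<le> 1 powr (2 * \<delta>)" using that assms by (intro powr_mono2) auto
    then show ?thesis by (simp add: envelope_def min_absorb2)
  qed
  show "envelope \<delta> t \<xi> = exp (- (t / 8))" if "1 < norm \<xi>"
  proof -
    have "1 \<le> norm \<xi> powr (2 * \<delta>)" using that assms by (intro ge_one_powr_ge_zero) auto
    then show ?thesis by (simp add: envelope_def min_absorb1)
  qed
qed

lemma powr_le_bessel_weight:
  assumes "1 < norm \<xi>" "x \<le> s" "0 \<le> s"
  shows "norm \<xi> powr x \<le> (1 + (norm \<xi>)\<^sup>2) powr (s / 2)"
proof -
  have "norm \<xi> powr x \<le> norm \<xi> powr (2 * (s / 2))" using assms by (intro powr_mono) auto
  also have "\<dots> = ((norm \<xi>)\<^sup>2) powr (s / 2)"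
    using assms(1) by (subst powr_powr[symmetric]) (auto simp: powr_numeral)
  also have "\<dots> \<le> (1 + (norm \<xi>)\<^sup>2) powr (s / 2)" using assms by (intro powr_mono2) auto
  finally show ?thesis .
qed

text \<open>The form in which both kernels, or both their time derivatives, are estimated. The power \<open>(1 + t)\<^sup>e\<close>
  accounts for the growth that the kernel of the second datum has relative to the envelope.\<close>

lemma two_multiplier_estimate:
  fixes \<delta> \<beta>0 \<beta>1 m s0 s1 M0 M1 e :: real and P0 P1 :: "real \<Rightarrow> real^'n \<Rightarrow> complex"
  assumes \<delta>: "0 < \<delta>" and \<beta>: "0 \<le> \<beta>0" "0 \<le> \<beta>1" and m: "1 \<le> m" "m \<le> 2" and M: "0 < M0" "0 < M1"
    and meas: "\<And>t. P0 t \<in> borel_measurable borel" "\<And>t. P1 t \<in> borel_measurable borel"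
    and low0: "\<And>t \<xi>. 0 \<le> t \<Longrightarrow> norm \<xi> \<le> 1 \<Longrightarrow> norm (P0 t \<xi>) \<le> M0 * (norm \<xi> powr \<beta>0 * envelope \<delta> t \<xi>)"
    and high0: "\<And>t \<xi>. 0 \<le> t \<Longrightarrow> 1 < norm \<xi> \<Longrightarrow> norm (P0 t \<xi>) \<le> M0 * ((1 + (norm \<xi>)\<^sup>2) powr (s0 / 2) * envelope \<delta> t \<xi>)"
    and low1: "\<And>t \<xi>. 0 \<le> t \<Longrightarrow> norm \<xi> \<le> 1 \<Longrightarrow> norm (P1 t \<xi>) \<le> M1 * (1 + t) powr e * (norm \<xi> powr \<beta>1 * envelope \<delta> t \<xi>)"
    and high1: "\<And>t \<xi>. 0 \<le> t \<Longrightarrow> 1 < norm \<xi> \<Longrightarrow> norm (P1 t \<xi>) \<le> M1 * (1 + t) powr e * ((1 + (norm \<xi>)\<^sup>2) powr (s1 / 2) * envelope \<delta> t \<xi>)"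
  shows "\<exists>C>0. \<forall>(w0 :: real^'n \<Rightarrow> complex) w1. in_Lp m w0 \<and> in_Hs s0 w0 \<and> in_Lp m w1 \<and> in_Hs s1 w1 \<longrightarrow> (\<forall>t\<ge>0.
     in_Lp 2 (\<lambda>\<xi>. P0 t \<xi> * fourier w0 \<xi> + P1 t \<xi> * fourier w1 \<xi>) \<and>
     Lp_norm 2 (\<lambda>\<xi>. P0 t \<xi> * fourier w0 \<xi> + P1 t \<xi> * fourier w1 \<xi>)
       \<le> C * ((1 + t) powr decay_exponent CARD('n) \<delta> m \<beta>0 * Lm_Hs_norm m s0 w0
          + (1 + t) powr (e - (real CARD('n) / (2 * \<delta>)) * (1 / m - 1 / 2) - \<beta>1 / (2 * \<delta>)) * Lm_Hs_norm m s1 w1))"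
proof -
  let ?\<mu> = "(real CARD('n) / (2 * \<delta>)) * (1 / m - 1 / 2)"
  show ?thesis
  proof (cases rule: multiplier_estimate[OF \<delta> \<beta>(1) m, where s = s0 and 'n = 'n, case_names bound])
    case C0: (bound C0)
    show ?thesis
    proof (cases rule: multiplier_estimate[OF \<delta> \<beta>(2) m, where s = s1 and 'n = 'n, case_names bound])
      case C1: (bound C1)
        let ?C = "C0 * M0 + C1 * M1"
        have pos: "0 < C0 * M0" "0 < C1 * M1" using C0(1) C1(1) M by simp_all
        show ?thesis
        proof (intro exI[of _ ?C] conjI allI impI)
          show "0 < ?C" using pos by simp
          fix w0 w1 :: "real^'n \<Rightarrow> complex" and t :: real
          assume w: "in_Lp m w0 \<and> in_Hs s0 w0 \<and> in_Lp m w1 \<and> in_Hs s1 w1" and t: "0 \<le> t"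
          have M1t: "0 < M1 * (1 + t) powr e" using M t by simp
          have 0: "in_Lp 2 (\<lambda>\<xi>. P0 t \<xi> * fourier w0 \<xi>) \<and>
            Lp_norm 2 (\<lambda>\<xi>. P0 t \<xi> * fourier w0 \<xi>) \<le> C0 * M0 * (1 + t) powr decay_exponent CARD('n) \<delta> m \<beta>0 * Lm_Hs_norm m s0 w0"
            by (rule C0(2))
              (use w t M meas low0[OF t] high0[OF t] in \<open>auto simp: envelope_low_high[OF \<delta>]\<close>)
          have 1: "in_Lp 2 (\<lambda>\<xi>. P1 t \<xi> * fourier w1 \<xi>) \<and>
            Lp_norm 2 (\<lambda>\<xi>. P1 t \<xi> * fourier w1 \<xi>) \<le> C1 * (M1 * (1 + t) powr e) * (1 + t) powr decay_exponent CARD('n) \<delta> m \<beta>1 * Lm_Hs_norm m s1 w1"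
            by (rule C1(2))
              (use w t M1t meas low1[OF t] high1[OF t] in \<open>auto simp: envelope_low_high[OF \<delta>]\<close>)
          show "in_Lp 2 (\<lambda>\<xi>. P0 t \<xi> * fourier w0 \<xi> + P1 t \<xi> * fourier w1 \<xi>)"
            using 0 1 by (intro Lp_2_add) auto
          let ?A = "(1 + t) powr decay_exponent CARD('n) \<delta> m \<beta>0 * Lm_Hs_norm m s0 w0"
          let ?B = "(1 + t) powr (e - ?\<mu> - \<beta>1 / (2 * \<delta>)) * Lm_Hs_norm m s1 w1"
          have "(1 + t) powr e * (1 + t) powr decay_exponent CARD('n) \<delta> m \<beta>1 = (1 + t) powr (e - ?\<mu> - \<beta>1 / (2 * \<delta>))"
            unfolding powr_add[symmetric] by (rule arg_cong[where f = "\<lambda>x. (1 + t) powr x"]) simp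
          then have B: "C1 * (M1 * (1 + t) powr e) * (1 + t) powr decay_exponent CARD('n) \<delta> m \<beta>1 * Lm_Hs_norm m s1 w1 = C1 * M1 * ?B"
            by (metis (no_types, opaque_lifting) mult.assoc)
          have "Lp_norm 2 (\<lambda>\<xi>. P0 t \<xi> * fourier w0 \<xi> + P1 t \<xi> * fourier w1 \<xi>) \<le> C0 * M0 * ?A + C1 * M1 * ?B"
            using Lp_2_add(2)[OF conjunct1[OF 0] conjunct1[OF 1]] conjunct2[OF 0] conjunct2[OF 1]
            unfolding B by (simp only: mult.assoc)
          also have "\<dots> \<le> ?C * ?A + ?C * ?B"
            using pos by (intro add_mono mult_right_mono mult_nonneg_nonneg) (auto simp: Lm_Hs_norm_def Hs_norm_def)
          finally show "Lp_norm 2 (\<lambda>\<xi>. P0 t \<xi> * fourier w0 \<xi> + P1 t \<xi> * fourier w1 \<xi>) \<le> ?C * (?A + ?B)"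
            by (simp only: distrib_left)
        qed
    qed
  qed
qed

lemma in_Lp_2_of_in_Hs: "in_Hs s w \<Longrightarrow> in_Lp 2 w"
  by (simp add: in_Hs_def)

lemma in_Lp_2_mult_fourier:
  fixes w :: "real^'n \<Rightarrow> complex"
  assumes w: "in_Hs s w" and [measurable]: "P \<in> borel_measurable borel" and c: "0 \<le> c"
    and le: "\<And>\<xi>. norm (P \<xi>) \<le> c * (1 + (norm \<xi>)\<^sup>2) powr (s / 2)"
  shows "in_Lp 2 (\<lambda>\<xi>. P \<xi> * fourier w \<xi>)"
proof -
  have W: "in_Lp 2 (\<lambda>\<xi>. of_real ((1 + (norm \<xi>)\<^sup>2) powr (s / 2)) * fourier w \<xi>)" using w by (simp add: in_Hs_def)
  have [measurable]: "fourier w \<in> borel_measurable borel"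
    using is_fourier_in_Lp(2)[OF is_fourier_fourier[OF in_Lp_2_of_in_Hs[OF w]]] by (auto dest: in_Lp_measurable)
  show ?thesis
  proof (rule Lp_2_mono(1)[OF W _ c])
    show "AE \<xi> in lborel. norm (P \<xi> * fourier w \<xi>) \<le> c * norm (of_real ((1 + (norm \<xi>)\<^sup>2) powr (s / 2)) * fourier w \<xi>)"
      using mult_right_mono[OF le norm_ge_zero] by (auto simp: norm_mult mult.assoc)
  qed measurable
qed

context
  fixes \<sigma> \<delta> a :: real
  assumes \<sigma>\<delta>: "0 < \<delta>" "\<sigma> \<le> 2 * \<delta>" "\<delta> \<le> \<sigma>" and a: "0 \<le> a"
begin

abbreviation kernel_mult0 :: "real \<Rightarrow> real^'n \<Rightarrow> complex" where
  "kernel_mult0 t \<xi> \<equiv> of_real (norm \<xi> powr a) * kernel0 \<sigma> \<delta> t \<xi>"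

abbreviation kernel_mult1 :: "real \<Rightarrow> real^'n \<Rightarrow> complex" where
  "kernel_mult1 t \<xi> \<equiv> of_real (norm \<xi> powr a) * kernel1 \<sigma> \<delta> t \<xi>"

text \<open>The definition of the solution and of \<open>|D|\<^sup>a\<close> applies the Fourier transform to an inverse transform,
  which returns the multiplier only up to a null set.\<close>

lemma is_fourier_abs_D_solution:
  fixes w0 w1 :: "real^'n \<Rightarrow> complex"
  assumes w: "in_Lp 2 w0" "in_Lp 2 w1" and t: "0 \<le> t"
    and L2: "in_Lp 2 (\<lambda>\<xi>. kernel_mult0 t \<xi> * fourier w0 \<xi> + kernel_mult1 t \<xi> * fourier w1 \<xi>)"
  shows "is_fourier (abs_D a (solution \<sigma> \<delta> w0 w1 t)) (\<lambda>\<xi>. kernel_mult0 t \<xi> * fourier w0 \<xi> + kernel_mult1 t \<xi> * fourier w1 \<xi>)"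
proof -
  let ?w = "\<lambda>\<xi>. kernel0 \<sigma> \<delta> t \<xi> * fourier w0 \<xi> + kernel1 \<sigma> \<delta> t \<xi> * fourier w1 \<xi>"
  note f2 = is_fourier_in_Lp(2)[OF is_fourier_fourier[OF w(1)]] is_fourier_in_Lp(2)[OF is_fourier_fourier[OF w(2)]]
  have [measurable]: "fourier w0 \<in> borel_measurable borel" "fourier w1 \<in> borel_measurable borel"
    using f2 by (auto dest: in_Lp_measurable)
  have env: "0 \<le> envelope \<delta> t \<xi>" "envelope \<delta> t \<xi> \<le> 1" for \<xi> :: "real^'n"
    using envelope_le_1[OF t] by (auto simp: envelope_def)
  have "in_Lp 2 (\<lambda>\<xi>. kernel0 \<sigma> \<delta> t \<xi> * fourier w0 \<xi>)"
  proof (rule Lp_2_mono(1)[OF f2(1), of _ 6])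
    have "norm (kernel0 \<sigma> \<delta> t \<xi>) \<le> 6" for \<xi> :: "real^'n"
      using kernel_bounds(3)[OF \<sigma>\<delta> t, of \<xi>] env[of \<xi>] by linarith
    then show "AE \<xi> in lborel. norm (kernel0 \<sigma> \<delta> t \<xi> * fourier w0 \<xi>) \<le> 6 * norm (fourier w0 \<xi>)"
      by (auto simp: norm_mult intro!: mult_right_mono)
  qed auto
  moreover have "in_Lp 2 (\<lambda>\<xi>. kernel1 \<sigma> \<delta> t \<xi> * fourier w1 \<xi>)"
  proof (rule Lp_2_mono(1)[OF f2(2), of _ t])
    have "norm (kernel1 \<sigma> \<delta> t \<xi>) \<le> t" for \<xi> :: "real^'n"
      using kernel_bounds(1)[OF \<sigma>\<delta> t, of \<xi>] mult_left_mono[OF env(2)[of \<xi>] t] by linarith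
    then show "AE \<xi> in lborel. norm (kernel1 \<sigma> \<delta> t \<xi> * fourier w1 \<xi>) \<le> t * norm (fourier w1 \<xi>)"
      by (auto simp: norm_mult intro!: mult_right_mono)
  qed (use t in auto)
  ultimately have "in_Lp 2 ?w" by (rule Lp_2_add(1))
  then have sol: "is_fourier (solution \<sigma> \<delta> w0 w1 t) ?w"
    unfolding solution_def by (rule is_fourier_inv_fourier)
  from is_fourier_fourier[OF is_fourier_in_Lp(1)[OF sol]]
  have four: "is_fourier (solution \<sigma> \<delta> w0 w1 t) (fourier (solution \<sigma> \<delta> w0 w1 t))" .
  have [measurable]: "fourier (solution \<sigma> \<delta> w0 w1 t) \<in> borel_measurable borel"
    using is_fourier_in_Lp(2)[OF four] by (auto dest: in_Lp_measurable)
  have eq: "AE \<xi> in lborel. of_real (norm \<xi> powr a) * fourier (solution \<sigma> \<delta> w0 w1 t) \<xi>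
      = kernel_mult0 t \<xi> * fourier w0 \<xi> + kernel_mult1 t \<xi> * fourier w1 \<xi>"
    using is_fourier_unique[OF four sol] by eventually_elim (simp add: algebra_simps)
  have meas: "(\<lambda>\<xi>. of_real (norm \<xi> powr a) * fourier (solution \<sigma> \<delta> w0 w1 t) \<xi>) \<in> borel_measurable lborel"
    by measurable
  have "is_fourier (abs_D a (solution \<sigma> \<delta> w0 w1 t)) (\<lambda>\<xi>. of_real (norm \<xi> powr a) * fourier (solution \<sigma> \<delta> w0 w1 t) \<xi>)"
    unfolding abs_D_def by (rule is_fourier_inv_fourier[OF Lp_2_cong_AE(1)[OF L2 meas eq]])
  moreover have "AE \<xi> in lborel. kernel_mult0 t \<xi> * fourier w0 \<xi> + kernel_mult1 t \<xi> * fourier w1 \<xi>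
      = of_real (norm \<xi> powr a) * fourier (solution \<sigma> \<delta> w0 w1 t) \<xi>"
    using eq by eventually_elim simp
  ultimately show ?thesis
    by (rule is_fourier_cong_AE[OF _ in_Lp_measurable[OF L2]])
qed

text \<open>At low frequencies the second kernel is bounded by \<open>t\<close> times the envelope; this is where the extra
  power of \<open>1 + t\<close> comes from. At high frequencies it gains \<open>2\<delta>\<close> derivatives.\<close>

lemma solution_estimate:
  assumes m: "1 \<le> m" "m \<le> 2"
  shows "\<exists>C>0. \<forall>(w0 :: real^'n \<Rightarrow> complex) w1. in_Lp m w0 \<and> in_Hs a w0 \<and> in_Lp m w1 \<and> in_Hs (max (a - 2 * \<delta>) 0) w1 \<longrightarrow> (\<forall>t\<ge>0.
     in_Lp 2 (abs_D a (solution \<sigma> \<delta> w0 w1 t)) \<and>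
     Lp_norm 2 (abs_D a (solution \<sigma> \<delta> w0 w1 t))
       \<le> C * ((1 + t) powr decay_exponent CARD('n) \<delta> m a * Lm_Hs_norm m a w0
          + (1 + t) powr (1 - (real CARD('n) / (2 * \<delta>)) * (1 / m - 1 / 2) - a / (2 * \<delta>)) * Lm_Hs_norm m (max (a - 2 * \<delta>) 0) w1))"
proof -
  let ?s1 = "max (a - 2 * \<delta>) 0"
  have env: "0 \<le> envelope \<delta> t \<xi>" for t and \<xi> :: "real^'n" by (simp add: envelope_def)
  have 1: "norm (kernel_mult1 t \<xi>) \<le> 8 * (1 + t) powr 1 * (norm \<xi> powr a * envelope \<delta> t \<xi>)"
    if t: "0 \<le> t" for t and \<xi> :: "real^'n"
  proof -
    have "norm (kernel_mult1 t \<xi>) = norm \<xi> powr a * norm (kernel1 \<sigma> \<delta> t \<xi>)" by (simp add: norm_mult)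
    also have "\<dots> \<le> norm \<xi> powr a * (t * envelope \<delta> t \<xi>)" by (intro mult_left_mono kernel_bounds \<sigma>\<delta> t) simp
    also have "\<dots> = t * (norm \<xi> powr a * envelope \<delta> t \<xi>)" by simp
    also have "\<dots> \<le> 8 * (1 + t) powr 1 * (norm \<xi> powr a * envelope \<delta> t \<xi>)"
      using t env by (intro mult_right_mono) auto
    finally show ?thesis .
  qed
  have 2: "norm (kernel_mult1 t \<xi>) \<le> 8 * (1 + t) powr 1 * ((1 + (norm \<xi>)\<^sup>2) powr (?s1 / 2) * envelope \<delta> t \<xi>)"
    if t: "0 \<le> t" and \<xi>: "1 < norm \<xi>" for t and \<xi> :: "real^'n"
  proof -
    have "norm (kernel_mult1 t \<xi>) = norm \<xi> powr (a - 2 * \<delta>) * (norm \<xi> powr (2 * \<delta>) * norm (kernel1 \<sigma> \<delta> t \<xi>))"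
      by (simp add: norm_mult mult.assoc[symmetric] flip: powr_add)
    also have "\<dots> \<le> norm \<xi> powr (a - 2 * \<delta>) * (8 * envelope \<delta> t \<xi>)" by (intro mult_left_mono kernel_bounds \<sigma>\<delta> t) simp
    also have "\<dots> \<le> (1 + (norm \<xi>)\<^sup>2) powr (?s1 / 2) * (8 * envelope \<delta> t \<xi>)"
      using env by (intro mult_right_mono powr_le_bessel_weight \<xi>) auto
    also have "\<dots> = 1 * (8 * ((1 + (norm \<xi>)\<^sup>2) powr (?s1 / 2) * envelope \<delta> t \<xi>))" by simp
    also have "\<dots> \<le> (1 + t) * (8 * ((1 + (norm \<xi>)\<^sup>2) powr (?s1 / 2) * envelope \<delta> t \<xi>))"
      using t env by (intro mult_right_mono) auto
    finally show ?thesis using t by (simp add: algebra_simps)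
  qed
  have 3: "norm (kernel_mult0 t \<xi>) \<le> 6 * (norm \<xi> powr a * envelope \<delta> t \<xi>)"
    if t: "0 \<le> t" for t and \<xi> :: "real^'n"
    using mult_left_mono[OF kernel_bounds(3)[OF \<sigma>\<delta> t, of \<xi>], of "norm \<xi> powr a"] by (simp add: norm_mult mult_ac)
  have 4: "norm (kernel_mult0 t \<xi>) \<le> 6 * ((1 + (norm \<xi>)\<^sup>2) powr (a / 2) * envelope \<delta> t \<xi>)"
    if t: "0 \<le> t" and \<xi>: "1 < norm \<xi>" for t and \<xi> :: "real^'n"
    using mult_right_mono[OF powr_le_bessel_weight[OF \<xi> order_refl a] env[of t \<xi>]] 3[OF t, of \<xi>] by linarith
  have "\<exists>C>0. \<forall>(w0 :: real^'n \<Rightarrow> complex) w1. in_Lp m w0 \<and> in_Hs a w0 \<and> in_Lp m w1 \<and> in_Hs ?s1 w1 \<longrightarrow> (\<forall>t\<ge>0.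
     in_Lp 2 (\<lambda>\<xi>. kernel_mult0 t \<xi> * fourier w0 \<xi> + kernel_mult1 t \<xi> * fourier w1 \<xi>) \<and>
     Lp_norm 2 (\<lambda>\<xi>. kernel_mult0 t \<xi> * fourier w0 \<xi> + kernel_mult1 t \<xi> * fourier w1 \<xi>)
       \<le> C * ((1 + t) powr decay_exponent CARD('n) \<delta> m a * Lm_Hs_norm m a w0
          + (1 + t) powr (1 - (real CARD('n) / (2 * \<delta>)) * (1 / m - 1 / 2) - a / (2 * \<delta>)) * Lm_Hs_norm m ?s1 w1))" (is "\<exists>C>0. ?Q C")
  proof -
    have "(\<lambda>\<xi>. kernel_mult0 t \<xi>) \<in> borel_measurable borel" "(\<lambda>\<xi>. kernel_mult1 t \<xi>) \<in> borel_measurable borel" for t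
      by measurable
    from two_multiplier_estimate[OF \<sigma>\<delta>(1) a a m _ _ this, of 6 8, OF _ _ 3 4 1 2]
    show ?thesis by auto
  qed
  then obtain C where C: "0 < C" and est: "?Q C" by blast
  show ?thesis
  proof (intro exI[of _ C] conjI allI impI C)
    fix w0 w1 :: "real^'n \<Rightarrow> complex" and t :: real
    assume w: "in_Lp m w0 \<and> in_Hs a w0 \<and> in_Lp m w1 \<and> in_Hs ?s1 w1" and t: "0 \<le> t"
    have w2: "in_Lp 2 w0" "in_Lp 2 w1" using w by (auto intro: in_Lp_2_of_in_Hs)
    note e = est[rule_format, OF w t]
    note F = is_fourier_abs_D_solution[OF w2 t conjunct1[OF e]]
    show "in_Lp 2 (abs_D a (solution \<sigma> \<delta> w0 w1 t))" by (rule is_fourier_in_Lp(1)[OF F])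
    show "Lp_norm 2 (abs_D a (solution \<sigma> \<delta> w0 w1 t))
       \<le> C * ((1 + t) powr decay_exponent CARD('n) \<delta> m a * Lm_Hs_norm m a w0
          + (1 + t) powr (1 - (real CARD('n) / (2 * \<delta>)) * (1 / m - 1 / 2) - a / (2 * \<delta>)) * Lm_Hs_norm m ?s1 w1)"
      unfolding plancherel[OF F, symmetric] by (rule conjunct2[OF e])
  qed
qed

abbreviation dkernel_mult0 :: "real \<Rightarrow> real^'n \<Rightarrow> complex" where
  "dkernel_mult0 t \<xi> \<equiv> of_real (norm \<xi> powr a) * dkernel0 \<sigma> \<delta> t \<xi>"

abbreviation dkernel_mult1 :: "real \<Rightarrow> real^'n \<Rightarrow> complex" where
  "dkernel_mult1 t \<xi> \<equiv> of_real (norm \<xi> powr a) * dkernel1 \<sigma> \<delta> t \<xi>"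

lemma weight_ge_1: "0 \<le> s \<Longrightarrow> 1 \<le> (1 + (norm \<xi>)\<^sup>2) powr (s / 2)"
  by (rule ge_one_powr_ge_zero) auto

lemma powr_le_weight:
  assumes "0 \<le> x" "x \<le> s"
  shows "norm \<xi> powr x \<le> (1 + (norm \<xi>)\<^sup>2) powr (s / 2)"
proof (cases "norm \<xi> \<le> 1")
  case True
  then have "norm \<xi> powr x \<le> 1 powr x" using assms by (intro powr_mono2) auto
  with weight_ge_1[of s \<xi>] assms show ?thesis by simp
next
  case False
  then show ?thesis using assms by (intro powr_le_bessel_weight) auto
qed

lemma dkernel_mult_bounds:
  fixes \<xi> :: "real^'n"
  assumes t: "0 \<le> t"
  shows "norm (dkernel_mult0 t \<xi>) \<le> 8 * (norm \<xi> powr (a + \<sigma>) * envelope \<delta> t \<xi>)"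
    and "1 < norm \<xi> \<Longrightarrow> norm (dkernel_mult0 t \<xi>) \<le> 8 * ((1 + (norm \<xi>)\<^sup>2) powr ((a + 2 * (\<sigma> - \<delta>)) / 2) * envelope \<delta> t \<xi>)"
    and "norm (dkernel_mult1 t \<xi>) \<le> 14 * (norm \<xi> powr a * envelope \<delta> t \<xi>)"
    and "norm (dkernel_mult0 t \<xi>) \<le> 8 * (1 + (norm \<xi>)\<^sup>2) powr ((a + 2 * (\<sigma> - \<delta>)) / 2)"
    and "norm (dkernel_mult1 t \<xi>) \<le> 14 * (1 + (norm \<xi>)\<^sup>2) powr (a / 2)"
proof -
  have env: "0 \<le> envelope \<delta> t \<xi>" "envelope \<delta> t \<xi> \<le> 1" using envelope_le_1[OF t] by (auto simp: envelope_def)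
  show low: "norm (dkernel_mult0 t \<xi>) \<le> 8 * (norm \<xi> powr (a + \<sigma>) * envelope \<delta> t \<xi>)"
    using mult_left_mono[OF kernel_bounds(5)[OF \<sigma>\<delta> t, of \<xi>], of "norm \<xi> powr a"] by (simp add: norm_mult powr_add mult_ac)
  show high: "norm (dkernel_mult0 t \<xi>) \<le> 8 * ((1 + (norm \<xi>)\<^sup>2) powr ((a + 2 * (\<sigma> - \<delta>)) / 2) * envelope \<delta> t \<xi>)"
    if \<xi>: "1 < norm \<xi>"
  proof -
    have "norm (dkernel_mult0 t \<xi>) \<le> norm \<xi> powr a * (8 * norm \<xi> powr (2 * (\<sigma> - \<delta>)) * envelope \<delta> t \<xi>)"
      using mult_left_mono[OF dkernel0_bound_high[OF \<sigma>\<delta> t, of \<xi>], of "norm \<xi> powr a"] by (simp add: norm_mult)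
    also have "\<dots> = 8 * (norm \<xi> powr (a + 2 * (\<sigma> - \<delta>)) * envelope \<delta> t \<xi>)" by (simp add: powr_add mult_ac)
    also have "\<dots> \<le> 8 * ((1 + (norm \<xi>)\<^sup>2) powr ((a + 2 * (\<sigma> - \<delta>)) / 2) * envelope \<delta> t \<xi>)"
      using env a \<sigma>\<delta> by (intro mult_left_mono mult_right_mono powr_le_bessel_weight \<xi>) auto
    finally show ?thesis .
  qed
  show 1: "norm (dkernel_mult1 t \<xi>) \<le> 14 * (norm \<xi> powr a * envelope \<delta> t \<xi>)"
    using mult_left_mono[OF kernel_bounds(4)[OF \<sigma>\<delta> t, of \<xi>], of "norm \<xi> powr a"] by (simp add: norm_mult mult_ac)
  let ?w = "(1 + (norm \<xi>)\<^sup>2) powr ((a + 2 * (\<sigma> - \<delta>)) / 2)"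
  show "norm (dkernel_mult0 t \<xi>) \<le> 8 * ?w"
  proof (cases "1 < norm \<xi>")
    case True
    have "?w * envelope \<delta> t \<xi> \<le> ?w" using env by (intro mult_left_le) auto
    with high[OF True] show ?thesis by linarith
  next
    case False
    have "norm \<xi> powr (a + \<sigma>) \<le> 1 powr (a + \<sigma>)" using False a \<sigma>\<delta> by (intro powr_mono2) auto
    then have "norm \<xi> powr (a + \<sigma>) * envelope \<delta> t \<xi> \<le> 1 * 1" using env by (intro mult_mono) auto
    moreover have "1 \<le> ?w" using a \<sigma>\<delta> by (intro weight_ge_1) auto
    ultimately show ?thesis using low by linarith
  qed
  have "norm \<xi> powr a * envelope \<delta> t \<xi> \<le> (1 + (norm \<xi>)\<^sup>2) powr (a / 2) * 1"
    using env a by (intro mult_mono powr_le_weight) auto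
  with 1 show "norm (dkernel_mult1 t \<xi>) \<le> 14 * (1 + (norm \<xi>)\<^sup>2) powr (a / 2)" by linarith
qed

text \<open>The bounds on the derivatives of the kernels hold for all times at once, so that the curve of transforms
  is Lipschitz with the square integrable constant that dominated convergence requires.\<close>

lemma has_L2_deriv_solution:
  fixes w0 w1 :: "real^'n \<Rightarrow> complex"
  assumes w0: "in_Hs (a + 2 * (\<sigma> - \<delta>)) w0" and w1: "in_Hs a w1" and t: "0 \<le> t"
  defines "V \<equiv> \<lambda>\<xi>. dkernel_mult0 t \<xi> * fourier w0 \<xi> + dkernel_mult1 t \<xi> * fourier w1 \<xi>"
  shows "in_Lp 2 V" "has_L2_deriv (\<lambda>s. abs_D a (solution \<sigma> \<delta> w0 w1 s)) (inv_fourier V) t"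
    and "\<And>s. 0 \<le> s \<Longrightarrow> in_Lp 2 (abs_D a (solution \<sigma> \<delta> w0 w1 s))"
proof -
  let ?s0 = "a + 2 * (\<sigma> - \<delta>)"
  let ?U = "\<lambda>s \<xi>. kernel_mult0 s \<xi> * fourier w0 \<xi> + kernel_mult1 s \<xi> * fourier w1 \<xi>"
  have meas: "(\<lambda>\<xi>::real^'n. kernel_mult0 s \<xi>) \<in> borel_measurable borel" "(\<lambda>\<xi>::real^'n. kernel_mult1 s \<xi>) \<in> borel_measurable borel"
    "(\<lambda>\<xi>::real^'n. dkernel_mult0 s \<xi>) \<in> borel_measurable borel" "(\<lambda>\<xi>::real^'n. dkernel_mult1 s \<xi>) \<in> borel_measurable borel" for s
    by measurable
  have U2: "in_Lp 2 (?U s)" if s: "0 \<le> s" for s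
  proof (rule Lp_2_add(1))
    have env: "0 \<le> envelope \<delta> s \<xi>" "envelope \<delta> s \<xi> \<le> 1" for \<xi> :: "real^'n"
      using envelope_le_1[OF s] by (auto simp: envelope_def)
    show "in_Lp 2 (\<lambda>\<xi>. kernel_mult0 s \<xi> * fourier w0 \<xi>)"
    proof (rule in_Lp_2_mult_fourier[OF w0 meas(1), of 6])
      fix \<xi> :: "real^'n"
      have "norm (kernel0 \<sigma> \<delta> s \<xi>) \<le> 6" using kernel_bounds(3)[OF \<sigma>\<delta> s, of \<xi>] env[of \<xi>] by linarith
      moreover have "norm \<xi> powr a \<le> (1 + (norm \<xi>)\<^sup>2) powr (?s0 / 2)" using a \<sigma>\<delta> by (intro powr_le_weight) auto
      ultimately have "norm \<xi> powr a * norm (kernel0 \<sigma> \<delta> s \<xi>) \<le> (1 + (norm \<xi>)\<^sup>2) powr (?s0 / 2) * 6"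
        by (intro mult_mono) auto
      then show "norm (kernel_mult0 s \<xi>) \<le> 6 * (1 + (norm \<xi>)\<^sup>2) powr (?s0 / 2)" by (simp add: norm_mult)
    qed simp
    show "in_Lp 2 (\<lambda>\<xi>. kernel_mult1 s \<xi> * fourier w1 \<xi>)"
    proof (rule in_Lp_2_mult_fourier[OF w1 meas(2) s])
      fix \<xi> :: "real^'n"
      have "norm (kernel1 \<sigma> \<delta> s \<xi>) \<le> s"
        using kernel_bounds(1)[OF \<sigma>\<delta> s, of \<xi>] mult_left_mono[OF env(2)[of \<xi>] s] by linarith
      moreover have "norm \<xi> powr a \<le> (1 + (norm \<xi>)\<^sup>2) powr (a / 2)" using a by (intro powr_le_weight) auto
      ultimately have "norm \<xi> powr a * norm (kernel1 \<sigma> \<delta> s \<xi>) \<le> (1 + (norm \<xi>)\<^sup>2) powr (a / 2) * s"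
        by (intro mult_mono) auto
      then show "norm (kernel_mult1 s \<xi>) \<le> s * (1 + (norm \<xi>)\<^sup>2) powr (a / 2)" by (simp add: norm_mult mult.commute)
    qed
  qed
  have F: "is_fourier (abs_D a (solution \<sigma> \<delta> w0 w1 s)) (?U s)" if s: "0 \<le> s" for s
    by (rule is_fourier_abs_D_solution[OF in_Lp_2_of_in_Hs[OF w0] in_Lp_2_of_in_Hs[OF w1] s U2[OF s]])
  show "in_Lp 2 (abs_D a (solution \<sigma> \<delta> w0 w1 s))" if "0 \<le> s" for s
    by (rule is_fourier_in_Lp(1)[OF F[OF that]])
  show V2: "in_Lp 2 V" unfolding V_def
    by (intro Lp_2_add in_Lp_2_mult_fourier[OF w0, of _ 8] in_Lp_2_mult_fourier[OF w1, of _ 14] meas dkernel_mult_bounds t) auto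
  define A0 where "A0 \<xi> = of_real (8 * (1 + (norm \<xi>)\<^sup>2) powr (?s0 / 2)) * fourier w0 \<xi>" for \<xi>
  define A1 where "A1 \<xi> = of_real (14 * (1 + (norm \<xi>)\<^sup>2) powr (a / 2)) * fourier w1 \<xi>" for \<xi>
  let ?W = "\<lambda>\<xi>. complex_of_real (norm (A0 \<xi>)) + complex_of_real (norm (A1 \<xi>))"
  have W_norm: "norm (?W \<xi>) = norm (A0 \<xi>) + norm (A1 \<xi>)" for \<xi> by (simp flip: of_real_add)
  have "in_Lp 2 A0" unfolding A0_def by (rule in_Lp_2_mult_fourier[OF w0, of _ 8]) auto
  moreover have "in_Lp 2 A1" unfolding A1_def by (rule in_Lp_2_mult_fourier[OF w1, of _ 14]) auto
  ultimately have W: "in_Lp 2 ?W" by (intro Lp_2_add Lp_2_of_norm)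
  have deriv: "((\<lambda>s. ?U s \<xi>) has_vector_derivative dkernel_mult0 s \<xi> * fourier w0 \<xi> + dkernel_mult1 s \<xi> * fourier w1 \<xi>) (at s within S)" for s S \<xi>
    by (intro has_vector_derivative_add has_vector_derivative_mult_left has_vector_derivative_mult_right kernel_deriv \<sigma>\<delta>)
  show "has_L2_deriv (\<lambda>s. abs_D a (solution \<sigma> \<delta> w0 w1 s)) (inv_fourier V) t"
  proof (rule has_L2_deriv_fourier[OF F is_fourier_inv_fourier[OF V2] W t])
    show "((\<lambda>s. ?U s \<xi>) has_vector_derivative V \<xi>) (at t within {0..})" for \<xi>
      unfolding V_def by (rule deriv)
    show "norm (?U s \<xi> - ?U t \<xi>) \<le> \<bar>s - t\<bar> * norm (?W \<xi>)" if s: "0 \<le> s" for s \<xi>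
    proof (rule lipschitz_of_vector_derivative[where S = "{0..}", OF _ _ _ _ deriv])
      fix r :: real assume "r \<in> {0..}"
      then have r: "0 \<le> r" by simp
      have "norm (dkernel_mult0 r \<xi> * fourier w0 \<xi>) \<le> norm (A0 \<xi>)"
        using mult_right_mono[OF dkernel_mult_bounds(4)[OF r, of \<xi>] norm_ge_zero[of "fourier w0 \<xi>"]]
        by (simp add: A0_def norm_mult)
      moreover have "norm (dkernel_mult1 r \<xi> * fourier w1 \<xi>) \<le> norm (A1 \<xi>)"
        using mult_right_mono[OF dkernel_mult_bounds(5)[OF r, of \<xi>] norm_ge_zero[of "fourier w1 \<xi>"]]
        by (simp add: A1_def norm_mult)
      ultimately show "norm (dkernel_mult0 r \<xi> * fourier w0 \<xi> + dkernel_mult1 r \<xi> * fourier w1 \<xi>) \<le> norm (?W \<xi>)"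
        unfolding W_norm by (rule norm_triangle_mono)
    qed (use s t in auto)
  qed
qed

lemma solution_deriv_estimate:
  assumes m: "1 \<le> m" "m \<le> 2"
  shows "\<exists>C>0. \<forall>(w0 :: real^'n \<Rightarrow> complex) w1. in_Lp m w0 \<and> in_Hs (a + 2 * (\<sigma> - \<delta>)) w0 \<and> in_Lp m w1 \<and> in_Hs a w1 \<longrightarrow> (\<forall>t\<ge>0.
     in_Lp 2 (L2_deriv (\<lambda>s. abs_D a (solution \<sigma> \<delta> w0 w1 s)) t) \<and>
     Lp_norm 2 (L2_deriv (\<lambda>s. abs_D a (solution \<sigma> \<delta> w0 w1 s)) t)
       \<le> C * ((1 + t) powr decay_exponent CARD('n) \<delta> m (a + \<sigma>) * Lm_Hs_norm m (a + 2 * (\<sigma> - \<delta>)) w0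
          + (1 + t) powr (1 - (real CARD('n) / (2 * \<delta>)) * (1 / m - 1 / 2) - (a + \<sigma>) / (2 * \<delta>)) * Lm_Hs_norm m a w1))"
proof -
  let ?s0 = "a + 2 * (\<sigma> - \<delta>)" and ?e = "1 - \<sigma> / (2 * \<delta>)"
  have e: "0 \<le> ?e" using \<sigma>\<delta> by simp
  have env: "0 \<le> envelope \<delta> t \<xi>" for t and \<xi> :: "real^'n" by (simp add: envelope_def)
  \<comment> \<open>The first time derivative of the second kernel decays faster than required; the surplus is the
    factor \<open>(1 + t)\<^bsup>1 - \<sigma>/(2\<delta>)\<^esup> \<ge> 1\<close>.\<close>
  have grow: "14 * x \<le> 14 * (1 + t) powr ?e * x" if "0 \<le> t" "0 \<le> x" for t x :: real
    using ge_one_powr_ge_zero[of "1 + t" ?e] e that mult_right_mono[of 1 "(1 + t) powr ?e" x] by auto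
  have 1: "norm (dkernel_mult1 t \<xi>) \<le> 14 * (1 + t) powr ?e * (norm \<xi> powr a * envelope \<delta> t \<xi>)"
    if t: "0 \<le> t" for t and \<xi> :: "real^'n"
    by (rule order_trans[OF dkernel_mult_bounds(3)[OF t] grow[OF t]]) (use env in simp)
  have 2: "norm (dkernel_mult1 t \<xi>) \<le> 14 * (1 + t) powr ?e * ((1 + (norm \<xi>)\<^sup>2) powr (a / 2) * envelope \<delta> t \<xi>)"
    if t: "0 \<le> t" and \<xi>: "1 < norm \<xi>" for t and \<xi> :: "real^'n"
    by (rule order_trans[OF 1[OF t] mult_left_mono[OF mult_right_mono[OF powr_le_bessel_weight[OF \<xi> order_refl a] env]]]) simp
  have "\<exists>C>0. \<forall>(w0 :: real^'n \<Rightarrow> complex) w1. in_Lp m w0 \<and> in_Hs ?s0 w0 \<and> in_Lp m w1 \<and> in_Hs a w1 \<longrightarrow> (\<forall>t\<ge>0.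
     in_Lp 2 (\<lambda>\<xi>. dkernel_mult0 t \<xi> * fourier w0 \<xi> + dkernel_mult1 t \<xi> * fourier w1 \<xi>) \<and>
     Lp_norm 2 (\<lambda>\<xi>. dkernel_mult0 t \<xi> * fourier w0 \<xi> + dkernel_mult1 t \<xi> * fourier w1 \<xi>)
       \<le> C * ((1 + t) powr decay_exponent CARD('n) \<delta> m (a + \<sigma>) * Lm_Hs_norm m ?s0 w0
          + (1 + t) powr (?e - (real CARD('n) / (2 * \<delta>)) * (1 / m - 1 / 2) - a / (2 * \<delta>)) * Lm_Hs_norm m a w1))" (is "\<exists>C>0. ?Q C")
  proof -
    have meas: "(\<lambda>\<xi>. dkernel_mult0 t \<xi>) \<in> borel_measurable borel" "(\<lambda>\<xi>. dkernel_mult1 t \<xi>) \<in> borel_measurable borel" for t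
      by measurable
    have "0 \<le> a + \<sigma>" using a \<sigma>\<delta> by simp
    from two_multiplier_estimate[OF \<sigma>\<delta>(1) this a m _ _ meas, of 8 14, OF _ _ dkernel_mult_bounds(1,2) 1 2]
    show ?thesis by auto
  qed
  then obtain C where C: "0 < C" and est: "?Q C" by blast
  have exponent: "?e - x - a / (2 * \<delta>) = 1 - x - (a + \<sigma>) / (2 * \<delta>)" for x
    by (simp add: add_divide_distrib)
  show ?thesis
  proof (intro exI[of _ C] conjI allI impI C)
    fix w0 w1 :: "real^'n \<Rightarrow> complex" and t :: real
    assume w: "in_Lp m w0 \<and> in_Hs ?s0 w0 \<and> in_Lp m w1 \<and> in_Hs a w1" and t: "0 \<le> t"
    then have w0: "in_Hs ?s0 w0" and w1: "in_Hs a w1" by auto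
    note D = has_L2_deriv_solution[OF w0 w1 t]
    note N = L2_deriv_norm[OF D(3) t D(2)]
    show "in_Lp 2 (L2_deriv (\<lambda>s. abs_D a (solution \<sigma> \<delta> w0 w1 s)) t)" by (rule N(1))
    show "Lp_norm 2 (L2_deriv (\<lambda>s. abs_D a (solution \<sigma> \<delta> w0 w1 s)) t)
       \<le> C * ((1 + t) powr decay_exponent CARD('n) \<delta> m (a + \<sigma>) * Lm_Hs_norm m ?s0 w0
          + (1 + t) powr (1 - (real CARD('n) / (2 * \<delta>)) * (1 / m - 1 / 2) - (a + \<sigma>) / (2 * \<delta>)) * Lm_Hs_norm m a w1)"
    proof -
      have "Lp_norm 2 (L2_deriv (\<lambda>s. abs_D a (solution \<sigma> \<delta> w0 w1 s)) t)
          = Lp_norm 2 (\<lambda>\<xi>. dkernel_mult0 t \<xi> * fourier w0 \<xi> + dkernel_mult1 t \<xi> * fourier w1 \<xi>)"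
        by (rule trans[OF N(2) plancherel[OF is_fourier_inv_fourier[OF D(1)], symmetric]])
      with conjunct2[OF est[rule_format, OF w t]] show ?thesis by (simp only: exponent)
    qed
  qed
qed

end

lemma time_deriv_simps: "time_deriv 0 u = u" "time_deriv 1 u = L2_deriv u" "time_deriv (Suc 0) u = L2_deriv u"
  by (simp_all add: time_deriv_def)

text \<open>The exponent \<open>m = 2\<close> is included; it is the estimate without additional integrability of the data.\<close>

lemma decay_estimate:
  fixes \<sigma> \<delta> m a :: real and j :: nat
  assumes \<sigma>\<delta>: "0 < \<delta>" "\<sigma> \<le> 2 * \<delta>" "\<delta> \<le> \<sigma>" and m: "1 \<le> m" "m \<le> 2" and a: "0 \<le> a" and j: "j \<in> {0, 1}"
  shows "\<exists>C>0. \<forall>w0 w1 :: real^'n \<Rightarrow> complex.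
        in_Lp m w0 \<and> in_Hs (a + 2 * real j * (\<sigma> - \<delta>)) w0 \<and>
        in_Lp m w1 \<and> in_Hs (max (a + 2 * (real j - 1) * \<delta>) 0) w1 \<longrightarrow>
        (\<forall>t\<ge>0.
          in_Lp 2 (time_deriv j (\<lambda>s. abs_D a (solution \<sigma> \<delta> w0 w1 s)) t) \<and>
          Lp_norm 2 (time_deriv j (\<lambda>s. abs_D a (solution \<sigma> \<delta> w0 w1 s)) t) \<le>
            C * ((1 + t) powr (- (real CARD('n) / (2 * \<delta>)) * (1 / m - 1 / 2)
                    - (a + real j * \<sigma>) / (2 * \<delta>))
                  * Lm_Hs_norm m (a + 2 * real j * (\<sigma> - \<delta>)) w0
               + (1 + t) powr (1 - (real CARD('n) / (2 * \<delta>)) * (1 / m - 1 / 2)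
                    - (a + real j * \<sigma>) / (2 * \<delta>))
                  * Lm_Hs_norm m (max (a + 2 * (real j - 1) * \<delta>) 0) w1))"
proof (cases "j = 0")
  case True
  have "a + 2 * real j * (\<sigma> - \<delta>) = a" "max (a + 2 * (real j - 1) * \<delta>) 0 = max (a - 2 * \<delta>) 0" "a + real j * \<sigma> = a"
    using True by simp_all
  then show ?thesis
    using solution_estimate[OF \<sigma>\<delta> a m, where 'n = 'n] True by (simp only: time_deriv_simps)
next
  case False
  then have j: "j = 1" using j by auto
  have "a + 2 * real j * (\<sigma> - \<delta>) = a + 2 * (\<sigma> - \<delta>)" "max (a + 2 * (real j - 1) * \<delta>) 0 = a" "a + real j * \<sigma> = a + \<sigma>"
    using j a by simp_all
  then show ?thesis
    using solution_deriv_estimate[OF \<sigma>\<delta> a m, where 'n = 'n] j by (simp only: time_deriv_simps)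
qed

lemma Lm_Hs_norm_2_le:
  assumes s: "0 \<le> s" and w: "in_Hs s w"
  shows "Lm_Hs_norm 2 s w \<le> 2 * Hs_norm s w"
proof -
  have F: "is_fourier w (fourier w)" by (rule is_fourier_fourier[OF in_Lp_2_of_in_Hs[OF w]])
  have "AE \<xi> in lborel. norm (fourier w \<xi>) \<le> 1 * norm (of_real ((1 + (norm \<xi>)\<^sup>2) powr (s / 2)) * fourier w \<xi>)"
  proof (intro AE_I2)
    fix \<xi>
    have "1 * norm (fourier w \<xi>) \<le> (1 + (norm \<xi>)\<^sup>2) powr (s / 2) * norm (fourier w \<xi>)"
      by (intro mult_right_mono ge_one_powr_ge_zero) (use s in auto)
    then show "norm (fourier w \<xi>) \<le> 1 * norm (of_real ((1 + (norm \<xi>)\<^sup>2) powr (s / 2)) * fourier w \<xi>)"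
      by (simp add: norm_mult)
  qed
  from Lp_2_mono(2)[OF _ in_Lp_measurable[OF is_fourier_in_Lp(2)[OF F]] _ this] w
  have "Lp_norm 2 (fourier w) \<le> Hs_norm s w" by (simp add: in_Hs_def Hs_norm_def)
  then show ?thesis using plancherel[OF F] by (simp add: Lm_Hs_norm_def)
qed

theorem proposition2p4:
  fixes \<sigma> \<delta> m a :: real and j :: nat
  assumes "\<sigma> \<ge> 1" and "\<sigma> / 2 < \<delta>" and "\<delta> < \<sigma>" and "1 \<le> m" and "m < 2"
    and "a \<ge> 0" and "j \<in> {0, 1}"
  shows
    "(\<exists>C>0. \<forall>w0 w1 :: real^'n \<Rightarrow> complex.
        in_Lp m w0 \<and> in_Hs (a + 2 * real j * (\<sigma> - \<delta>)) w0 \<and>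
        in_Lp m w1 \<and> in_Hs (max (a + 2 * (real j - 1) * \<delta>) 0) w1 \<longrightarrow>
        (\<forall>t\<ge>0.
          in_Lp 2 (time_deriv j (\<lambda>s. abs_D a (solution \<sigma> \<delta> w0 w1 s)) t) \<and>
          Lp_norm 2 (time_deriv j (\<lambda>s. abs_D a (solution \<sigma> \<delta> w0 w1 s)) t) \<le>
            C * ((1 + t) powr (- (real CARD('n) / (2 * \<delta>)) * (1 / m - 1 / 2)
                    - (a + real j * \<sigma>) / (2 * \<delta>))
                  * Lm_Hs_norm m (a + 2 * real j * (\<sigma> - \<delta>)) w0
               + (1 + t) powr (1 - (real CARD('n) / (2 * \<delta>)) * (1 / m - 1 / 2)
                    - (a + real j * \<sigma>) / (2 * \<delta>))
                  * Lm_Hs_norm m (max (a + 2 * (real j - 1) * \<delta>) 0) w1)))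
     \<and>
     (\<exists>C>0. \<forall>w0 w1 :: real^'n \<Rightarrow> complex.
        in_Hs (a + 2 * real j * (\<sigma> - \<delta>)) w0 \<and>
        in_Hs (max (a + 2 * (real j - 1) * \<delta>) 0) w1 \<longrightarrow>
        (\<forall>t\<ge>0.
          in_Lp 2 (time_deriv j (\<lambda>s. abs_D a (solution \<sigma> \<delta> w0 w1 s)) t) \<and>
          Lp_norm 2 (time_deriv j (\<lambda>s. abs_D a (solution \<sigma> \<delta> w0 w1 s)) t) \<le>
            C * ((1 + t) powr (- (a + real j * \<sigma>) / (2 * \<delta>))
                  * Hs_norm (a + 2 * real j * (\<sigma> - \<delta>)) w0
               + (1 + t) powr (1 - (a + real j * \<sigma>) / (2 * \<delta>))
                  * Hs_norm (max (a + 2 * (real j - 1) * \<delta>) 0) w1)))"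
proof -
  let ?N0 = "Hs_norm (a + 2 * real j * (\<sigma> - \<delta>))" and ?N1 = "Hs_norm (max (a + 2 * (real j - 1) * \<delta>) 0)"
  have \<sigma>\<delta>: "0 < \<delta>" "\<sigma> \<le> 2 * \<delta>" "\<delta> \<le> \<sigma>" using assms by auto
  have s0: "0 \<le> a + 2 * real j * (\<sigma> - \<delta>)" using assms by simp
  show ?thesis (is "?P \<and> ?Q")
  proof
    show ?P using decay_estimate[OF \<sigma>\<delta> assms(4) less_imp_le[OF assms(5)] assms(6,7), where 'n = 'n] .
    obtain C where C: "0 < C" and est: "\<forall>w0 w1 :: real^'n \<Rightarrow> complex.
        in_Lp 2 w0 \<and> in_Hs (a + 2 * real j * (\<sigma> - \<delta>)) w0 \<and>
        in_Lp 2 w1 \<and> in_Hs (max (a + 2 * (real j - 1) * \<delta>) 0) w1 \<longrightarrow>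
        (\<forall>t\<ge>0.
          in_Lp 2 (time_deriv j (\<lambda>s. abs_D a (solution \<sigma> \<delta> w0 w1 s)) t) \<and>
          Lp_norm 2 (time_deriv j (\<lambda>s. abs_D a (solution \<sigma> \<delta> w0 w1 s)) t) \<le>
            C * ((1 + t) powr (- (real CARD('n) / (2 * \<delta>)) * (1 / 2 - 1 / 2)
                    - (a + real j * \<sigma>) / (2 * \<delta>))
                  * Lm_Hs_norm 2 (a + 2 * real j * (\<sigma> - \<delta>)) w0
               + (1 + t) powr (1 - (real CARD('n) / (2 * \<delta>)) * (1 / 2 - 1 / 2)
                    - (a + real j * \<sigma>) / (2 * \<delta>))
                  * Lm_Hs_norm 2 (max (a + 2 * (real j - 1) * \<delta>) 0) w1))"
      using decay_estimate[OF \<sigma>\<delta> _ _ assms(6,7), of 2, where 'n = 'n]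
      by (elim meta_impE exE conjE) (simp, simp, rule that, assumption+)
    show ?Q
    proof (intro exI[of _ "2 * C"] conjI allI impI)
      show "0 < 2 * C" using C by simp
      fix w0 w1 :: "real^'n \<Rightarrow> complex" and t :: real
      assume w: "in_Hs (a + 2 * real j * (\<sigma> - \<delta>)) w0 \<and> in_Hs (max (a + 2 * (real j - 1) * \<delta>) 0) w1" and t: "0 \<le> t"
      have w': "in_Lp 2 w0 \<and> in_Hs (a + 2 * real j * (\<sigma> - \<delta>)) w0 \<and> in_Lp 2 w1 \<and> in_Hs (max (a + 2 * (real j - 1) * \<delta>) 0) w1"
        using w in_Lp_2_of_in_Hs by blast
      note e = est[rule_format, OF w' t]
      show "in_Lp 2 (time_deriv j (\<lambda>s. abs_D a (solution \<sigma> \<delta> w0 w1 s)) t)" by (rule conjunct1[OF e])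
      let ?A = "(1 + t) powr (- (a + real j * \<sigma>) / (2 * \<delta>))" and ?B = "(1 + t) powr (1 - (a + real j * \<sigma>) / (2 * \<delta>))"
      have "Lp_norm 2 (time_deriv j (\<lambda>s. abs_D a (solution \<sigma> \<delta> w0 w1 s)) t)
          \<le> C * (?A * Lm_Hs_norm 2 (a + 2 * real j * (\<sigma> - \<delta>)) w0 + ?B * Lm_Hs_norm 2 (max (a + 2 * (real j - 1) * \<delta>) 0) w1)"
      proof -
        have "- (real CARD('n) / (2 * \<delta>)) * (1 / 2 - 1 / 2) - (a + real j * \<sigma>) / (2 * \<delta>) = - (a + real j * \<sigma>) / (2 * \<delta>)"
          "1 - (real CARD('n) / (2 * \<delta>)) * (1 / 2 - 1 / 2) - (a + real j * \<sigma>) / (2 * \<delta>) = 1 - (a + real j * \<sigma>) / (2 * \<delta>)"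
          by (simp_all only: diff_self mult_zero_right diff_0 diff_0_right minus_divide_left)
        with conjunct2[OF e] show ?thesis by (simp only:)
      qed
      also have "\<dots> \<le> C * (?A * (2 * ?N0 w0) + ?B * (2 * ?N1 w1))"
        using C w s0 by (intro mult_left_mono add_mono Lm_Hs_norm_2_le) auto
      also have "\<dots> = 2 * C * (?A * ?N0 w0 + ?B * ?N1 w1)" by (simp add: algebra_simps)
      finally show "Lp_norm 2 (time_deriv j (\<lambda>s. abs_D a (solution \<sigma> \<delta> w0 w1 s)) t)
          \<le> 2 * C * (?A * ?N0 w0 + ?B * ?N1 w1)" .
    qed
  qed
qed

end
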